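(* Let $0 < \epsilon \leq 1/2$ and let $A \in \mathbb{R}^{d\times d}$ be a positive definite matrix. There is an algorithm that runs in time $O\left(nd\cdot 2^{\tilde{O}(k^2/\epsilon)}\right)$ and gives a $(1+\epsilon)$-approximation to the $k$-median objective function with respect to the Mahalanobis distance $D_A$ for any point set $P \subseteq \mathbb{R}^d$ with $|P| = n$.
   Context: The Mahalanobis distance with respect to a positive definite matrix $A$ is $D_A(p,q) = (p-q)^T A (p-q)$ for $p,q\in\mathbb{R}^d$. The $k$-median objective with respect to $D_A$ is $\Delta(P,C) = \sum_{p\in P}\min_{c\in C} D_A(p,c)$ for a set $C$ of $k$ centers in $\mathbb{R}^d$; a $(1+\epsilon)$-approximation is a set $C$ of $k$ centers whose cost is at most $(1+\epsilon)$ times the minimum possible cost. The $\tilde{O}$ notation hides logarithmic factors in the exponent. The algorithm is randomized and its approximation guarantee holds with high probability. *)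

theory Defs
  imports
    "HOL-Probability.Probability_Mass_Function"
    "Jordan_Normal_Form.Matrix"
begin

section \<open>The Mahalanobis k-median problem\<close>

definition pos_def_mat :: "nat \<Rightarrow> real mat \<Rightarrow> bool" where
  "pos_def_mat d A \<longleftrightarrow>
     A \<in> carrier_mat d d \<and> transpose_mat A = A \<and>
     (\<forall>x \<in> carrier_vec d. x \<noteq> 0\<^sub>v d \<longrightarrow> scalar_prod x (A *\<^sub>v x) > 0)"

definition mahalanobis :: "real mat \<Rightarrow> real vec \<Rightarrow> real vec \<Rightarrow> real" where
  "mahalanobis A p q = scalar_prod (p - q) (A *\<^sub>v (p - q))"

definition kmedian_cost :: "real mat \<Rightarrow> real vec set \<Rightarrow> real vec set \<Rightarrow> real" where
  "kmedian_cost A P C = (\<Sum>p\<in>P. Min ((\<lambda>c. mahalanobis A p c) ` C))"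

text \<open>For \<open>k \<ge> 1\<close> the condition \<open>card C = k\<close> forces \<open>C\<close> to be finite and nonempty, so that
  \<^const>\<open>Min\<close> above is meaningful.\<close>

definition center_sets :: "nat \<Rightarrow> nat \<Rightarrow> real vec set set" where
  "center_sets d k = {C. C \<subseteq> carrier_vec d \<and> card C = k}"

definition opt_cost :: "nat \<Rightarrow> nat \<Rightarrow> real mat \<Rightarrow> real vec set \<Rightarrow> real" where
  "opt_cost d k A P = (INF C\<in>center_sets d k. kmedian_cost A P C)"

definition kmedian_approx ::
  "nat \<Rightarrow> nat \<Rightarrow> real mat \<Rightarrow> real \<Rightarrow> real vec set \<Rightarrow> real vec set \<Rightarrow> bool" where
  "kmedian_approx d k A \<epsilon> P C \<longleftrightarrow>
     C \<in> center_sets d k \<and> kmedian_cost A P C \<le> (1 + \<epsilon>) * opt_cost d k A P"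

section \<open>A randomized real RAM\<close>

text \<open>
  Each of the two sorts \<^typ>\<open>nat\<close> and \<^typ>\<open>real\<close> has registers, which a program addresses by
  literal indices, and an array memory, which it addresses indirectly through natural-number
  registers. As usual for a real RAM, exact arithmetic, comparisons, loads and stores cost one
  step, and real constants may occur in a program. There is no rounding from reals to naturals.
  The only source of randomness is drawing a uniform natural number from an initial segment.
\<close>

record ram_state =
  nreg :: "nat \<Rightarrow> nat"
  rreg :: "nat \<Rightarrow> real"
  nmem :: "nat \<Rightarrow> nat"
  rmem :: "nat \<Rightarrow> real"

datatype arith_op = Plus | Minus | Times

fun arith :: "arith_op \<Rightarrow> 'a::{plus,minus,times} \<Rightarrow> 'a \<Rightarrow> 'a" where
  "arith Plus x y = x + y"
| "arith Minus x y = x - y"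
| "arith Times x y = x * y"

datatype instr =
    NConst nat nat
  | NArith nat arith_op nat nat
  | NLoad nat nat
  | NStore nat nat
  | NRand nat nat
  | RConst nat real
  | RArith nat arith_op nat nat
  | RDiv nat nat nat
  | ROfNat nat nat
  | RLoad nat nat
  | RStore nat nat

fun exec_instr :: "instr \<Rightarrow> ram_state \<Rightarrow> ram_state pmf" where
  "exec_instr (NConst i a) s = return_pmf (s\<lparr>nreg := (nreg s)(i := a)\<rparr>)"
| "exec_instr (NArith i f j l) s =
     return_pmf (s\<lparr>nreg := (nreg s)(i := arith f (nreg s j) (nreg s l))\<rparr>)"
| "exec_instr (NLoad i j) s = return_pmf (s\<lparr>nreg := (nreg s)(i := nmem s (nreg s j))\<rparr>)"
| "exec_instr (NStore i j) s = return_pmf (s\<lparr>nmem := (nmem s)(nreg s i := nreg s j)\<rparr>)"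
| "exec_instr (NRand i j) s =
     map_pmf (\<lambda>r. s\<lparr>nreg := (nreg s)(i := r)\<rparr>) (pmf_of_set {0..nreg s j})"
| "exec_instr (RConst i a) s = return_pmf (s\<lparr>rreg := (rreg s)(i := a)\<rparr>)"
| "exec_instr (RArith i f j l) s =
     return_pmf (s\<lparr>rreg := (rreg s)(i := arith f (rreg s j) (rreg s l))\<rparr>)"
| "exec_instr (RDiv i j l) s = return_pmf (s\<lparr>rreg := (rreg s)(i := rreg s j / rreg s l)\<rparr>)"
| "exec_instr (ROfNat i j) s = return_pmf (s\<lparr>rreg := (rreg s)(i := real (nreg s j))\<rparr>)"
| "exec_instr (RLoad i j) s = return_pmf (s\<lparr>rreg := (rreg s)(i := rmem s (nreg s j))\<rparr>)"
| "exec_instr (RStore i j) s = return_pmf (s\<lparr>rmem := (rmem s)(nreg s i := rreg s j)\<rparr>)"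

datatype test = NLess nat nat | RLess nat nat

fun test_holds :: "test \<Rightarrow> ram_state \<Rightarrow> bool" where
  "test_holds (NLess i j) s \<longleftrightarrow> nreg s i < nreg s j"
| "test_holds (RLess i j) s \<longleftrightarrow> rreg s i < rreg s j"

datatype prog =
    Halt
  | Instr instr
  | Seq prog prog
  | Cond test prog prog
  | While test prog

fun step :: "prog \<times> ram_state \<Rightarrow> (prog \<times> ram_state) pmf" where
  "step (Halt, s) = return_pmf (Halt, s)"
| "step (Instr i, s) = map_pmf (\<lambda>s'. (Halt, s')) (exec_instr i s)"
| "step (Seq p q, s) =
     (if p = Halt then return_pmf (q, s)
      else map_pmf (\<lambda>(p', s'). (Seq p' q, s')) (step (p, s)))"
| "step (Cond b p q, s) = return_pmf (if test_holds b s then p else q, s)"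
| "step (While b p, s) = return_pmf (if test_holds b s then Seq p (While b p) else Halt, s)"

fun run :: "nat \<Rightarrow> prog \<times> ram_state \<Rightarrow> (prog \<times> ram_state) pmf" where
  "run 0 cfg = return_pmf cfg"
| "run (Suc t) cfg = bind_pmf (step cfg) (run t)"

definition halts_within :: "nat \<Rightarrow> prog \<Rightarrow> ram_state \<Rightarrow> bool" where
  "halts_within t p s \<longleftrightarrow> (\<forall>cfg \<in> set_pmf (run t (p, s)). fst cfg = Halt)"

text \<open>Input and output are stored row by row in the real memory, starting at address \<open>0\<close>; the
  first two natural-number registers initially hold the number of points and the number of
  centers, and all other cells are \<open>0\<close>.\<close>

definition input_state :: "nat \<Rightarrow> nat \<Rightarrow> real vec list \<Rightarrow> ram_state" where
  "input_state d k ps =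
     \<lparr> nreg = (\<lambda>_. 0)(0 := length ps, 1 := k),
       rreg = (\<lambda>_. 0),
       nmem = (\<lambda>_. 0),
       rmem = (\<lambda>a. if a < length ps * d then vec_index (ps ! (a div d)) (a mod d) else 0) \<rparr>"

definition output_centers :: "nat \<Rightarrow> nat \<Rightarrow> ram_state \<Rightarrow> real vec set" where
  "output_centers d k s = (\<lambda>i. vec d (\<lambda>j. rmem s (i * d + j))) ` {..<k}"

end

theory Submission
  imports Defs
begin

text \<open>The algorithm repeats independent trials and keeps the best result. A trial finds the \<open>k\<close> centers one by
  one, each as the mean of \<open>M = O(1/\<epsilon>)\<close> random vectors: with equal probability a uniform point, a
  point drawn proportionally to its distance to the current centers, or a current center.

  Call a cluster of an optimal solution covered if its cost is at most \<open>1 + \<beta>\<close> times optimal. As long as the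
  current centers are not good enough, some uncovered cluster carries a fraction \<open>\<Omega>(\<beta>/k)\<close> of the current
  cost. Its light points are much closer to a current center than to the centroid of the cluster, so that moving them
  into that center changes little. Hence, with a probability \<open>\<kappa>^M\<close> where \<open>1/\<kappa>\<close> is
  polynomial in \<open>k/\<epsilon>\<close>, the random vectors behave like a uniform sample from the cluster,
  and then their mean covers the cluster with probability at least \<open>1/2\<close>. A trial thus succeeds with
  probability \<open>2^(-O(k/\<epsilon> log(k/\<epsilon>)))\<close>.

  An exact distance would cost time \<open>d^2\<close>. With \<open>A = B^T B\<close>, the distance \<open>D\<^sub>A(p, q)\<close> is
  the expectation of \<open>(g \<bullet> (p - q))^2\<close> for a random-sign combination \<open>g\<close> of the rows of \<open>B\<close>.
  Averages over \<open>2h^2\<close> such \<open>g\<close>, drawn afresh for every use, have relative error \<open>1/h\<close>.\<close>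

section \<open>Structured programs\<close>

text \<open>The program is fixed before \<open>n\<close>, \<open>k\<close> and the points are known,
  but after \<open>d\<close>, \<open>A\<close>, \<epsilon> and \<delta>. So constants and tables
  that depend on \<open>d\<close> and \<open>A\<close> may be compiled in, whereas parameters that
  depend on \<open>k\<close> (number of rounds, size of a sketch) have to be computed at run time.
  Only the estimated costs of candidate solutions have to be precise: they decide which solution
  survives, and an underestimate in any one of the \<open>T + 1\<close> evaluations could let a bad
  one win. A union bound thus forces \<open>h\<close> to grow with \<open>T\<close>, and the time
  becomes cubic in \<open>T\<close>, which the exponent tolerates. The sampling itself puts up with
  constant-factor errors in the distances. This is why first moments and Markov's inequality suffice
  for the sketches. After the linear map \<open>B\<close> the distance is a squared Euclidean one,
  so centroids are optimal centers. The machine imposes two detours: random numbers are uniform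
  integers, and exactly \<open>k\<close> distinct centers must be output although a trial may
  produce coinciding ones. The abstract random process is analysed separately and tied to the
  program by couplings.\<close>

primrec iterM :: "nat \<Rightarrow> (nat \<Rightarrow> 'a \<Rightarrow> 'a pmf) \<Rightarrow> 'a \<Rightarrow> 'a pmf" where
  "iterM 0 F a = return_pmf a"
| "iterM (Suc m) F a = bind_pmf (iterM m F a) (F m)"

text \<open>\<open>iterM\<close> appends the last round, which suits invariants; unrolling a
  \<open>While\<close> loop requires the first round in front, which is possible as all rounds are
  the same map.\<close>

lemma iterM_front: "iterM (Suc m) (\<lambda>_. f) a = bind_pmf (f a) (iterM m (\<lambda>_. f))"
  by (induction m) (simp_all add: bind_return_pmf bind_return_pmf' bind_assoc_pmf)

datatype cmd = Skip | Ins instr | Sq cmd cmd | Ifc test cmd cmd | For nat nat cmd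

text \<open>Register 5 holds the constant 1 by which loop counters are incremented.\<close>

primrec compile :: "cmd \<Rightarrow> prog" where
  "compile Skip = Halt"
| "compile (Ins i) = Instr i"
| "compile (Sq a b) = Seq (compile a) (compile b)"
| "compile (Ifc t a b) = Cond t (compile a) (compile b)"
| "compile (For i N c) = Seq (Instr (NConst i 0))
     (While (NLess i N) (Seq (compile c) (Seq (Instr (NConst 5 1)) (Instr (NArith i Plus i 5)))))"

definition setn :: "nat \<Rightarrow> nat \<Rightarrow> ram_state \<Rightarrow> ram_state" where
  "setn i a s = s\<lparr>nreg := (nreg s)(i := a)\<rparr>"

lemma setn_simps [simp]:
  "nreg (setn i a s) = (nreg s)(i := a)" "rreg (setn i a s) = rreg s"
  "nmem (setn i a s) = nmem s" "rmem (setn i a s) = rmem s"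
  by (simp_all add: setn_def)

definition incr :: "nat \<Rightarrow> ram_state \<Rightarrow> ram_state" where
  "incr i s = s\<lparr>nreg := (nreg s)(5 := 1, i := Suc (nreg s i))\<rparr>"

text \<open>The bound of a \<open>For\<close> is read once, on entry; the conditions of
  \<open>wfc\<close> make this agree with the compiled \<open>While\<close>.\<close>

primrec sem :: "cmd \<Rightarrow> ram_state \<Rightarrow> ram_state pmf" where
  "sem Skip s = return_pmf s"
| "sem (Ins i) s = exec_instr i s"
| "sem (Sq a b) s = bind_pmf (sem a s) (sem b)"
| "sem (Ifc t a b) s = (if test_holds t s then sem a s else sem b s)"
| "sem (For i N c) s = iterM (nreg s N) (\<lambda>_ s. map_pmf (incr i) (sem c s)) (setn i 0 s)"

text \<open>\<open>\<nu>\<close> supplies the values of the bounding registers, so that the cost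
  does not depend on the random run. Per pass: one step for the test, two hand-overs between
  components and three for the increment; outside the passes: initialization, a hand-over and the
  last test.\<close>

primrec tm :: "(nat \<Rightarrow> nat) \<Rightarrow> cmd \<Rightarrow> nat" where
  "tm \<nu> Skip = 0"
| "tm \<nu> (Ins i) = 1"
| "tm \<nu> (Sq a b) = tm \<nu> a + tm \<nu> b + 1"
| "tm \<nu> (Ifc t a b) = max (tm \<nu> a) (tm \<nu> b) + 1"
| "tm \<nu> (For i N c) = \<nu> N * (tm \<nu> c + 6) + 3"

section \<open>Write sets and the frame property\<close>

fun iwn :: "instr \<Rightarrow> nat set" where
  "iwn (NConst i a) = {i}"
| "iwn (NArith i f j l) = {i}"
| "iwn (NLoad i j) = {i}"
| "iwn (NRand i j) = {i}"
| "iwn _ = {}"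

fun iwr :: "instr \<Rightarrow> nat set" where
  "iwr (RConst i a) = {i}"
| "iwr (RArith i f j l) = {i}"
| "iwr (RDiv i j l) = {i}"
| "iwr (ROfNat i j) = {i}"
| "iwr (RLoad i j) = {i}"
| "iwr _ = {}"

fun iwm :: "instr \<Rightarrow> bool" where
  "iwm (NStore i j) = True"
| "iwm _ = False"

fun iwd :: "instr \<Rightarrow> bool" where
  "iwd (RStore i j) = True"
| "iwd _ = False"

primrec wn :: "cmd \<Rightarrow> nat set" where
  "wn Skip = {}"
| "wn (Ins i) = iwn i"
| "wn (Sq a b) = wn a \<union> wn b"
| "wn (Ifc t a b) = wn a \<union> wn b"
| "wn (For i N c) = {i, 5} \<union> wn c"

primrec wr :: "cmd \<Rightarrow> nat set" where
  "wr Skip = {}"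
| "wr (Ins i) = iwr i"
| "wr (Sq a b) = wr a \<union> wr b"
| "wr (Ifc t a b) = wr a \<union> wr b"
| "wr (For i N c) = wr c"

primrec wm :: "cmd \<Rightarrow> bool" where
  "wm Skip = False"
| "wm (Ins i) = iwm i"
| "wm (Sq a b) = (wm a \<or> wm b)"
| "wm (Ifc t a b) = (wm a \<or> wm b)"
| "wm (For i N c) = wm c"

primrec wd :: "cmd \<Rightarrow> bool" where
  "wd Skip = False"
| "wd (Ins i) = iwd i"
| "wd (Sq a b) = (wd a \<or> wd b)"
| "wd (Ifc t a b) = (wd a \<or> wd b)"
| "wd (For i N c) = wd c"

definition frame :: "cmd \<Rightarrow> ram_state \<Rightarrow> ram_state \<Rightarrow> bool" where
  "frame c s s' \<longleftrightarrow> (\<forall>x. x \<notin> wn c \<longrightarrow> nreg s' x = nreg s x) \<and> (\<forall>x. x \<notin> wr c \<longrightarrow> rreg s' x = rreg s x)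
     \<and> (\<not> wm c \<longrightarrow> nmem s' = nmem s) \<and> (\<not> wd c \<longrightarrow> rmem s' = rmem s)"

lemma incr_simps [simp]:
  "nreg (incr i s) = (nreg s)(5 := 1, i := Suc (nreg s i))" "rreg (incr i s) = rreg s"
  "nmem (incr i s) = nmem s" "rmem (incr i s) = rmem s"
  by (simp_all add: incr_def)

lemma frame_incr: "frame (For i N c) s (incr i s)"
  by (auto simp: frame_def incr_def)

lemma frame_setn: "frame (For i N c) s (setn i 0 s)"
  by (auto simp: frame_def)

lemma frame_body: "frame c s s' \<Longrightarrow> frame (For i N c) s s'"
  by (auto simp: frame_def)

lemma frame_trans: "frame c s s' \<Longrightarrow> frame c s' s'' \<Longrightarrow> frame c s s''"
  by (auto simp: frame_def)

lemma iterM_invariant: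
  assumes "P a" and "\<And>j x y. P x \<Longrightarrow> j < m \<Longrightarrow> y \<in> set_pmf (F j x) \<Longrightarrow> P y"
  shows "y \<in> set_pmf (iterM m F a) \<Longrightarrow> P y"
  using assms(2)
proof (induction m arbitrary: y)
  case 0
  then show ?case using assms(1) by simp
next
  case (Suc m)
  from Suc.prems(1) obtain x where x: "x \<in> set_pmf (iterM m F a)" "y \<in> set_pmf (F m x)"
    by auto
  have "P x"
    by (rule Suc.IH[OF x(1)]) (use Suc.prems(2) less_Suc_eq in blast)
  then show ?case using Suc.prems(2) x(2) by blast
qed

lemma sem_frame: "s' \<in> set_pmf (sem c s) \<Longrightarrow> frame c s s'"
proof (induction c arbitrary: s s')
  case (Ins i)
  then show ?case by (cases i) (auto simp: frame_def)
next
  case (Sq a b)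
  then obtain t where "t \<in> set_pmf (sem a s)" "s' \<in> set_pmf (sem b t)" by auto
  with Sq.IH have "frame a s t" "frame b t s'" by auto
  then show ?case by (auto simp: frame_def)
next
  case (Ifc t a b)
  then have "frame a s s' \<or> frame b s s'" by (auto split: if_splits)
  then show ?case by (auto simp: frame_def)
next
  case (For i N c)
  let ?c = "For i N c"
  show ?case
  proof (rule iterM_invariant[where P = "\<lambda>x. frame ?c s x" and a = "setn i 0 s"])
    show "frame ?c s (setn i 0 s)" by (rule frame_setn)
    show "s' \<in> set_pmf (iterM (nreg s N) (\<lambda>_ s. map_pmf (incr i) (sem c s)) (setn i 0 s))"
      using For.prems by simp
    fix j :: nat and x y
    assume x: "frame ?c s x" and "y \<in> set_pmf (map_pmf (incr i) (sem c x))"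
    then obtain z where z: "z \<in> set_pmf (sem c x)" "y = incr i z" by auto
    have "frame ?c x z" using For.IH[OF z(1)] by (rule frame_body)
    with x have "frame ?c s z" by (rule frame_trans)
    then show "frame ?c s y" unfolding z(2) using frame_incr by (rule frame_trans)
  qed
qed (auto simp: frame_def)

text \<open>The body touches neither the counter nor the bound, and the bound is not register 5, so
  the \<open>While\<close> loop makes exactly as many passes as the value read on entry says. The
  set \<open>K\<close> collects the bounds, on whose values the cost \<open>tm\<close>
  relies.\<close>

primrec wfc :: "nat set \<Rightarrow> cmd \<Rightarrow> bool" where
  "wfc K Skip = True"
| "wfc K (Ins i) = True"
| "wfc K (Sq a b) = (wfc K a \<and> wfc K b)"
| "wfc K (Ifc t a b) = (wfc K a \<and> wfc K b)"
| "wfc K (For i N c) = (wfc K c \<and> N \<in> K \<and> i \<noteq> 5 \<and> i \<noteq> N \<and> N \<noteq> 5 \<and> N \<notin> wn c \<and> i \<notin> wn c)"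

section \<open>Small-step runs and the correctness of compilation\<close>

lemma run_add: "run (t + u) cfg = bind_pmf (run t cfg) (run u)"
  by (induction t arbitrary: cfg)
    (auto simp: bind_return_pmf bind_assoc_pmf intro!: bind_pmf_cong)

lemma run_Halt: "run t (Halt, s) = return_pmf (Halt, s)"
  by (induction t) (simp_all add: bind_return_pmf)

lemma run_halted:
  assumes "halts_within t p s"
  shows "run (t + u) (p, s) = run t (p, s)"
proof -
  have "run (t + u) (p, s) = bind_pmf (run t (p, s)) return_pmf"
    unfolding run_add
    by (rule bind_pmf_cong[OF refl]) (use assms run_Halt in \<open>auto simp: halts_within_def\<close>)
  then show ?thesis by (simp add: bind_return_pmf')
qed

lemma halts_within_0: "halts_within 0 p s \<longleftrightarrow> p = Halt"
  by (simp add: halts_within_def)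

lemma halts_within_Suc:
  "halts_within (Suc t) p s \<longleftrightarrow> (\<forall>(p', s') \<in> set_pmf (step (p, s)). halts_within t p' s')"
  by (auto simp: halts_within_def)

text \<open>The first component halts at a random time. Both phases can still be given fixed
  lengths, because a halted configuration idles: where \<open>p\<close> stops early,
  \<open>q\<close> starts early and waits at the end.\<close>

lemma run_Seq:
  assumes "halts_within t p s" and "\<And>c. c \<in> set_pmf (run t (p, s)) \<Longrightarrow> halts_within t' q (snd c)"
  shows "run (t + 1 + t') (Seq p q, s) = bind_pmf (run t (p, s)) (\<lambda>c. run t' (q, snd c))"
  using assms
proof (induction t arbitrary: p s)
  case 0
  then show ?case by (simp add: halts_within_0 bind_return_pmf)
next
  case (Suc t)
  show ?case
  proof (cases "p = Halt")
    case True
    then have "halts_within t' q s" using Suc.prems(2)[of "(Halt, s)"] by (simp only: run_Halt) simp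
    from run_halted[OF this, of "Suc t"] True show ?thesis
      by (simp only: run_Halt) (simp add: bind_return_pmf add.commute)
  next
    case False
    have "run (Suc t + 1 + t') (Seq p q, s) =
        bind_pmf (step (p, s)) (\<lambda>c. run (t + 1 + t') (Seq (fst c) q, snd c))"
      using False by (simp add: map_pmf_def bind_assoc_pmf bind_return_pmf case_prod_beta)
    also have "\<dots> = bind_pmf (step (p, s)) (\<lambda>c. bind_pmf (run t c) (\<lambda>c. run t' (q, snd c)))"
    proof (rule bind_pmf_cong[OF refl])
      fix c assume c: "c \<in> set_pmf (step (p, s))"
      have "run (t + 1 + t') (Seq (fst c) q, snd c) = bind_pmf (run t (fst c, snd c)) (\<lambda>c. run t' (q, snd c))"
      proof (rule Suc.IH)
        show "halts_within t (fst c) (snd c)" using Suc.prems(1) c by (auto simp: halts_within_Suc)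
        show "halts_within t' q (snd c')" if "c' \<in> set_pmf (run t (fst c, snd c))" for c'
          using Suc.prems(2)[of c'] that c by auto
      qed
      then show "run (t + 1 + t') (Seq (fst c) q, snd c) = bind_pmf (run t c) (\<lambda>c. run t' (q, snd c))"
        by simp
    qed
    finally show ?thesis by (simp add: bind_assoc_pmf)
  qed
qed

text \<open>Holding at a fixed time \<open>t\<close>, this contains halting: every configuration in
  the support has \<open>Halt\<close> as its program. Waiting keeps it true, so \<open>t\<close>
  acts as an upper bound.\<close>

definition impl :: "nat \<Rightarrow> prog \<Rightarrow> ram_state \<Rightarrow> ram_state pmf \<Rightarrow> bool" where
  "impl t p s S \<longleftrightarrow> run t (p, s) = map_pmf (Pair Halt) S"

lemma impl_halts: "impl t p s S \<Longrightarrow> halts_within t p s"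
  by (auto simp: impl_def halts_within_def)

lemma impl_mono: "impl t p s S \<Longrightarrow> t \<le> u \<Longrightarrow> impl u p s S"
  using run_halted[OF impl_halts, of t p s S "u - t"] by (simp add: impl_def)

lemma impl_Seq:
  assumes "impl t p s S" and "\<And>s'. s' \<in> set_pmf S \<Longrightarrow> impl t' q s' (N s')"
  shows "impl (t + 1 + t') (Seq p q) s (bind_pmf S N)"
proof -
  have "run (t + 1 + t') (Seq p q, s) = bind_pmf (run t (p, s)) (\<lambda>c. run t' (q, snd c))"
    by (rule run_Seq) (use assms impl_halts in \<open>auto simp: impl_def\<close>)
  also have "\<dots> = bind_pmf S (\<lambda>s'. map_pmf (Pair Halt) (N s'))"
    using assms by (auto simp: impl_def bind_map_pmf intro: bind_pmf_cong)
  finally show ?thesis by (simp add: impl_def map_bind_pmf)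
qed

lemma impl_While:
  assumes "\<And>s'. s' \<in> set_pmf S \<Longrightarrow> impl u (While b p) s' (N s')" and "impl t p s S" and "test_holds b s"
  shows "impl (t + 2 + u) (While b p) s (bind_pmf S N)"
  using impl_Seq[OF assms(2,1)] assms(3) by (simp add: impl_def bind_return_pmf)

text \<open>Only loops carry content. No register in \<open>K\<close> is ever written, so
  \<open>\<nu>\<close> stays valid from pass to pass, and one cost bound serves all passes whatever
  the random choices.\<close>

lemma impl_comp:
  assumes "wfc K c" and "\<And>x. x \<in> K \<Longrightarrow> nreg s x = \<nu> x" and "K \<inter> wn c = {}"
  shows "impl (tm \<nu> c) (compile c) s (sem c s)"
  using assms
proof (induction c arbitrary: s)
  case Skip
  then show ?case by (simp add: impl_def)
next
  case (Ins i)
  then show ?case by (simp add: impl_def bind_return_pmf' map_pmf_def bind_assoc_pmf bind_return_pmf)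
next
  case (Sq a b)
  have "impl (tm \<nu> a + 1 + tm \<nu> b) (Seq (compile a) (compile b)) s (bind_pmf (sem a s) (sem b))"
  proof (rule impl_Seq)
    show "impl (tm \<nu> a) (compile a) s (sem a s)"
      by (rule Sq.IH) (use Sq.prems in auto)
    fix s' assume "s' \<in> set_pmf (sem a s)"
    then have "frame a s s'" by (rule sem_frame)
    then have "\<And>x. x \<in> K \<Longrightarrow> nreg s' x = \<nu> x" using Sq.prems by (auto simp: frame_def)
    then show "impl (tm \<nu> b) (compile b) s' (sem b s')"
      by (intro Sq.IH) (use Sq.prems in auto)
  qed
  then show ?case by (simp add: add.commute add.left_commute)
next
  case (Ifc t a b)
  have "impl (tm \<nu> a) (compile a) s (sem a s)" "impl (tm \<nu> b) (compile b) s (sem b s)"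
    by (rule Ifc.IH; use Ifc.prems in auto)+
  then have "impl (max (tm \<nu> a) (tm \<nu> b)) (compile a) s (sem a s)"
    "impl (max (tm \<nu> a) (tm \<nu> b)) (compile b) s (sem b s)"
    using impl_mono by auto
  then show ?case by (simp add: impl_def bind_return_pmf)
next
  case (For i N c)
  let ?f = "\<lambda>s. map_pmf (incr i) (sem c s)"
  let ?body = "Seq (compile c) (Seq (Instr (NConst 5 1)) (Instr (NArith i Plus i 5)))"
  have i: "i \<noteq> 5" "i \<noteq> N" "N \<noteq> 5" "N \<notin> wn c" "i \<notin> wn c" "wfc K c" "N \<in> K" "K \<inter> wn c = {}" "i \<notin> K" "5 \<notin> K"
    using For.prems by auto
  have body: "impl (tm \<nu> c + 4) ?body s (?f s)" if K: "\<And>x. x \<in> K \<Longrightarrow> nreg s x = \<nu> x" for s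
  proof -
    have "impl 3 (Seq (Instr (NConst 5 1)) (Instr (NArith i Plus i 5))) s' (return_pmf (incr i s'))" for s'
      using i by (simp add: impl_def numeral_3_eq_3 bind_return_pmf incr_def)
    from impl_Seq[OF For.IH[OF i(6) K i(8)] this] show ?thesis
      by (simp add: map_pmf_def add.commute)
  qed
  \<comment> \<open>Stated for an arbitrary current counter value, since the induction is on the
    number of passes that remain.\<close>
  have loop: "impl (m * (tm \<nu> c + 6) + 1) (While (NLess i N) ?body) s (iterM m (\<lambda>_. ?f) s)"
    if "\<And>x. x \<in> K \<Longrightarrow> nreg s x = \<nu> x" "nreg s i + m = nreg s N" for m s
    using that
  proof (induction m arbitrary: s)
    case 0
    then show ?case by (simp add: impl_def bind_return_pmf)
  next
    case (Suc m)
    have "impl (tm \<nu> c + 4 + 2 + (m * (tm \<nu> c + 6) + 1)) (While (NLess i N) ?body) s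
        (bind_pmf (?f s) (iterM m (\<lambda>_. ?f)))"
    proof (rule impl_While)
      show "impl (tm \<nu> c + 4) ?body s (?f s)" by (rule body[OF Suc.prems(1)])
      show "test_holds (NLess i N) s" using Suc.prems by simp
      fix s' assume "s' \<in> set_pmf (?f s)"
      then obtain s1 where s1: "s1 \<in> set_pmf (sem c s)" "s' = incr i s1" by auto
      then have fr: "\<And>x. x \<notin> wn c \<Longrightarrow> nreg s1 x = nreg s x" using sem_frame by (auto simp: frame_def)
      show "impl (m * (tm \<nu> c + 6) + 1) (While (NLess i N) ?body) s' (iterM m (\<lambda>_. ?f) s')"
      proof (rule Suc.IH)
        show "nreg s' x = \<nu> x" if "x \<in> K" for x
          using that i fr[of x] Suc.prems(1)[of x] s1(2) by (auto simp: incr_def)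
        show "nreg s' i + m = nreg s' N"
          using i fr Suc.prems(2) s1(2) by (auto simp: incr_def)
      qed
    qed
    then show ?case unfolding iterM_front by (simp add: add.commute add.left_commute)
  qed
  have "impl (1 + 1 + (\<nu> N * (tm \<nu> c + 6) + 1)) (compile (For i N c)) s
     (bind_pmf (return_pmf (setn i 0 s)) (iterM (\<nu> N) (\<lambda>_. ?f)))"
    unfolding compile.simps
  proof (rule impl_Seq)
    show "impl 1 (Instr (NConst i 0)) s (return_pmf (setn i 0 s))"
      by (simp add: impl_def bind_return_pmf setn_def)
    fix s' assume "s' \<in> set_pmf (return_pmf (setn i 0 s))"
    then have s': "s' = setn i 0 s" by simp
    show "impl (\<nu> N * (tm \<nu> c + 6) + 1) (While (NLess i N) ?body) s' (iterM (\<nu> N) (\<lambda>_. ?f) s')"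
      by (rule loop) (use i s' For.prems in auto)
  qed
  then show ?case using For.prems by (simp add: bind_return_pmf eval_nat_numeral)
qed

section \<open>Program logic\<close>

definition hoare :: "cmd \<Rightarrow> ram_state \<Rightarrow> (ram_state \<Rightarrow> bool) \<Rightarrow> bool" where
  "hoare c s Q \<longleftrightarrow> (\<forall>s' \<in> set_pmf (sem c s). Q s')"

text \<open>\<open>R a s'\<close> says that the machine state \<open>s'\<close> represents the
  abstract value \<open>a\<close>. A relation is used because neither side determines the other:
  states contain scratch cells, and centers have coordinates that are not stored.\<close>

definition coup :: "cmd \<Rightarrow> ram_state \<Rightarrow> 'a pmf \<Rightarrow> ('a \<Rightarrow> ram_state \<Rightarrow> bool) \<Rightarrow> bool" where
  "coup c s M R \<longleftrightarrow> rel_pmf R M (sem c s)"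

lemma hoare_Skip [simp]: "hoare Skip s Q \<longleftrightarrow> Q s"
  by (simp add: hoare_def)

lemma hoare_Sq [simp]: "hoare (Sq a b) s Q \<longleftrightarrow> hoare a s (\<lambda>s'. hoare b s' Q)"
  by (auto simp: hoare_def)

lemma hoare_Ifc [simp]: "hoare (Ifc t a b) s Q \<longleftrightarrow> (if test_holds t s then hoare a s Q else hoare b s Q)"
  by (auto simp: hoare_def)

lemma hoare_Ins: "hoare (Ins i) s Q \<longleftrightarrow> (\<forall>s' \<in> set_pmf (exec_instr i s). Q s')"
  by (simp add: hoare_def)

lemma hoare_conseq:
  "hoare c s Q \<Longrightarrow> (\<And>s'. Q s' \<Longrightarrow> frame c s s' \<Longrightarrow> Q' s') \<Longrightarrow> hoare c s Q'"
  using sem_frame by (auto simp: hoare_def)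

lemma hoare_For:
  assumes "i \<noteq> 5" "i \<notin> wn c"
    and "Inv 0 (setn i 0 s)"
    and "\<And>j s'. j < nreg s N \<Longrightarrow> Inv j s' \<Longrightarrow> frame (For i N c) s s' \<Longrightarrow> nreg s' i = j \<Longrightarrow>
          hoare c s' (\<lambda>s''. Inv (Suc j) (incr i s''))"
  shows "hoare (For i N c) s (\<lambda>s'. Inv (nreg s N) s')"
proof -
  have "s' \<in> set_pmf (iterM m (\<lambda>_ s. map_pmf (incr i) (sem c s)) (setn i 0 s)) \<Longrightarrow> m \<le> nreg s N \<Longrightarrow>
      Inv m s' \<and> frame (For i N c) s s' \<and> nreg s' i = m" for m s'
  proof (induction m arbitrary: s')
    case 0
    then show ?case using assms(3) frame_setn by simp
  next
    case (Suc m)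
    then obtain s1 s2 where s: "s1 \<in> set_pmf (iterM m (\<lambda>_ s. map_pmf (incr i) (sem c s)) (setn i 0 s))"
      "s2 \<in> set_pmf (sem c s1)" "s' = incr i s2" by auto
    then have IH: "Inv m s1" "frame (For i N c) s s1" "nreg s1 i = m" using Suc by auto
    have "hoare c s1 (\<lambda>s''. Inv (Suc m) (incr i s''))" using assms(4) IH Suc.prems by simp
    then have "Inv (Suc m) s'" using s by (auto simp: hoare_def)
    moreover have fr: "frame c s1 s2" using s by (simp add: sem_frame)
    then have "frame (For i N c) s s'"
      unfolding s(3) using IH(2) frame_trans frame_body frame_incr by blast
    moreover have "nreg s' i = Suc m" using fr assms(1,2) IH(3) s(3) by (auto simp: frame_def incr_def)
    ultimately show ?case by blast
  qed
  then show ?thesis by (auto simp: hoare_def)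
qed

lemma coup_hoare: "hoare c s Q \<Longrightarrow> (\<And>s'. Q s' \<Longrightarrow> R a s') \<Longrightarrow> coup c s (return_pmf a) R"
  by (auto simp: coup_def hoare_def rel_pmf_return_pmf1)

lemma coup_conseq:
  assumes "coup c s M R" "\<And>a s'. a \<in> set_pmf M \<Longrightarrow> R a s' \<Longrightarrow> frame c s s' \<Longrightarrow> R' a s'"
  shows "coup c s M R'"
  using assms unfolding coup_def by (auto intro: pmf.rel_mono_strong dest: sem_frame)

lemma coup_Sq:
  assumes "coup a s M R" "\<And>x s'. x \<in> set_pmf M \<Longrightarrow> R x s' \<Longrightarrow> frame a s s' \<Longrightarrow> coup b s' (N x) R'"
  shows "coup (Sq a b) s (bind_pmf M N) R'"
proof -
  have "rel_pmf (\<lambda>x s'. R x s' \<and> frame a s s' \<and> x \<in> set_pmf M) M (sem a s)"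
    using coup_conseq[OF assms(1), of "\<lambda>x s'. R x s' \<and> frame a s s' \<and> x \<in> set_pmf M"]
    by (simp add: coup_def)
  then show ?thesis unfolding coup_def sem.simps
    by (rule rel_pmf_bindI) (use assms(2) in \<open>auto simp: coup_def\<close>)
qed

lemma coup_hoare_Sq:
  assumes "hoare a s Q" "\<And>s'. Q s' \<Longrightarrow> frame a s s' \<Longrightarrow> coup b s' M R"
  shows "coup (Sq a b) s M R"
proof -
  have "coup a s (return_pmf ()) (\<lambda>_. Q)" using assms(1) by (rule coup_hoare)
  from coup_Sq[OF this, of b "\<lambda>_. M" R] assms(2) show ?thesis by (simp add: bind_return_pmf)
qed

lemma coup_Sq_hoare:
  assumes "coup a s M R" "\<And>x s'. x \<in> set_pmf M \<Longrightarrow> R x s' \<Longrightarrow> frame a s s' \<Longrightarrow> hoare b s' (R' (f x))"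
  shows "coup (Sq a b) s (map_pmf f M) R'"
  unfolding map_pmf_def
  by (rule coup_Sq[OF assms(1)], rule coup_hoare, erule (2) assms(2))

text \<open>\<open>rel_pmf_bindI\<close> glues the couplings of the single rounds. The frame
  condition and the value of the counter travel inside the relation, so that an invariant need only
  mention what changes.\<close>

lemma coup_For:
  assumes "i \<noteq> 5" "i \<notin> wn c"
    and "Inv 0 a (setn i 0 s)"
    and "\<And>j x s'. j < nreg s N \<Longrightarrow> Inv j x s' \<Longrightarrow> frame (For i N c) s s' \<Longrightarrow> nreg s' i = j \<Longrightarrow>
          coup c s' (F j x) (\<lambda>y s''. Inv (Suc j) y (incr i s''))"
  shows "coup (For i N c) s (iterM (nreg s N) F a) (Inv (nreg s N))"
proof -
  have "m \<le> nreg s N \<Longrightarrow> rel_pmf (\<lambda>x s'. Inv m x s' \<and> frame (For i N c) s s' \<and> nreg s' i = m)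
     (iterM m F a) (iterM m (\<lambda>_ s. map_pmf (incr i) (sem c s)) (setn i 0 s))" for m
  proof (induction m)
    case 0
    show ?case unfolding iterM.simps rel_return_pmf using assms(3) frame_setn[of i N c s] by simp
  next
    case (Suc m)
    show ?case unfolding iterM.simps
    proof (rule rel_pmf_bindI[OF Suc.IH])
      show "m \<le> nreg s N" using Suc by simp
      fix x s1 assume IH: "Inv m x s1 \<and> frame (For i N c) s s1 \<and> nreg s1 i = m"
      then have "coup c s1 (F m x) (\<lambda>y s''. Inv (Suc m) y (incr i s''))"
        using assms(4) Suc.prems by simp
      then have "coup c s1 (F m x) (\<lambda>y s2. Inv (Suc m) y (incr i s2) \<and> frame c s1 s2)"
        by (rule coup_conseq) blast
      then have "coup c s1 (F m x) (\<lambda>y s2. Inv (Suc m) y (incr i s2) \<and>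
            frame (For i N c) s (incr i s2) \<and> nreg (incr i s2) i = Suc m)"
      proof (rule coup_conseq)
        fix y s2 assume a: "Inv (Suc m) y (incr i s2) \<and> frame c s1 s2"
        then have "frame (For i N c) s (incr i s2)"
          using IH frame_trans frame_body frame_incr by blast
        moreover have "nreg (incr i s2) i = Suc m"
          using a assms(1,2) IH by (auto simp: frame_def incr_def)
        ultimately show "Inv (Suc m) y (incr i s2) \<and>
            frame (For i N c) s (incr i s2) \<and> nreg (incr i s2) i = Suc m" using a by blast
      qed
      then show "rel_pmf (\<lambda>x s'. Inv (Suc m) x s' \<and> frame (For i N c) s s' \<and> nreg s' i = Suc m)
          (F m x) (map_pmf (incr i) (sem c s1))"
        by (simp add: coup_def pmf.rel_map)
    qed
  qed
  from this[of "nreg s N"] show ?thesis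
    unfolding coup_def sem.simps by (rule pmf.rel_mono_strong) simp_all
qed

section \<open>Expectations over finitely supported distributions\<close>

abbreviation E :: "'a pmf \<Rightarrow> ('a \<Rightarrow> real) \<Rightarrow> real" where
  "E p f \<equiv> measure_pmf.expectation p f"

text \<open>Finite support makes every real function integrable and turns expectations into finite
  sums.\<close>

abbreviation fin :: "'a pmf \<Rightarrow> bool" where
  "fin p \<equiv> finite (set_pmf p)"

definition pr :: "'a pmf \<Rightarrow> ('a \<Rightarrow> bool) \<Rightarrow> real" where
  "pr p P = measure_pmf.prob p {x. P x}"

lemma E_add: "fin p \<Longrightarrow> E p (\<lambda>x. f x + g x) = E p f + E p g"
  by (intro Bochner_Integration.integral_add integrable_measure_pmf_finite)

lemma E_diff: "fin p \<Longrightarrow> E p (\<lambda>x. f x - g x) = E p f - E p g"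
  by (intro Bochner_Integration.integral_diff integrable_measure_pmf_finite)

lemma E_sum: "fin p \<Longrightarrow> E p (\<lambda>x. \<Sum>i\<in>I. f i x) = (\<Sum>i\<in>I. E p (f i))"
  by (intro Bochner_Integration.integral_sum integrable_measure_pmf_finite)

lemma E_mono: "fin p \<Longrightarrow> (\<And>x. x \<in> set_pmf p \<Longrightarrow> f x \<le> g x) \<Longrightarrow> E p f \<le> E p g"
  by (intro integral_mono_AE integrable_measure_pmf_finite) (auto simp: AE_measure_pmf_iff)

lemma E_nonneg: "(\<And>x. x \<in> set_pmf p \<Longrightarrow> 0 \<le> f x) \<Longrightarrow> 0 \<le> E p f"
  by (intro integral_nonneg_AE) (auto simp: AE_measure_pmf_iff)

lemma E_cong: "(\<And>x. x \<in> set_pmf p \<Longrightarrow> f x = g x) \<Longrightarrow> E p f = E p g"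
  by (intro integral_cong_AE) (auto simp: AE_measure_pmf_iff)

lemma E_bind:
  assumes "fin p" "\<And>x. x \<in> set_pmf p \<Longrightarrow> fin (f x)"
  shows "E (bind_pmf p f) g = E p (\<lambda>x. E (f x) g)"
proof -
  have "E (bind_pmf p f) g = (\<Sum>a\<in>set_pmf p. pmf p a *\<^sub>R E (f a) g)"
    by (rule pmf_expectation_bind) (use assms in auto)
  also have "\<dots> = E p (\<lambda>x. E (f x) g)"
    by (rule integral_measure_pmf[symmetric]) (use assms in auto)
  finally show ?thesis .
qed

lemma E_finite: "fin p \<Longrightarrow> E p f = (\<Sum>x\<in>set_pmf p. pmf p x * f x)"
  using integral_measure_pmf[of "set_pmf p" p f] by auto

lemma E_uniform: "finite A \<Longrightarrow> A \<noteq> {} \<Longrightarrow> E (pmf_of_set A) f = (\<Sum>x\<in>A. f x) / card A"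
  by (rule integral_pmf_of_set)

lemma pr_E: "pr p P = E p (\<lambda>x. of_bool (P x))"
proof -
  have "E p (\<lambda>x. of_bool (P x)) = E p (indicat_real {x. P x})"
    by (intro Bochner_Integration.integral_cong) (auto simp: indicator_def)
  then show ?thesis by (simp add: pr_def)
qed

lemma pr_mono: "(\<And>x. x \<in> set_pmf p \<Longrightarrow> P x \<Longrightarrow> Q x) \<Longrightarrow> pr p P \<le> pr p Q"
  unfolding pr_def by (intro measure_pmf.finite_measure_mono_AE) (auto simp: AE_measure_pmf_iff)

lemma pr_nonneg [simp]: "0 \<le> pr p P"
  by (simp add: pr_def)

lemma pr_le_1 [simp]: "pr p P \<le> 1"
  by (simp add: pr_def)

lemma pr_True: "(\<And>x. x \<in> set_pmf p \<Longrightarrow> P x) \<Longrightarrow> pr p P = 1"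
  unfolding pr_def by (rule measure_pmf.prob_eq_1[THEN iffD2]) (auto simp: AE_measure_pmf_iff)

lemma pr_not: "pr p (\<lambda>x. \<not> P x) = 1 - pr p P"
  using measure_pmf.prob_compl[of "{x. P x}" p] by (simp add: pr_def Compl_eq_Diff_UNIV[symmetric] Collect_neg_eq)

lemma pr_disj: "pr p (\<lambda>x. P x \<or> Q x) \<le> pr p P + pr p Q"
  unfolding pr_def Collect_disj_eq by (rule measure_subadditive) auto

lemma pr_return [simp]: "pr (return_pmf a) P = of_bool (P a)"
  by (simp add: pr_E)

lemma pr_bind:
  assumes "fin p" "\<And>x. x \<in> set_pmf p \<Longrightarrow> fin (f x)"
  shows "pr (bind_pmf p f) P = E p (\<lambda>x. pr (f x) P)"
  unfolding pr_E by (rule E_bind[OF assms])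

lemma pr_map: "pr (map_pmf f p) P = pr p (\<lambda>x. P (f x))"
  by (simp add: pr_E)

lemma pr_bind_ge:
  assumes "fin p" "\<And>x. x \<in> set_pmf p \<Longrightarrow> fin (f x)" "0 \<le> c"
    and "\<And>x. x \<in> set_pmf p \<Longrightarrow> P x \<Longrightarrow> c \<le> pr (f x) Q"
  shows "c * pr p P \<le> pr (bind_pmf p f) Q"
proof -
  have "c * pr p P = E p (\<lambda>x. c * of_bool (P x))" by (simp add: pr_E)
  also have "\<dots> \<le> E p (\<lambda>x. pr (f x) Q)"
    by (rule E_mono[OF assms(1)]) (use assms(3,4) in auto)
  finally show ?thesis by (simp add: pr_bind assms)
qed

lemma markov:
  assumes "fin p" "0 < a" "\<And>x. x \<in> set_pmf p \<Longrightarrow> 0 \<le> f x"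
  shows "pr p (\<lambda>x. a \<le> f x) \<le> E p f / a"
proof -
  have "pr p (\<lambda>x. a \<le> f x) \<le> E p (\<lambda>x. f x / a)"
    unfolding pr_E by (rule E_mono[OF assms(1)]) (use assms in \<open>auto simp: divide_nonneg_pos\<close>)
  then show ?thesis by simp
qed

lemma E_eq_0D:
  assumes "fin p" "\<And>x. x \<in> set_pmf p \<Longrightarrow> 0 \<le> f x" "E p f \<le> 0" "x \<in> set_pmf p"
  shows "f x = 0"
proof -
  have "pmf p x * f x \<le> (\<Sum>x\<in>set_pmf p. pmf p x * f x)"
    by (rule member_le_sum) (use assms in auto)
  then have "pmf p x * f x \<le> 0" using assms by (simp add: E_finite)
  moreover have "pmf p x > 0" using assms(4) by (simp add: pmf_positive)
  ultimately show ?thesis using assms(2)[OF assms(4)] by (simp add: mult_le_0_iff)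
qed

text \<open>This is E|f| \<le> sqrt(E f^2), derived from the pointwise 2c|y| \<le> y^2 + c^2.
  Dividing by \<open>c\<close> forces the separate case \<open>c = 0\<close>, where \<open>f\<close>
  vanishes on the support.\<close>

lemma E_abs_le:
  assumes "fin p" "0 \<le> c" "E p (\<lambda>x. (f x)\<^sup>2) \<le> c\<^sup>2"
  shows "E p (\<lambda>x. \<bar>f x\<bar>) \<le> c"
proof (cases "c = 0")
  case True
  then have "(f x)\<^sup>2 = 0" if "x \<in> set_pmf p" for x
    using E_eq_0D[OF assms(1), of "\<lambda>x. (f x)\<^sup>2" x] that assms(3) by simp
  then have "E p (\<lambda>x. \<bar>f x\<bar>) = E p (\<lambda>_. 0)" by (intro E_cong) simp
  then show ?thesis using assms by simp
next
  case False
  then have c: "c > 0" using assms by simp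
  have "\<bar>f x\<bar> \<le> ((f x)\<^sup>2 / c + c) / 2" for x
  proof -
    have "0 \<le> (\<bar>f x\<bar> - c)\<^sup>2" by simp
    then have "2 * \<bar>f x\<bar> * c \<le> (f x)\<^sup>2 + c * c" by (simp add: power2_diff power2_eq_square[of c] algebra_simps)
    then show ?thesis using c by (simp add: field_simps power2_eq_square)
  qed
  then have "E p (\<lambda>x. \<bar>f x\<bar>) \<le> E p (\<lambda>x. ((f x)\<^sup>2 / c + c) / 2)" by (intro E_mono[OF assms(1)])
  also have "\<dots> = (E p (\<lambda>x. (f x)\<^sup>2) / c + c) / 2"
    using assms(1) by (simp add: E_add)
  also have "\<dots> \<le> (c\<^sup>2 / c + c) / 2"
    using assms(3) c by (intro divide_right_mono add_right_mono) auto
  finally show ?thesis using c by (simp add: power2_eq_square)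
qed

section \<open>Independent repetitions\<close>

lemma fin_iterM: "(\<And>j x. fin (F j x)) \<Longrightarrow> fin (iterM m F a)"
  by (induction m) auto

text \<open>Defined through \<open>iterM\<close>, so that the loop rule for couplings applies
  directly to repeated sampling.\<close>

definition reps :: "nat \<Rightarrow> 'a pmf \<Rightarrow> 'a list pmf" where
  "reps m p = iterM m (\<lambda>_ xs. map_pmf (\<lambda>x. xs @ [x]) p) []"

lemma reps_0: "reps 0 p = return_pmf []"
  by (simp add: reps_def)

lemma reps_Suc: "reps (Suc m) p = bind_pmf (reps m p) (\<lambda>xs. map_pmf (\<lambda>x. xs @ [x]) p)"
  by (simp add: reps_def)

lemma fin_reps [simp]: "fin p \<Longrightarrow> fin (reps m p)"
  unfolding reps_def by (rule fin_iterM) simp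

lemma set_reps: "xs \<in> set_pmf (reps m p) \<Longrightarrow> length xs = m \<and> set xs \<subseteq> set_pmf p"
  by (induction m arbitrary: xs) (fastforce simp: reps_0 reps_Suc)+

lemma E_reps_Suc: "fin p \<Longrightarrow> E (reps (Suc m) p) f = E (reps m p) (\<lambda>xs. E p (\<lambda>x. f (xs @ [x])))"
  by (simp add: reps_Suc E_bind)

lemma E_reps_sum:
  "fin p \<Longrightarrow> E (reps m p) (\<lambda>xs. sum_list (map f xs)) = m * E p f"
  by (induction m) (simp_all add: reps_0 E_reps_Suc E_add algebra_simps)

text \<open>Independence: for a fixed past, the cross term is a multiple of the centered variable
  \<open>f x - E p f\<close>, whose mean is zero, so variances add.\<close>

lemma E_reps_variance:
  assumes "fin p"
  shows "E (reps m p) (\<lambda>xs. (sum_list (map f xs) - m * E p f)\<^sup>2) = m * E p (\<lambda>x. (f x - E p f)\<^sup>2)"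
proof (induction m)
  case 0
  then show ?case by (simp add: reps_0)
next
  case (Suc m)
  define \<mu> where "\<mu> = E p f"
  define V where "V = E p (\<lambda>x. (f x - \<mu>)\<^sup>2)"
  have "E p (\<lambda>x. (sum_list (map f (xs @ [x])) - Suc m * \<mu>)\<^sup>2) = (sum_list (map f xs) - m * \<mu>)\<^sup>2 + V" for xs
  proof -
    define a where "a = sum_list (map f xs) - m * \<mu>"
    have "E p (\<lambda>x. (sum_list (map f (xs @ [x])) - Suc m * \<mu>)\<^sup>2)
        = E p (\<lambda>x. a\<^sup>2 + (2 * a * (f x - \<mu>) + (f x - \<mu>)\<^sup>2))"
      by (rule E_cong) (simp add: a_def power2_eq_square algebra_simps)
    also have "\<dots> = a\<^sup>2 + (2 * a * (E p f - \<mu>) + V)"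
      using assms by (simp add: E_add E_diff V_def)
    finally show ?thesis by (simp add: a_def \<mu>_def)
  qed
  then show ?case using Suc assms
    by (simp add: E_reps_Suc E_add \<mu>_def V_def algebra_simps)
qed

section \<open>Random-sign sketches\<close>

text \<open>The binary digits of a number uniform below \<open>2 ^ d\<close> are \<open>d\<close>
  independent signs; a row of the sketch matrix is thus determined by one number.\<close>

definition sg :: "nat \<Rightarrow> nat \<Rightarrow> real" where
  "sg x q = (if odd (x div 2 ^ q) then 1 else - 1)"

lemma sum_double: "(\<Sum>x<2 * m. f x) = (\<Sum>y<m. f (2 * y) + f (2 * y + 1))" for m :: nat and f :: "nat \<Rightarrow> real"
  by (induction m) (simp_all add: algebra_simps)

definition signed_sum :: "nat \<Rightarrow> (nat \<Rightarrow> real) \<Rightarrow> nat \<Rightarrow> real" where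
  "signed_sum m a x = (\<Sum>q<m. sg x q * a q)"

lemma signed_sum_Suc:
  "signed_sum (Suc m) a (2 * y) = signed_sum m (a \<circ> Suc) y - a 0"
  "signed_sum (Suc m) a (2 * y + 1) = signed_sum m (a \<circ> Suc) y + a 0"
proof -
  have "sg (2 * y) (Suc q) = sg y q" "sg (2 * y + 1) (Suc q) = sg y q" for q
    by (simp_all add: sg_def div_mult2_eq)
  moreover have "sg (2 * y) 0 = -1" "sg (2 * y + 1) 0 = 1" by (simp_all add: sg_def)
  ultimately show "signed_sum (Suc m) a (2 * y) = signed_sum m (a \<circ> Suc) y - a 0"
    "signed_sum (Suc m) a (2 * y + 1) = signed_sum m (a \<circ> Suc) y + a 0"
    by (simp_all add: signed_sum_def sum.lessThan_Suc_shift del: sum.lessThan_Suc)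
qed

text \<open>Induction on the lowest binary digit of \<open>x\<close>: the values z - b and z + b
  occur in pairs, and their cross terms cancel.\<close>

lemma signed_sum_square: "(\<Sum>x<2 ^ m. (signed_sum m a x)\<^sup>2) = 2 ^ m * (\<Sum>q<m. (a q)\<^sup>2)"
proof (induction m arbitrary: a)
  case 0
  then show ?case by (simp add: signed_sum_def)
next
  case (Suc m)
  have "(\<Sum>x<2 ^ Suc m. (signed_sum (Suc m) a x)\<^sup>2)
      = (\<Sum>y<2 ^ m. 2 * (signed_sum m (a \<circ> Suc) y)\<^sup>2 + 2 * (a 0)\<^sup>2)"
    unfolding power_Suc sum_double signed_sum_Suc
    by (intro sum.cong refl) (simp add: power2_eq_square algebra_simps)
  also have "\<dots> = 2 ^ Suc m * ((\<Sum>q<m. ((a \<circ> Suc) q)\<^sup>2) + (a 0)\<^sup>2)"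
    by (simp add: sum.distrib sum_distrib_left[symmetric] Suc.IH algebra_simps)
  finally show ?case by (simp add: sum.lessThan_Suc_shift del: sum.lessThan_Suc)
qed

text \<open>Khintchine's inequality for fourth powers. A pair contributes 2z^4 + 12 b^2 z^2 + 2b^4,
  and 3(S + b^2)^2 leaves room for this with 4b^4 to spare per pair on average.\<close>

lemma signed_sum_fourth: "(\<Sum>x<2 ^ m. (signed_sum m a x) ^ 4) \<le> 2 ^ m * (3 * (\<Sum>q<m. (a q)\<^sup>2)\<^sup>2)"
proof (induction m arbitrary: a)
  case 0
  then show ?case by (simp add: signed_sum_def)
next
  case (Suc m)
  define S where "S = (\<Sum>q<m. ((a \<circ> Suc) q)\<^sup>2)"
  have S: "(\<Sum>q<Suc m. (a q)\<^sup>2) = S + (a 0)\<^sup>2"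
    by (simp add: S_def sum.lessThan_Suc_shift del: sum.lessThan_Suc)
  have IH: "(\<Sum>y<2 ^ m. (signed_sum m (a \<circ> Suc) y) ^ 4) \<le> 2 ^ m * (3 * S\<^sup>2)"
    unfolding S_def by (rule Suc.IH)
  have four: "(z - b) ^ 4 + (z + b) ^ 4 = 2 * z ^ 4 + 12 * b\<^sup>2 * z\<^sup>2 + 2 * b ^ 4" for z b :: real
    by (simp add: power2_eq_square power4_eq_xxxx algebra_simps)
  have "(\<Sum>x<2 ^ Suc m. (signed_sum (Suc m) a x) ^ 4)
      = (\<Sum>y<2 ^ m. 2 * (signed_sum m (a \<circ> Suc) y) ^ 4 + 12 * (a 0)\<^sup>2 * (signed_sum m (a \<circ> Suc) y)\<^sup>2 + 2 * (a 0) ^ 4)"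
    unfolding power_Suc[of 2] sum_double signed_sum_Suc by (intro sum.cong refl four)
  also have "\<dots> = 2 * (\<Sum>y<2 ^ m. (signed_sum m (a \<circ> Suc) y) ^ 4) + 2 ^ m * (12 * (a 0)\<^sup>2 * S + 2 * (a 0) ^ 4)"
    by (simp add: sum.distrib sum_distrib_left[symmetric] signed_sum_square S_def algebra_simps)
  also have "\<dots> \<le> 2 * (2 ^ m * (3 * S\<^sup>2)) + 2 ^ m * (12 * (a 0)\<^sup>2 * S + 2 * (a 0) ^ 4)"
    by (intro add_right_mono mult_left_mono IH) simp
  also have "\<dots> \<le> 2 ^ Suc m * (3 * (S + (a 0)\<^sup>2)\<^sup>2)"
  proof -
    have "2 ^ Suc m * (3 * (S + (a 0)\<^sup>2)\<^sup>2) - (2 * (2 ^ m * (3 * S\<^sup>2)) + 2 ^ m * (12 * (a 0)\<^sup>2 * S + 2 * (a 0) ^ 4))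
        = 2 ^ m * (4 * (a 0) ^ 4)"
      by (simp add: power2_eq_square power4_eq_xxxx algebra_simps)
    moreover have "0 \<le> 2 ^ m * (4 * (a 0) ^ 4)" by simp
    ultimately show ?thesis by linarith
  qed
  finally show ?case unfolding S .
qed

section \<open>The algorithm\<close>

text \<open>Points and centers are functions of the coordinate, of which only the first \<open>d\<close> values matter.
  \<open>B\<close> is a factor of the matrix, so that \<open>D\<close> is the Mahalanobis distance, and \<open>s\<close>
  is the number of rows of a sketch.\<close>

definition sketch_row :: "nat \<Rightarrow> (nat \<Rightarrow> nat \<Rightarrow> real) \<Rightarrow> nat \<Rightarrow> nat \<Rightarrow> real" where
  "sketch_row d B x j = (\<Sum>q<d. sg x q * B q j)"

type_synonym point = "nat \<Rightarrow> real"
type_synonym centers = "nat \<Rightarrow> point"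

locale clustering =
  fixes d n k s M :: nat and B :: "nat \<Rightarrow> nat \<Rightarrow> real" and X :: "nat \<Rightarrow> point"
  assumes n_pos: "n \<ge> 1" and k_pos: "k \<ge> 1"
begin

definition lin :: "nat \<Rightarrow> point \<Rightarrow> real" where
  "lin q u = (\<Sum>j<d. B q j * u j)"

definition D :: "point \<Rightarrow> point \<Rightarrow> real" where
  "D u v = (\<Sum>q<d. (lin q u - lin q v)\<^sup>2)"

definition proj :: "nat \<Rightarrow> point \<Rightarrow> point \<Rightarrow> real" where
  "proj x u v = (\<Sum>j<d. sketch_row d B x j * (u j - v j))"

text \<open>Not divided by the number of rows: it approximates \<open>s * D u v\<close>, and only
  quotients and comparisons of such values matter.\<close>

definition est :: "nat list \<Rightarrow> point \<Rightarrow> point \<Rightarrow> real" where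
  "est xs u v = sum_list (map (\<lambda>x. (proj x u v)\<^sup>2) xs)"

definition wt :: "nat list \<Rightarrow> centers \<Rightarrow> nat \<Rightarrow> real" where
  "wt xs C p = Min ((\<lambda>l. est xs (X p) (C l)) ` {..<k})"

definition w :: "centers \<Rightarrow> nat \<Rightarrow> real" where
  "w C p = Min ((\<lambda>l. D (X p) (C l)) ` {..<k})"

definition cum :: "nat list \<Rightarrow> centers \<Rightarrow> nat \<Rightarrow> real" where
  "cum xs C m = (\<Sum>p<m. wt xs C p)"

definition bits :: "nat pmf" where
  "bits = pmf_of_set {0..2 ^ d - 1}"

definition sk :: "nat list pmf" where
  "sk = reps s bits"

text \<open>Inversion of the distribution function at the level r/n: the result is the first point
  whose prefix sum exceeds that share of the total. Products replace the division. If all weights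
  are zero the count is \<open>n\<close>, which denotes the first current center.\<close>

definition pick :: "nat list \<Rightarrow> centers \<Rightarrow> nat \<Rightarrow> nat" where
  "pick xs C r = card {p. p < n \<and> real n * cum xs C (Suc p) \<le> real r * cum xs C n}"

text \<open>A sampled row is either a point (\<open>< n\<close>) or a current center (\<open>n + l\<close>).\<close>

definition sample :: "centers \<Rightarrow> nat pmf" where
  "sample C = bind_pmf sk (\<lambda>xs. bind_pmf (pmf_of_set {0..2}) (\<lambda>m::nat.
     bind_pmf (pmf_of_set {0..n - 1}) (\<lambda>r. map_pmf (\<lambda>l.
       if m = 0 then r else if m = 1 then pick xs C r else n + l) (pmf_of_set {0..k - 1}))))"

definition row :: "centers \<Rightarrow> nat \<Rightarrow> point" where
  "row C r = (if r < n then X r else C (r - n))"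

definition mean :: "centers \<Rightarrow> nat list \<Rightarrow> point" where
  "mean C rs = (\<lambda>j. sum_list (map (\<lambda>r. row C r j) rs) / M)"

text \<open>Filling all slots from \<open>i\<close> on keeps \<open>k\<close> slots throughout, with
  copies in those that are not decided yet; copies do not affect minimal distances.\<close>

definition stage :: "nat \<Rightarrow> centers \<Rightarrow> centers pmf" where
  "stage i C = map_pmf (\<lambda>rs l. if l < i then C l else mean C rs) (reps M (sample C))"

definition trial :: "centers \<Rightarrow> centers pmf" where
  "trial C = iterM k stage C"

definition total :: "centers \<Rightarrow> real pmf" where
  "total C = map_pmf (\<lambda>xs. cum xs C n) sk"

text \<open>The components are the current centers, the best ones and the estimated cost of the
  latter. A trial starts from whatever the previous one left, as its guarantee holds for every
  start.\<close>

definition round :: "centers \<times> centers \<times> real \<Rightarrow> (centers \<times> centers \<times> real) pmf" where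
  "round st = bind_pmf (trial (fst st)) (\<lambda>C. map_pmf (\<lambda>v.
     if v < snd (snd st) then (C, C, v) else (C, snd st)) (total C))"

definition search :: "nat \<Rightarrow> centers \<Rightarrow> (centers \<times> centers \<times> real) pmf" where
  "search T C = bind_pmf (total C) (\<lambda>v. iterM T (\<lambda>_. round) (C, C, v))"

lemma fin_bits [simp]: "fin bits"
  by (simp add: bits_def)

lemma fin_sk [simp]: "fin sk"
  by (simp add: sk_def)

lemma fin_sample [simp]: "fin (sample C)"
  by (simp add: sample_def)

lemma fin_stage [simp]: "fin (stage i C)"
  by (simp add: stage_def)

lemma fin_trial [simp]: "fin (trial C)"
  unfolding trial_def by (rule fin_iterM) simp

lemma fin_total [simp]: "fin (total C)"
  by (simp add: total_def)

lemma fin_round [simp]: "fin (round st)"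
  by (simp add: round_def)

lemma D_nonneg [simp]: "0 \<le> D u v"
  by (simp add: D_def sum_nonneg)

lemma est_nonneg [simp]: "0 \<le> est xs u v"
  unfolding est_def by (intro sum_list_nonneg) auto

lemma k_nonempty [simp]: "{..<k} \<noteq> {}"
  using k_pos lessThan_empty_iff[of k] by linarith

lemma w_le: "l < k \<Longrightarrow> w C p \<le> D (X p) (C l)"
  unfolding w_def by (rule Min_le) auto

lemma w_attained: "\<exists>l<k. w C p = D (X p) (C l)"
proof -
  have "w C p \<in> (\<lambda>l. D (X p) (C l)) ` {..<k}" unfolding w_def by (rule Min_in) auto
  then show ?thesis by auto
qed

lemma wt_le: "l < k \<Longrightarrow> wt xs C p \<le> est xs (X p) (C l)"
  unfolding wt_def by (rule Min_le) auto

lemma wt_attained: "\<exists>l<k. wt xs C p = est xs (X p) (C l)"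
proof -
  have "wt xs C p \<in> (\<lambda>l. est xs (X p) (C l)) ` {..<k}" unfolding wt_def by (rule Min_in) auto
  then show ?thesis by auto
qed

lemma w_nonneg [simp]: "0 \<le> w C p"
  using w_attained[of C p] by auto

lemma wt_nonneg [simp]: "0 \<le> wt xs C p"
  using wt_attained[of xs C p] by auto

section \<open>Accuracy of the sketches\<close>

lemma proj_signed_sum: "proj x u v = signed_sum d (\<lambda>q. lin q u - lin q v) x"
proof -
  have "proj x u v = (\<Sum>j<d. \<Sum>q<d. sg x q * (B q j * u j - B q j * v j))"
    unfolding proj_def sketch_row_def sum_distrib_right
    by (intro sum.cong refl) (simp add: algebra_simps)
  also have "\<dots> = (\<Sum>q<d. \<Sum>j<d. sg x q * (B q j * u j - B q j * v j))"
    by (rule sum.swap)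
  finally show ?thesis
    by (simp add: signed_sum_def lin_def sum_subtractf[symmetric] sum_distrib_left)
qed

lemma E_sign: "E bits f = (\<Sum>x<2 ^ d. f x) / 2 ^ d"
proof -
  obtain m where m: "2 ^ d = Suc m" using gr0_conv_Suc[of "2 ^ d :: nat"] by auto
  have "{0..2 ^ d - 1} = {..<2 ^ d :: nat}" unfolding m by auto
  then show ?thesis unfolding bits_def by (subst E_uniform) auto
qed

lemma E_proj: "E bits (\<lambda>x. (proj x u v)\<^sup>2) = D u v"
  unfolding E_sign proj_signed_sum signed_sum_square D_def by simp

lemma E_proj_fourth: "E bits (\<lambda>x. (proj x u v) ^ 4) \<le> 3 * (D u v)\<^sup>2"
  using signed_sum_fourth[of d "\<lambda>q. lin q u - lin q v"]
  unfolding E_sign proj_signed_sum D_def by (simp add: divide_le_eq mult.commute)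

text \<open>The fourth moment is at most three times the squared mean, so a single squared
  projection has variance at most twice the squared mean.\<close>

lemma E_est_variance: "E sk (\<lambda>xs. (est xs u v - s * D u v)\<^sup>2) \<le> 2 * s * (D u v)\<^sup>2"
proof -
  let ?U = bits
  have *: "E sk (\<lambda>xs. (est xs u v - s * D u v)\<^sup>2) = s * E ?U (\<lambda>x. ((proj x u v)\<^sup>2 - D u v)\<^sup>2)"
    using E_reps_variance[of ?U s "\<lambda>x. (proj x u v)\<^sup>2"] by (simp add: sk_def est_def E_proj)
  have "E ?U (\<lambda>x. ((proj x u v)\<^sup>2 - D u v)\<^sup>2)
      = E ?U (\<lambda>x. (proj x u v) ^ 4 - 2 * D u v * (proj x u v)\<^sup>2 + (D u v)\<^sup>2)"
    by (rule E_cong) (simp add: power2_eq_square power4_eq_xxxx algebra_simps)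
  also have "\<dots> = E ?U (\<lambda>x. (proj x u v) ^ 4) - 2 * D u v * D u v + (D u v)\<^sup>2"
    by (simp add: E_add E_diff E_proj)
  also have "\<dots> \<le> 2 * (D u v)\<^sup>2"
    using E_proj_fourth[of u v] by (simp add: power2_eq_square)
  finally have "s * E ?U (\<lambda>x. ((proj x u v)\<^sup>2 - D u v)\<^sup>2) \<le> s * (2 * (D u v)\<^sup>2)"
    by (rule mult_left_mono) simp
  then show ?thesis unfolding * by (simp only: mult.assoc mult.left_commute)
qed

text \<open>With \<open>s = 2h\<^sup>2\<close> the relative standard deviation of an estimate is \<open>1/h\<close>.\<close>

lemma E_est_abs:
  assumes "s = 2 * h\<^sup>2"
  shows "E sk (\<lambda>xs. \<bar>est xs u v - s * D u v\<bar>) \<le> 2 * real h * D u v"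
proof (rule E_abs_le)
  have "E sk (\<lambda>xs. (est xs u v - s * D u v)\<^sup>2) \<le> 2 * s * (D u v)\<^sup>2" by (rule E_est_variance)
  also have "\<dots> = (2 * real h * D u v)\<^sup>2" using assms by (simp add: power2_eq_square)
  finally show "E sk (\<lambda>xs. (est xs u v - s * D u v)\<^sup>2) \<le> (2 * real h * D u v)\<^sup>2" .
qed auto

lemma D_0_est: "D u v = 0 \<Longrightarrow> est xs u v = 0"
proof -
  assume "D u v = 0"
  then have "lin q u - lin q v = 0" if "q < d" for q
    using that by (auto simp: D_def sum_nonneg_eq_0_iff)
  then have "proj x u v = 0" for x by (auto simp: proj_signed_sum signed_sum_def)
  then show ?thesis by (simp add: est_def)
qed

text \<open>A minimum over noisy values must not inherit the error at distant centers, which can be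
  far larger than \<open>w C p\<close>. The factor w/D, at most 1, scales each error down to the
  size of \<open>w C p\<close>. The upper estimate compares with the true nearest center, the lower
  one with the center that looks nearest.\<close>

lemma wt_deviation:
  "\<bar>wt xs C p - s * w C p\<bar> \<le> (\<Sum>l<k. w C p / D (X p) (C l) * \<bar>est xs (X p) (C l) - s * D (X p) (C l)\<bar>)"
    (is "_ \<le> (\<Sum>l<k. ?t l)")
proof -
  have t: "?t l \<le> (\<Sum>l<k. ?t l)" if "l < k" for l
    by (rule member_le_sum) (use that in auto)
  then have nonneg: "0 \<le> (\<Sum>l<k. ?t l)" by (intro sum_nonneg) auto
  obtain a where a: "a < k" "w C p = D (X p) (C a)" using w_attained by blast
  obtain b where b: "b < k" "wt xs C p = est xs (X p) (C b)" using wt_attained by blast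
  have "wt xs C p - s * w C p \<le> est xs (X p) (C a) - s * D (X p) (C a)"
    using wt_le[OF a(1)] a(2) by simp
  also have "\<dots> \<le> ?t a"
  proof (cases "D (X p) (C a) = 0")
    case True
    then show ?thesis by (simp add: D_0_est)
  next
    case False
    then show ?thesis using a by simp
  qed
  finally have up: "wt xs C p - s * w C p \<le> (\<Sum>l<k. ?t l)" using t[OF a(1)] by simp
  have "s * w C p - wt xs C p \<le> (\<Sum>l<k. ?t l)"
  proof (cases "D (X p) (C b) = 0")
    case True
    then have "w C p = 0" using w_le[OF b(1), of C p] w_nonneg[of C p] by simp
    then show ?thesis using nonneg wt_nonneg[of xs C p] by simp
  next
    case False
    then have D: "D (X p) (C b) > 0" using D_nonneg[of "X p" "C b"] by linarith
    define r where "r = w C p / D (X p) (C b)"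
    have r: "0 \<le> r" "r \<le> 1" "w C p = r * D (X p) (C b)"
      using w_le[OF b(1), of C p] D by (auto simp: r_def)
    have "s * w C p - wt xs C p \<le> r * (s * D (X p) (C b)) - r * est xs (X p) (C b)"
      using r b(2) mult_right_mono[OF r(2), of "est xs (X p) (C b)"] by simp
    also have "\<dots> \<le> r * \<bar>est xs (X p) (C b) - s * D (X p) (C b)\<bar>"
      unfolding right_diff_distrib[symmetric] by (intro mult_left_mono r) auto
    finally show ?thesis using t[OF b(1)] by (simp add: r_def)
  qed
  with up show ?thesis by linarith
qed

text \<open>The weights w/D cancel the growth of the errors with the distance, so each of the
  \<open>k\<close> centers contributes at most \<open>2 * real h * w C p\<close>. Relative to
  \<open>s * w C p\<close> the error is k/h.\<close>

lemma E_wt: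
  assumes "s = 2 * h\<^sup>2"
  shows "E sk (\<lambda>xs. \<bar>wt xs C p - s * w C p\<bar>) \<le> 2 * real h * k * w C p"
proof -
  have "E sk (\<lambda>xs. \<bar>wt xs C p - s * w C p\<bar>)
      \<le> E sk (\<lambda>xs. \<Sum>l<k. w C p / D (X p) (C l) * \<bar>est xs (X p) (C l) - s * D (X p) (C l)\<bar>)"
    by (intro E_mono wt_deviation) simp
  also have "\<dots> = (\<Sum>l<k. w C p / D (X p) (C l) * E sk (\<lambda>xs. \<bar>est xs (X p) (C l) - s * D (X p) (C l)\<bar>))"
    by (simp add: E_sum)
  also have "\<dots> \<le> (\<Sum>l<k. 2 * real h * w C p)"
  proof (rule sum_mono)
    fix l assume l: "l \<in> {..<k}"
    have "w C p / D (X p) (C l) * E sk (\<lambda>xs. \<bar>est xs (X p) (C l) - s * D (X p) (C l)\<bar>)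
        \<le> w C p / D (X p) (C l) * (2 * real h * D (X p) (C l))"
      by (intro mult_left_mono E_est_abs[OF assms]) auto
    also have "\<dots> \<le> 2 * real h * w C p" by (cases "D (X p) (C l) = 0") auto
    finally show "w C p / D (X p) (C l) * E sk (\<lambda>xs. \<bar>est xs (X p) (C l) - s * D (X p) (C l)\<bar>) \<le> 2 * real h * w C p" .
  qed
  finally show ?thesis by (simp add: algebra_simps)
qed

definition W :: "centers \<Rightarrow> real" where
  "W C = (\<Sum>p<n. w C p)"

lemma W_nonneg [simp]: "0 \<le> W C"
  by (simp add: W_def sum_nonneg)

lemma cum_nonneg [simp]: "0 \<le> cum xs C m"
  by (simp add: cum_def sum_nonneg)

lemma E_cum:
  assumes "s = 2 * h\<^sup>2"
  shows "E sk (\<lambda>xs. \<bar>cum xs C n - s * W C\<bar>) \<le> 2 * real h * k * W C"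
proof -
  have "\<bar>cum xs C n - s * W C\<bar> \<le> (\<Sum>p<n. \<bar>wt xs C p - s * w C p\<bar>)" for xs
    unfolding cum_def W_def sum_distrib_left sum_subtractf[symmetric] by (rule sum_abs)
  then have "E sk (\<lambda>xs. \<bar>cum xs C n - s * W C\<bar>) \<le> E sk (\<lambda>xs. \<Sum>p<n. \<bar>wt xs C p - s * w C p\<bar>)"
    by (intro E_mono) auto
  also have "\<dots> = (\<Sum>p<n. E sk (\<lambda>xs. \<bar>wt xs C p - s * w C p\<bar>))" by (simp add: E_sum)
  also have "\<dots> \<le> (\<Sum>p<n. 2 * real h * k * w C p)" by (intro sum_mono E_wt[OF assms])
  finally show ?thesis by (simp add: W_def sum_distrib_left)
qed

end

section \<open>Sampling\<close>

context clustering
begin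

lemma sketch_wt_half:
  assumes "s = 2 * h\<^sup>2" "h \<ge> 1" "w C p > 0"
  shows "pr sk (\<lambda>xs. wt xs C p < s * w C p / 2) \<le> 2 * k / h"
proof -
  have h: "real h > 0" using assms by simp
  have "pr sk (\<lambda>xs. wt xs C p < s * w C p / 2) \<le> pr sk (\<lambda>xs. (real h)\<^sup>2 * w C p \<le> \<bar>wt xs C p - s * w C p\<bar>)"
    by (rule pr_mono) (auto simp: assms(1))
  also have "\<dots> \<le> E sk (\<lambda>xs. \<bar>wt xs C p - s * w C p\<bar>) / ((real h)\<^sup>2 * w C p)"
    by (rule markov) (use assms(3) h in auto)
  also have "\<dots> \<le> 2 * real h * k * w C p / ((real h)\<^sup>2 * w C p)"
    by (rule divide_right_mono[OF E_wt[OF assms(1)]]) (use assms in auto)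
  also have "\<dots> = 2 * k / h" using assms h by (simp add: power2_eq_square)
  finally show ?thesis .
qed

lemma sketch_cum_double:
  assumes "s = 2 * h\<^sup>2" "h \<ge> 1" "W C > 0"
  shows "pr sk (\<lambda>xs. cum xs C n > 2 * s * W C) \<le> k / h"
proof -
  have h: "real h > 0" using assms by simp
  have "pr sk (\<lambda>xs. cum xs C n > 2 * s * W C) \<le> pr sk (\<lambda>xs. 2 * (real h)\<^sup>2 * W C \<le> \<bar>cum xs C n - s * W C\<bar>)"
    by (rule pr_mono) (auto simp: assms(1))
  also have "\<dots> \<le> E sk (\<lambda>xs. \<bar>cum xs C n - s * W C\<bar>) / (2 * (real h)\<^sup>2 * W C)"
    by (rule markov) (use assms(3) h in auto)
  also have "\<dots> \<le> 2 * real h * k * W C / (2 * (real h)\<^sup>2 * W C)"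
    by (rule divide_right_mono[OF E_cum[OF assms(1)]]) (use assms in auto)
  also have "\<dots> = k / h" using assms h by (simp add: power2_eq_square)
  finally show ?thesis .
qed

text \<open>Markov's inequality for the mean absolute error. It cannot divide by a zero cost, but
  then the mean error is zero and the estimate is exact on the whole support.\<close>

lemma total_accurate:
  fixes \<tau> :: real
  assumes "s = 2 * h\<^sup>2" "h \<ge> 1" "\<tau> > 0"
  shows "pr (total C) (\<lambda>v. \<not> ((1 - \<tau>) * s * W C \<le> v \<and> v \<le> (1 + \<tau>) * s * W C)) \<le> k / (h * \<tau>)"
proof (cases "W C = 0")
  case True
  have "\<bar>cum xs C n - s * W C\<bar> = 0" if "xs \<in> set_pmf sk" for xs
    by (rule E_eq_0D[where p = sk]) (use E_cum[OF assms(1), of C] True that in auto)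
  then have "pr (total C) (\<lambda>v. \<not> ((1 - \<tau>) * s * W C \<le> v \<and> v \<le> (1 + \<tau>) * s * W C)) \<le> pr sk (\<lambda>_. False)"
    unfolding total_def pr_map by (intro pr_mono) (auto simp: True)
  also have "\<dots> = 0" by (simp add: pr_E)
  finally show ?thesis using assms by (auto intro: order_trans)
next
  case False
  then have W: "W C > 0" using W_nonneg[of C] by linarith
  have h: "real h > 0" using assms by simp
  have "pr (total C) (\<lambda>v. \<not> ((1 - \<tau>) * s * W C \<le> v \<and> v \<le> (1 + \<tau>) * s * W C))
      \<le> pr sk (\<lambda>xs. \<tau> * (2 * (real h)\<^sup>2 * W C) \<le> \<bar>cum xs C n - s * W C\<bar>)"
    unfolding total_def pr_map by (rule pr_mono) (auto simp: assms(1) algebra_simps)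
  also have "\<dots> \<le> E sk (\<lambda>xs. \<bar>cum xs C n - s * W C\<bar>) / (\<tau> * (2 * (real h)\<^sup>2 * W C))"
    by (rule markov) (use assms(3) h W in auto)
  also have "\<dots> \<le> 2 * real h * k * W C / (\<tau> * (2 * (real h)\<^sup>2 * W C))"
    by (rule divide_right_mono[OF E_cum[OF assms(1)]]) (use assms in auto)
  also have "\<dots> = k / (h * \<tau>)" using assms h W by (simp add: power2_eq_square)
  finally show ?thesis .
qed

section \<open>Picking a point in proportion to its weight\<close>

lemma cum_mono: "a \<le> b \<Longrightarrow> cum xs C a \<le> cum xs C b"
  unfolding cum_def by (rule sum_mono2) auto

lemma pick_eq:
  assumes "p < n" "real n * cum xs C p \<le> real r * cum xs C n" "real r * cum xs C n < real n * cum xs C (Suc p)"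
  shows "pick xs C r = p"
proof -
  have "real n * cum xs C (Suc p') \<le> real r * cum xs C n \<longleftrightarrow> p' < p" for p'
  proof (cases "p' < p")
    case True
    have "real n * cum xs C (Suc p') \<le> real n * cum xs C p"
      by (intro mult_left_mono cum_mono) (use True in auto)
    then have "real n * cum xs C (Suc p') \<le> real r * cum xs C n" using assms(2) by linarith
    then show ?thesis by (simp only: True)
  next
    case False
    have "real n * cum xs C (Suc p) \<le> real n * cum xs C (Suc p')"
      by (intro mult_left_mono cum_mono) (use False in auto)
    then have "\<not> real n * cum xs C (Suc p') \<le> real r * cum xs C n" using assms(3) by linarith
    then show ?thesis by (simp only: False)
  qed
  then have "{p'. p' < n \<and> real n * cum xs C (Suc p') \<le> real r * cum xs C n} = {p'. p' < n \<and> p' < p}"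
    by presburger
  also have "\<dots> = {..<p}" using assms(1) by auto
  finally have "{p'. p' < n \<and> real n * cum xs C (Suc p') \<le> real r * cum xs C n} = {..<p}" .
  then show ?thesis by (simp add: pick_def)
qed

text \<open>The levels that select \<open>p\<close> are the integers in a half-open interval whose
  length is \<open>n\<close> times the share of \<open>p\<close>; there are at least this length
  minus one of them.\<close>

lemma pr_pick:
  assumes "p < n" "cum xs C n > 0"
  shows "pr (pmf_of_set {0..n - 1}) (\<lambda>r. pick xs C r = p) \<ge> wt xs C p / cum xs C n - 1 / n"
proof -
  define S where "S = cum xs C n"
  define a where "a = nat \<lceil>real n * cum xs C p / S\<rceil>"
  define b where "b = nat \<lceil>real n * cum xs C (Suc p) / S\<rceil>"
  have S: "S > 0" using assms by (simp add: S_def)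
  have n: "real n > 0" using n_pos by simp
  have "a \<le> b" unfolding a_def b_def
    by (intro nat_mono ceiling_mono divide_right_mono mult_left_mono cum_mono) (use S in auto)
  have "cum xs C (Suc p) \<le> S" unfolding S_def by (rule cum_mono) (use assms in auto)
  then have "b \<le> n" unfolding b_def using S by (simp add: ceiling_le_iff divide_le_eq mult_left_mono)
  have ar: "real n * cum xs C p / S \<le> real a" unfolding a_def by linarith
  have ar': "real a < real n * cum xs C p / S + 1"
    using S ceiling_correct[of "real n * cum xs C p / S"] unfolding a_def by (simp add: of_nat_nat)
  have br: "real n * cum xs C (Suc p) / S \<le> real b" unfolding b_def by linarith
  have br': "real r < real n * cum xs C (Suc p) / S" if "r < b" for r
    using that by (simp add: b_def zless_nat_eq_int_zless less_ceiling_iff)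
  have "{a..<b} \<subseteq> {r \<in> {0..n - 1}. pick xs C r = p}"
  proof
    fix r assume r: "r \<in> {a..<b}"
    then have "r < n" using \<open>b \<le> n\<close> by auto
    have "pick xs C r = p"
    proof (rule pick_eq[OF assms(1)])
      have "real n * cum xs C p / S \<le> r" using ar r by simp
      then show "real n * cum xs C p \<le> real r * cum xs C n" using S by (simp add: S_def divide_le_eq)
      have "r < real n * cum xs C (Suc p) / S" using br'[of r] r by auto
      then show "real r * cum xs C n < real n * cum xs C (Suc p)" using S by (simp add: S_def less_divide_eq)
    qed
    with \<open>r < n\<close> show "r \<in> {r \<in> {0..n - 1}. pick xs C r = p}" by auto
  qed
  then have "card {a..<b} \<le> card {r \<in> {0..n - 1}. pick xs C r = p}"
    by (rule card_mono[rotated]) auto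
  then have card: "real b - real a \<le> card {r \<in> {0..n - 1}. pick xs C r = p}" using \<open>a \<le> b\<close> by simp
  have "wt xs C p / S - 1 / n = (real n * cum xs C (Suc p) / S - (real n * cum xs C p / S + 1)) / n"
    using n S by (simp add: cum_def field_simps)
  also have "\<dots> \<le> card {r \<in> {0..n - 1}. pick xs C r = p} / n"
    by (intro divide_right_mono) (use ar' br card in auto)
  also have "\<dots> = pr (pmf_of_set {0..n - 1}) (\<lambda>r. pick xs C r = p)"
    using n_pos by (simp add: pr_def measure_pmf_of_set Int_def conj_commute)
  finally show ?thesis by (simp add: S_def)
qed

lemma pr_sample:
  "pr (sample C) Q = (pr (pmf_of_set {0..n - 1}) Q + E sk (\<lambda>xs. pr (pmf_of_set {0..n - 1}) (\<lambda>r. Q (pick xs C r)))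
     + pr (pmf_of_set {0..k - 1}) (\<lambda>l. Q (n + l))) / 3"
proof -
  have three: "{0..2::nat} = {0, 1, 2}" by auto
  have "pr (sample C) Q = E sk (\<lambda>xs. (pr (pmf_of_set {0..n - 1}) Q +
        pr (pmf_of_set {0..n - 1}) (\<lambda>r. Q (pick xs C r)) + pr (pmf_of_set {0..k - 1}) (\<lambda>l. Q (n + l))) / 3)"
    unfolding sample_def
    by (subst pr_bind, simp, simp, rule E_cong, subst pr_bind, simp, simp, subst E_uniform, simp, simp)
       (simp add: three pr_bind pr_map, simp add: pr_E)
  then show ?thesis by (simp add: E_add)
qed

lemma pr_uniform_eq: "a < m \<Longrightarrow> pr (pmf_of_set {0..m - 1}) (\<lambda>r. r = a) = 1 / m" for m :: nat
  by (simp add: pr_def measure_pmf_of_set Int_absorb1)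

lemma E_pr_nonneg: "0 \<le> E p (\<lambda>x. pr (f x) (Q x))"
  by (rule E_nonneg) simp

lemma pr_sample_point:
  assumes "p < n"
  shows "pr (sample C) (\<lambda>r. r = p) \<ge> 1 / (3 * n)"
proof -
  define b where "b = E sk (\<lambda>xs. pr (pmf_of_set {0..n - 1}) (\<lambda>r. pick xs C r = p))"
  define c where "c = pr (pmf_of_set {0..k - 1}) (\<lambda>l. n + l = p)"
  have "0 \<le> b" "0 \<le> c" unfolding b_def c_def by (rule E_pr_nonneg, rule pr_nonneg)
  then have "1 / n \<le> 1 / n + b + c" by linarith
  then show ?thesis unfolding pr_sample pr_uniform_eq[OF assms] b_def[symmetric] c_def[symmetric] by simp
qed

lemma pr_sample_center:
  assumes "l < k"
  shows "pr (sample C) (\<lambda>r. r = n + l) \<ge> 1 / (3 * k)"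
proof -
  define a where "a = pr (pmf_of_set {0..n - 1}) (\<lambda>r. r = n + l)"
  define b where "b = E sk (\<lambda>xs. pr (pmf_of_set {0..n - 1}) (\<lambda>r. pick xs C r = n + l))"
  have c: "pr (pmf_of_set {0..k - 1}) (\<lambda>l'. n + l' = n + l) = 1 / k"
    using pr_uniform_eq[OF assms] by simp
  have "0 \<le> a" "0 \<le> b" unfolding a_def b_def by (rule pr_nonneg, rule E_pr_nonneg)
  then have "1 / k \<le> a + b + 1 / k" by linarith
  then show ?thesis unfolding pr_sample c a_def[symmetric] b_def[symmetric] by simp
qed

text \<open>Rounding makes \<open>pick\<close> lose up to \<open>1/n\<close>, which the uniform mode compensates.\<close>

lemma pr_sample_far:
  assumes "s = 2 * h\<^sup>2" "h \<ge> 1" "h \<ge> 6 * k" "W C > 0" "p < n"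
  shows "pr (sample C) (\<lambda>r. r = p) \<ge> w C p / (24 * W C)"
proof (cases "w C p = 0")
  case False
  then have w: "w C p > 0" using w_nonneg[of C p] by linarith
  define good where "good xs \<longleftrightarrow> \<not> (wt xs C p < s * w C p / 2 \<or> cum xs C n > 2 * s * W C)" for xs
  have h: "real h > 0" and s: "real s > 0" using assms by auto
  have "pr sk (\<lambda>xs. wt xs C p < s * w C p / 2 \<or> cum xs C n > 2 * s * W C) \<le> 2 * k / h + k / h"
    by (rule order_trans[OF pr_disj add_mono[OF sketch_wt_half[OF assms(1,2) w] sketch_cum_double[OF assms(1,2,4)]]])
  \<comment> \<open>This is where \<open>h \<ge> 6 * k\<close> enters: 3k/h is at most one
    half.\<close>
  also have "\<dots> \<le> 1 / 2"
  proof -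
    have "real h \<ge> 6 * real k" using assms(3) by (metis of_nat_mono of_nat_mult of_nat_numeral)
    then show ?thesis using h by (simp add: field_simps)
  qed
  finally have good: "pr sk good \<ge> 1 / 2" unfolding good_def pr_not by simp
  \<comment> \<open>The 24 of the claim: 4 from two errors by a factor 2, another 2 from the
    probability of a good sketch, 3 from the choice of the mode.\<close>
  have "w C p / (4 * W C) * of_bool (good xs) - 1 / n \<le> pr (pmf_of_set {0..n - 1}) (\<lambda>r. pick xs C r = p)" for xs
  proof (cases "good xs")
    case True
    then have g: "s * w C p / 2 \<le> wt xs C p" "cum xs C n \<le> 2 * s * W C" by (auto simp: good_def)
    have "0 < s * w C p / 2" using s w by simp
    also have "\<dots> \<le> wt xs C p" by (rule g)
    also have "wt xs C p \<le> cum xs C n" unfolding cum_def by (rule member_le_sum) (use assms in auto)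
    finally have S: "cum xs C n > 0" .
    have "w C p / (4 * W C) = (s * w C p / 2) / (2 * s * W C)" using s by simp
    also have "\<dots> \<le> wt xs C p / cum xs C n"
      by (intro frac_le g S) auto
    finally show ?thesis using pr_pick[OF assms(5) S] True by simp
  next
    case False
    then show ?thesis by (simp add: order_trans[OF _ pr_nonneg])
  qed
  then have "E sk (\<lambda>xs. w C p / (4 * W C) * of_bool (good xs) - 1 / n)
      \<le> E sk (\<lambda>xs. pr (pmf_of_set {0..n - 1}) (\<lambda>r. pick xs C r = p))"
    by (intro E_mono) auto
  then have "w C p / (4 * W C) * pr sk good - 1 / n \<le> E sk (\<lambda>xs. pr (pmf_of_set {0..n - 1}) (\<lambda>r. pick xs C r = p))"
    by (simp add: E_diff pr_E)
  moreover have "w C p / (4 * W C) * (1 / 2) \<le> w C p / (4 * W C) * pr sk good"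
    by (intro mult_left_mono good) (use w assms in auto)
  moreover define x where "x = w C p / (24 * W C)"
  moreover define y where "y = w C p / (4 * W C) * pr sk good"
  moreover define e where "e = E sk (\<lambda>xs. pr (pmf_of_set {0..n - 1}) (\<lambda>r. pick xs C r = p))"
  ultimately have "3 * x \<le> y" "y - 1 / n \<le> e" by simp_all
  then have "3 * x \<le> 1 / n + e + pr (pmf_of_set {0..k - 1}) (\<lambda>l. n + l = p)"
    using pr_nonneg[of "pmf_of_set {0..k - 1}" "\<lambda>l. n + l = p"] by linarith
  then show ?thesis unfolding pr_sample pr_uniform_eq[OF assms(5)] e_def x_def by simp
qed simp

end

section \<open>Domination of distributions\<close>

lemma E_dominated:
  assumes "fin p" "fin q" "0 \<le> c" "\<And>x. x \<in> set_pmf q \<Longrightarrow> c * pmf q x \<le> pmf p x" "\<And>x. 0 \<le> f x"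
  shows "c * E q f \<le> E p f"
proof -
  let ?A = "set_pmf p \<union> set_pmf q"
  have "E q f = (\<Sum>x\<in>?A. pmf q x * f x)" "E p f = (\<Sum>x\<in>?A. pmf p x * f x)"
    using integral_measure_pmf[of ?A q f] integral_measure_pmf[of ?A p f] assms(1,2) by auto
  moreover have "c * pmf q x * f x \<le> pmf p x * f x" for x
    by (cases "x \<in> set_pmf q") (use assms in \<open>auto intro: mult_right_mono simp: set_pmf_iff\<close>)
  then have "(\<Sum>x\<in>?A. c * (pmf q x * f x)) \<le> (\<Sum>x\<in>?A. pmf p x * f x)"
    by (intro sum_mono) (simp add: mult.assoc)
  ultimately show ?thesis by (simp add: sum_distrib_left)
qed

text \<open>Domination by a constant factor passes to products, at the price of \<open>c ^ m\<close>
  for \<open>m\<close> draws. Facts on ideal samples from one cluster thereby carry over to the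
  draws that are actually made.\<close>

lemma E_reps_dominated:
  assumes "fin p" "fin q" "0 \<le> c" "\<And>x. x \<in> set_pmf q \<Longrightarrow> c * pmf q x \<le> pmf p x" "\<And>xs. 0 \<le> f xs"
  shows "c ^ m * E (reps m q) f \<le> E (reps m p) f"
  using assms(5)
proof (induction m arbitrary: f)
  case 0
  then show ?case by (simp add: reps_0)
next
  case (Suc m)
  have "c ^ Suc m * E (reps (Suc m) q) f = c ^ m * E (reps m q) (\<lambda>xs. c * E q (\<lambda>x. f (xs @ [x])))"
    using assms(2) by (simp add: E_reps_Suc)
  also have "\<dots> \<le> c ^ m * E (reps m q) (\<lambda>xs. E p (\<lambda>x. f (xs @ [x])))"
    by (intro mult_left_mono E_mono E_dominated assms) (use assms Suc.prems in auto)
  also have "\<dots> \<le> E (reps m p) (\<lambda>xs. E p (\<lambda>x. f (xs @ [x])))"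
    by (rule Suc.IH) (intro E_nonneg Suc.prems)
  finally show ?case using assms(1) by (simp add: E_reps_Suc)
qed

lemma reps_map: "reps m (map_pmf g p) = map_pmf (map g) (reps m p)"
  by (induction m) (simp_all add: reps_0 reps_Suc map_bind_pmf bind_map_pmf pmf.map_comp o_def)

text \<open>The Cauchy-Schwarz inequality against the constant 1.\<close>

lemma sum_list_square_le:
  "(sum_list (map g xs))\<^sup>2 \<le> length xs * sum_list (map (\<lambda>x. (g x)\<^sup>2) xs)" for g :: "'a \<Rightarrow> real"
  using sum_squared_le_sum_of_squares[of "\<lambda>i. g (xs ! i)" "{0..<length xs}"]
  by (simp add: sum_list_sum_nth mult.commute)

section \<open>Averages of samples from a cluster\<close>

context clustering
begin

lemma D_triangle: "D u v \<le> 2 * D u x + 2 * D x v"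
proof -
  have "(a - b)\<^sup>2 \<le> 2 * (a - c)\<^sup>2 + 2 * (c - b)\<^sup>2" for a b c :: real
  proof -
    have "0 \<le> ((a - c) - (c - b))\<^sup>2" by simp
    then show ?thesis by (simp add: power2_eq_square algebra_simps)
  qed
  then show ?thesis unfolding D_def sum_distrib_left sum.distrib[symmetric] by (rule sum_mono)
qed

lemma D_commute: "D u v = D v u"
  by (simp add: D_def power2_commute)

lemma D_self [simp]: "D u u = 0"
  by (simp add: D_def)

lemma lin_mean:
  "lin q (mean C rs) = sum_list (map (\<lambda>r. lin q (row C r)) rs) / M"
proof -
  have "(\<Sum>j<d. B q j * sum_list (map (\<lambda>r. row C r j) rs)) = sum_list (map (\<lambda>r. lin q (row C r)) rs)"
    by (induction rs) (simp_all add: lin_def algebra_simps sum.distrib)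
  then show ?thesis by (simp add: lin_def mean_def sum_divide_distrib[symmetric])
qed

definition centroid :: "nat set \<Rightarrow> point" where
  "centroid S = (\<lambda>j. (\<Sum>p\<in>S. X p j) / card S)"

definition dev :: "nat set \<Rightarrow> real" where
  "dev S = (\<Sum>p\<in>S. D (X p) (centroid S))"

lemma dev_nonneg [simp]: "0 \<le> dev S"
  by (simp add: dev_def sum_nonneg)

lemma lin_centroid: "lin q (centroid S) = (\<Sum>p\<in>S. lin q (X p)) / card S"
proof -
  have "(\<Sum>j<d. B q j * (\<Sum>p\<in>S. X p j)) = (\<Sum>p\<in>S. lin q (X p))"
    unfolding lin_def sum_distrib_left by (rule sum.swap)
  then show ?thesis by (simp add: lin_def centroid_def sum_divide_distrib[symmetric])
qed

text \<open>The cross term is a multiple of the summed deviations from the centroid, which vanish in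
  each coordinate \<open>lin q\<close>.\<close>

lemma parallel_axis:
  assumes "finite S"
  shows "(\<Sum>p\<in>S. D (X p) c) = dev S + card S * D (centroid S) c"
proof (cases "S = {}")
  case False
  then have card: "real (card S) > 0" using assms by (simp add: card_gt_0_iff)
  have "(\<Sum>p\<in>S. (lin q (X p) - lin q c)\<^sup>2) = (\<Sum>p\<in>S. (lin q (X p) - lin q (centroid S))\<^sup>2)
      + card S * (lin q (centroid S) - lin q c)\<^sup>2" for q
  proof -
    define a where "a = lin q (centroid S)"
    have "(\<Sum>p\<in>S. lin q (X p)) = card S * a" unfolding a_def lin_centroid using card by simp
    then have zero: "(\<Sum>p\<in>S. lin q (X p) - a) = 0" by (simp add: sum_subtractf)
    have "(\<Sum>p\<in>S. (lin q (X p) - lin q c)\<^sup>2)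
        = (\<Sum>p\<in>S. (lin q (X p) - a)\<^sup>2 + 2 * (a - lin q c) * (lin q (X p) - a) + (a - lin q c)\<^sup>2)"
      by (rule sum.cong) (simp_all add: power2_eq_square algebra_simps)
    also have "\<dots> = (\<Sum>p\<in>S. (lin q (X p) - a)\<^sup>2) + 2 * (a - lin q c) * (\<Sum>p\<in>S. lin q (X p) - a)
        + card S * (a - lin q c)\<^sup>2"
      by (simp only: sum.distrib sum_distrib_left[symmetric] sum_constant)
    finally show ?thesis unfolding zero by (simp add: a_def)
  qed
  then have "(\<Sum>q<d. \<Sum>p\<in>S. (lin q (X p) - lin q c)\<^sup>2) = (\<Sum>q<d. \<Sum>p\<in>S. (lin q (X p) - lin q (centroid S))\<^sup>2)
      + card S * (\<Sum>q<d. (lin q (centroid S) - lin q c)\<^sup>2)"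
    by (simp add: sum.distrib sum_distrib_left)
  then show ?thesis by (simp add: D_def dev_def sum.swap[of _ S])
qed (simp add: dev_def)

text \<open>The error of the mean splits into a sampling error and the displacement by
  \<open>\<pi>\<close>. The first is centered, and averaging divides its variance by
  \<open>M\<close>; the second is not, so Cauchy-Schwarz only bounds it by its mean square. Squaring
  the sum costs the factor 2.\<close>

lemma E_mean:
  fixes \<theta> :: real
  assumes S: "finite S" "S \<noteq> {}" and M: "M \<ge> 1"
    and move: "\<And>p. p \<in> S \<Longrightarrow> D (X p) (row C (\<pi> p)) \<le> \<theta> * D (X p) (centroid S)"
  shows "card S * E (reps M (map_pmf \<pi> (pmf_of_set S))) (\<lambda>rs. D (centroid S) (mean C rs))
      \<le> (2 / M + 2 * \<theta>) * dev S"
proof -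
  let ?U = "pmf_of_set S"
  let ?R = "reps M ?U"
  have fin: "fin ?U" using S by simp
  have card: "real (card S) > 0" using S by (simp add: card_gt_0_iff)
  have M': "real M > 0" using M by simp
  define \<mu> where "\<mu> = centroid S"
  have coord: "E ?R (\<lambda>ps. (lin q \<mu> - lin q (mean C (map \<pi> ps)))\<^sup>2)
      \<le> 2 / M * E ?U (\<lambda>p. (lin q (X p) - lin q \<mu>)\<^sup>2) + 2 * E ?U (\<lambda>p. (lin q (X p) - lin q (row C (\<pi> p)))\<^sup>2)" for q
  proof -
    define a where "a p = lin q (X p)" for p
    define g where "g p = a p - lin q (row C (\<pi> p))" for p
    have mu: "E ?U a = lin q \<mu>" using S by (simp add: E_uniform \<mu>_def lin_centroid a_def)
    have "(lin q \<mu> - lin q (mean C (map \<pi> ps)))\<^sup>2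
        \<le> 2 / M\<^sup>2 * (sum_list (map a ps) - M * lin q \<mu>)\<^sup>2 + 2 / M * sum_list (map (\<lambda>p. (g p)\<^sup>2) ps)"
      if "ps \<in> set_pmf ?R" for ps
    proof -
      have len: "length ps = M" using set_reps[OF that] by simp
      define x where "x = sum_list (map a ps) - M * lin q \<mu>"
      define y where "y = sum_list (map g ps)"
      have "y = sum_list (map a ps) - sum_list (map (\<lambda>p. lin q (row C (\<pi> p))) ps)"
        unfolding y_def g_def by (rule sum_list_subtractf)
      then have "lin q \<mu> - lin q (mean C (map \<pi> ps)) = (y - x) / M"
        unfolding lin_mean x_def using M' by (simp add: field_simps o_def)
      then have "(lin q \<mu> - lin q (mean C (map \<pi> ps)))\<^sup>2 = (y - x)\<^sup>2 / M\<^sup>2" by (simp add: power_divide)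
      also have "\<dots> \<le> (2 * x\<^sup>2 + 2 * y\<^sup>2) / M\<^sup>2"
      proof (rule divide_right_mono)
        have "0 \<le> (y + x)\<^sup>2" by simp
        then show "(y - x)\<^sup>2 \<le> 2 * x\<^sup>2 + 2 * y\<^sup>2" by (simp add: power2_eq_square algebra_simps)
      qed simp
      also have "\<dots> \<le> (2 * x\<^sup>2 + 2 * (M * sum_list (map (\<lambda>p. (g p)\<^sup>2) ps))) / M\<^sup>2"
        using sum_list_square_le[of g ps] len by (intro divide_right_mono add_left_mono) (auto simp: y_def)
      also have "\<dots> = 2 / M\<^sup>2 * x\<^sup>2 + 2 / M * sum_list (map (\<lambda>p. (g p)\<^sup>2) ps)"
        using M' by (simp add: power2_eq_square field_simps)
      finally show ?thesis by (simp add: x_def)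
    qed
    then have "E ?R (\<lambda>ps. (lin q \<mu> - lin q (mean C (map \<pi> ps)))\<^sup>2)
        \<le> E ?R (\<lambda>ps. 2 / M\<^sup>2 * (sum_list (map a ps) - M * lin q \<mu>)\<^sup>2 + 2 / M * sum_list (map (\<lambda>p. (g p)\<^sup>2) ps))"
      using fin by (intro E_mono) auto
    also have "\<dots> = 2 / M\<^sup>2 * E ?R (\<lambda>ps. (sum_list (map a ps) - M * lin q \<mu>)\<^sup>2)
        + 2 / M * E ?R (\<lambda>ps. sum_list (map (\<lambda>p. (g p)\<^sup>2) ps))"
      using fin by (subst E_add) simp_all
    also have "E ?R (\<lambda>ps. (sum_list (map a ps) - M * lin q \<mu>)\<^sup>2) = M * E ?U (\<lambda>p. (a p - lin q \<mu>)\<^sup>2)"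
      using E_reps_variance[OF fin, of M a] by (simp add: mu)
    also have "E ?R (\<lambda>ps. sum_list (map (\<lambda>p. (g p)\<^sup>2) ps)) = M * E ?U (\<lambda>p. (g p)\<^sup>2)"
      by (rule E_reps_sum[OF fin])
    finally show ?thesis using M' by (simp add: power2_eq_square a_def g_def)
  qed
  have "E (reps M (map_pmf \<pi> ?U)) (\<lambda>rs. D \<mu> (mean C rs)) = E ?R (\<lambda>ps. D \<mu> (mean C (map \<pi> ps)))"
    by (simp add: reps_map)
  also have "\<dots> = (\<Sum>q<d. E ?R (\<lambda>ps. (lin q \<mu> - lin q (mean C (map \<pi> ps)))\<^sup>2))"
    unfolding D_def using fin by (intro E_sum) simp
  also have "\<dots> \<le> (\<Sum>q<d. 2 / M * E ?U (\<lambda>p. (lin q (X p) - lin q \<mu>)\<^sup>2)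
      + 2 * E ?U (\<lambda>p. (lin q (X p) - lin q (row C (\<pi> p)))\<^sup>2))"
    by (rule sum_mono) (rule coord)
  also have "\<dots> = 2 / M * E ?U (\<lambda>p. D (X p) \<mu>) + 2 * E ?U (\<lambda>p. D (X p) (row C (\<pi> p)))"
    unfolding D_def using fin by (simp only: E_sum sum.distrib sum_distrib_left)
  finally have "card S * E (reps M (map_pmf \<pi> ?U)) (\<lambda>rs. D \<mu> (mean C rs))
      \<le> card S * (2 / M * E ?U (\<lambda>p. D (X p) \<mu>) + 2 * E ?U (\<lambda>p. D (X p) (row C (\<pi> p))))"
    by (rule mult_left_mono) simp
  also have "\<dots> = 2 / M * (\<Sum>p\<in>S. D (X p) \<mu>) + 2 * (\<Sum>p\<in>S. D (X p) (row C (\<pi> p)))"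
    using S card by (simp add: E_uniform field_simps)
  also have "\<dots> \<le> 2 / M * (\<Sum>p\<in>S. D (X p) \<mu>) + 2 * (\<theta> * (\<Sum>p\<in>S. D (X p) \<mu>))"
  proof -
    have "(\<Sum>p\<in>S. D (X p) (row C (\<pi> p))) \<le> (\<Sum>p\<in>S. \<theta> * D (X p) \<mu>)"
      unfolding \<mu>_def by (rule sum_mono) (rule move)
    then show ?thesis by (simp add: sum_distrib_left[symmetric])
  qed
  finally show ?thesis by (simp add: dev_def \<mu>_def algebra_simps)
qed

text \<open>By the parallel axis identity, the excess of the cost over \<open>dev S\<close> is
  \<open>card S\<close> times the squared distance of the mean from the centroid. Its expectation is
  at most half of the allowed \<open>\<beta> * dev S\<close>, so Markov's inequality gives one
  half.\<close>

lemma pr_mean: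
  fixes \<theta> \<beta> :: real
  assumes S: "finite S" "S \<noteq> {}" and M: "M \<ge> 1"
    and move: "\<And>p. p \<in> S \<Longrightarrow> D (X p) (row C (\<pi> p)) \<le> \<theta> * D (X p) (centroid S)"
    and \<beta>: "0 < \<beta>" "2 / M + 2 * \<theta> \<le> \<beta> / 2"
  shows "pr (reps M (map_pmf \<pi> (pmf_of_set S))) (\<lambda>rs. (\<Sum>p\<in>S. D (X p) (mean C rs)) \<le> (1 + \<beta>) * dev S) \<ge> 1 / 2"
proof -
  let ?R = "reps M (map_pmf \<pi> (pmf_of_set S))"
  let ?f = "\<lambda>rs. card S * D (centroid S) (mean C rs)"
  have fin: "fin ?R" using S by simp
  have "E ?R ?f \<le> (2 / M + 2 * \<theta>) * dev S"
    using E_mean[OF S M move] by simp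
  also have "\<dots> \<le> \<beta> / 2 * dev S" by (rule mult_right_mono[OF \<beta>(2)]) simp
  finally have E: "E ?R ?f \<le> \<beta> / 2 * dev S" .
  have "pr ?R (\<lambda>rs. \<not> ?f rs \<le> \<beta> * dev S) \<le> 1 / 2"
  proof (cases "dev S = 0")
    case True
    then have "?f rs = 0" if "rs \<in> set_pmf ?R" for rs
      by (intro E_eq_0D[OF fin _ _ that]) (use E in auto)
    then have "pr ?R (\<lambda>rs. \<not> ?f rs \<le> \<beta> * dev S) \<le> pr ?R (\<lambda>_. False)"
      by (intro pr_mono) (simp only: True mult_zero_right order_refl not_True_eq_False)
    also have "\<dots> = 0" by (simp add: pr_E)
    finally show ?thesis by simp
  next
    case False
    then have dev: "dev S > 0" using dev_nonneg[of S] by linarith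
    have "pr ?R (\<lambda>rs. \<not> ?f rs \<le> \<beta> * dev S) \<le> pr ?R (\<lambda>rs. \<beta> * dev S \<le> ?f rs)"
      by (rule pr_mono) simp
    also have "\<dots> \<le> E ?R ?f / (\<beta> * dev S)"
      by (rule markov[OF fin]) (use dev \<beta> in auto)
    also have "\<dots> \<le> (\<beta> / 2 * dev S) / (\<beta> * dev S)"
      by (rule divide_right_mono[OF E]) (use dev \<beta> in auto)
    also have "\<dots> = 1 / 2" using dev \<beta> by simp
    finally show ?thesis .
  qed
  then have "1 / 2 \<le> pr ?R (\<lambda>rs. ?f rs \<le> \<beta> * dev S)" unfolding pr_not by simp
  also have "\<dots> \<le> pr ?R (\<lambda>rs. (\<Sum>p\<in>S. D (X p) (mean C rs)) \<le> (1 + \<beta>) * dev S)"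
    by (rule pr_mono) (simp add: parallel_axis[OF S(1)] algebra_simps)
  finally show ?thesis .
qed

text \<open>The ideal distribution is the image of the uniform one on \<open>S\<close> under
  \<open>\<pi>\<close>. A value of \<open>\<pi>\<close> has there the mass of its fibre, which
  \<kappa> compares with the mass under \<open>sample C\<close>.\<close>

lemma pr_stage:
  fixes \<theta> \<beta> \<kappa> :: real
  assumes S: "finite S" "S \<noteq> {}" and M: "M \<ge> 1"
    and move: "\<And>p. p \<in> S \<Longrightarrow> D (X p) (row C (\<pi> p)) \<le> \<theta> * D (X p) (centroid S)"
    and \<beta>: "0 < \<beta>" "2 / M + 2 * \<theta> \<le> \<beta> / 2"
    and \<kappa>: "0 \<le> \<kappa>" "\<And>p. p \<in> S \<Longrightarrow>
       \<kappa> * card {p' \<in> S. \<pi> p' = \<pi> p} / card S \<le> pr (sample C) (\<lambda>r. r = \<pi> p)"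
  shows "pr (stage i C) (\<lambda>C'. (\<forall>l<i. C' l = C l) \<and> (\<exists>c. (\<forall>l\<ge>i. C' l = c) \<and> (\<Sum>p\<in>S. D (X p) c) \<le> (1 + \<beta>) * dev S))
     \<ge> \<kappa> ^ M / 2"
proof -
  let ?q = "map_pmf \<pi> (pmf_of_set S)"
  let ?P = "\<lambda>rs. (\<Sum>p\<in>S. D (X p) (mean C rs)) \<le> (1 + \<beta>) * dev S"
  have "\<kappa> * pmf ?q r \<le> pmf (sample C) r" if "r \<in> set_pmf ?q" for r
  proof -
    from that S obtain p where p: "p \<in> S" "r = \<pi> p" by auto
    have "pmf ?q r = card {p' \<in> S. \<pi> p' = \<pi> p} / card S"
      using S by (simp add: pmf_map measure_pmf_of_set vimage_def Int_def p(2))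
    moreover have "pmf (sample C) r = pr (sample C) (\<lambda>x. x = r)" by (simp add: pr_def measure_pmf_single)
    ultimately show ?thesis using \<kappa>(2)[OF p(1)] p(2) by simp
  qed
  then have "\<kappa> ^ M * E (reps M ?q) (\<lambda>rs. of_bool (?P rs)) \<le> E (reps M (sample C)) (\<lambda>rs. of_bool (?P rs))"
    using S \<kappa>(1) by (intro E_reps_dominated) auto
  then have "\<kappa> ^ M * pr (reps M ?q) ?P \<le> pr (reps M (sample C)) ?P" by (simp add: pr_E)
  moreover have "\<kappa> ^ M * (1 / 2) \<le> \<kappa> ^ M * pr (reps M ?q) ?P"
    by (intro mult_left_mono pr_mean[OF S M move \<beta>]) (use \<kappa> in auto)
  moreover have "pr (reps M (sample C)) ?P \<le> pr (stage i C)
     (\<lambda>C'. (\<forall>l<i. C' l = C l) \<and> (\<exists>c. (\<forall>l\<ge>i. C' l = c) \<and> (\<Sum>p\<in>S. D (X p) c) \<le> (1 + \<beta>) * dev S))"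
    unfolding stage_def pr_map by (rule pr_mono) auto
  ultimately show ?thesis by linarith
qed

end

section \<open>Trials\<close>

text \<open>Here \<open>f\<close> is any partition into \<open>k\<close> classes; optimality comes
  in when it is instantiated. The bound on \<open>M\<close> makes 2/M at most \<beta>/4. In 4608 =
  24 * 3 * 64 the factors stem from the sampling probability, the share of a heavy cluster and the
  threshold for light points.\<close>

locale clustered = clustering +
  fixes f :: "nat \<Rightarrow> nat" and \<beta> \<kappa> :: real and h :: nat
  assumes f: "\<And>p. p < n \<Longrightarrow> f p < k"
    and s_def: "s = 2 * h\<^sup>2" and h: "h \<ge> 1" "h \<ge> 6 * k"
    and \<beta>: "0 < \<beta>" "\<beta> \<le> 1"
    and M: "8 / \<beta> \<le> M"
    and \<kappa>: "0 \<le> \<kappa>" "\<kappa> \<le> \<beta> ^ 3 / (4608 * k)"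
begin

definition S :: "nat \<Rightarrow> nat set" where
  "S j = {p \<in> {..<n}. f p = j}"

definition OPT :: real where
  "OPT = (\<Sum>j<k. dev (S j))"

definition Wj :: "centers \<Rightarrow> nat \<Rightarrow> real" where
  "Wj C j = (\<Sum>p\<in>S j. w C p)"

definition uncovered :: "centers \<Rightarrow> nat set" where
  "uncovered C = {j. j < k \<and> (1 + \<beta>) * dev (S j) < Wj C j}"

text \<open>The factor exceeds the \<open>1 + \<beta>\<close> for a single cluster, so that, when
  \<open>C\<close> is not good, the uncovered clusters together cost at least
  \<open>\<beta> * OPT\<close>.\<close>

definition good :: "centers \<Rightarrow> bool" where
  "good C \<longleftrightarrow> W C \<le> (1 + 2 * \<beta>) * OPT"

text \<open>By the first clause the slots from \<open>i\<close> on repeat slot \<open>i - 1\<close>,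
  so that the next stage may overwrite them without losing a center.\<close>

definition trial_inv :: "nat \<Rightarrow> centers \<Rightarrow> bool" where
  "trial_inv i C \<longleftrightarrow> (\<forall>l\<ge>i. C l = C (i - 1)) \<and> (good C \<or> card (uncovered C) \<le> k - i)"

lemma S_finite [simp]: "finite (S j)"
  by (simp add: S_def)

lemma S_less: "p \<in> S j \<Longrightarrow> p < n"
  by (simp add: S_def)

lemma finite_uncovered [simp]: "finite (uncovered C)"
  by (simp add: uncovered_def)

lemma W_split: "W C = (\<Sum>j<k. Wj C j)"
  unfolding W_def Wj_def S_def by (rule sum.group[symmetric]) (use f in auto)

lemma Wj_nonneg [simp]: "0 \<le> Wj C j"
  by (simp add: Wj_def sum_nonneg)

lemma OPT_nonneg: "0 \<le> OPT"
  by (simp add: OPT_def sum_nonneg)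

lemma Wj_mono: "(\<And>p. p < n \<Longrightarrow> w C' p \<le> w C p) \<Longrightarrow> Wj C' j \<le> Wj C j"
  unfolding Wj_def by (rule sum_mono) (auto simp: S_def)

lemma w_center: "l < k \<Longrightarrow> Wj C j \<le> (\<Sum>p\<in>S j. D (X p) (C l))"
  unfolding Wj_def by (rule sum_mono) (rule w_le)

lemma W_uncovered: "W C \<le> (1 + \<beta>) * OPT + (\<Sum>j\<in>uncovered C. Wj C j)"
proof -
  have "W C = (\<Sum>j\<in>{..<k} - uncovered C. Wj C j) + (\<Sum>j\<in>uncovered C. Wj C j)"
    unfolding W_split by (rule sum.subset_diff) (auto simp: uncovered_def)
  moreover have "(\<Sum>j\<in>{..<k} - uncovered C. Wj C j) \<le> (\<Sum>j\<in>{..<k} - uncovered C. (1 + \<beta>) * dev (S j))"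
  proof (rule sum_mono)
    fix j assume "j \<in> {..<k} - uncovered C"
    then have "\<not> (1 + \<beta>) * dev (S j) < Wj C j" unfolding uncovered_def by blast
    then show "Wj C j \<le> (1 + \<beta>) * dev (S j)" by linarith
  qed
  moreover have "\<dots> \<le> (\<Sum>j<k. (1 + \<beta>) * dev (S j))"
  proof (rule sum_mono2)
    show "0 \<le> (1 + \<beta>) * dev (S j)" for j using \<beta> by (intro mult_nonneg_nonneg) simp_all
  qed auto
  moreover have "\<dots> = (1 + \<beta>) * OPT" unfolding OPT_def sum_distrib_left ..
  ultimately show ?thesis by linarith
qed

lemma all_covered_good: "uncovered C = {} \<Longrightarrow> good C"
  using W_uncovered[of C] mult_right_mono[of "1 + \<beta>" "1 + 2 * \<beta>" OPT] \<beta> OPT_nonneg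
  unfolding good_def by simp

text \<open>The uncovered clusters together carry a share of at least \<beta>/3 of the cost; the
  costliest of these at most \<open>k\<close> clusters is chosen.\<close>

lemma heavy_uncovered:
  assumes "\<not> good C"
  obtains j where "j \<in> uncovered C" "\<beta> * W C \<le> 3 * k * Wj C j"
proof -
  define u where "u = (\<Sum>j\<in>uncovered C. Wj C j)"
  have ne: "uncovered C \<noteq> {}" using assms all_covered_good by blast
  have "Max (Wj C ` uncovered C) \<in> Wj C ` uncovered C" by (rule Max_in) (use ne in simp_all)
  then obtain j where j: "j \<in> uncovered C" "Wj C j = Max (Wj C ` uncovered C)"
    by (elim imageE) simp
  have "Wj C i \<le> Wj C j" if "i \<in> uncovered C" for i
    unfolding j(2) using that by (intro Max_ge) auto
  then have "u \<le> card (uncovered C) * Wj C j"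
    unfolding u_def by (rule sum_bounded_above)
  also have "\<dots> \<le> k * Wj C j"
  proof (rule mult_right_mono)
    have "card (uncovered C) \<le> card {..<k}" by (rule card_mono) (auto simp: uncovered_def)
    then show "real (card (uncovered C)) \<le> real k" by simp
  qed simp
  finally have u: "u \<le> k * Wj C j" .
  have W: "W C \<le> (1 + \<beta>) * OPT + u" unfolding u_def by (rule W_uncovered)
  have "(1 + 2 * \<beta>) * OPT < W C" using assms by (simp add: good_def)
  then have "\<beta> * OPT \<le> u" using W by (simp add: algebra_simps)
  have "\<beta> * W C \<le> \<beta> * ((1 + \<beta>) * OPT + u)" using W \<beta> by (intro mult_left_mono) auto
  also have "\<dots> = (1 + \<beta>) * (\<beta> * OPT) + \<beta> * u" by (simp add: algebra_simps)
  also have "\<dots> \<le> (1 + \<beta>) * u + \<beta> * u"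
    using \<open>\<beta> * OPT \<le> u\<close> \<beta> by (intro add_right_mono mult_left_mono) auto
  also have "\<dots> = (1 + 2 * \<beta>) * u" by (simp add: algebra_simps)
  also have "\<dots> \<le> 3 * u"
    by (rule mult_right_mono) (use \<beta> in \<open>auto simp: u_def intro: sum_nonneg\<close>)
  finally show thesis using u j(1) that[of j] by simp
qed

lemma M1: "M \<ge> 1" and M4: "2 / M \<le> \<beta> / 4"
proof -
  have "0 < 8 / \<beta>" using \<beta> by simp
  then have M': "real M > 0" using M by linarith
  then show "M \<ge> 1" by simp
  show "2 / M \<le> \<beta> / 4" using M M' \<beta> by (simp add: field_simps)
qed

lemma \<kappa>_le: "\<kappa> \<le> 1 / (3 * k)"
proof -
  have "\<kappa> \<le> \<beta> ^ 3 / (4608 * k)" by (rule \<kappa>)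
  also have "\<dots> \<le> 1 / (4608 * k)"
    by (rule divide_right_mono) (use \<beta> power_le_one[of \<beta> 3] in auto)
  also have "\<dots> \<le> 1 / (3 * k)" using k_pos by (simp add: field_simps)
  finally show ?thesis .
qed

lemma uncovered_less:
  assumes "\<And>p. p < n \<Longrightarrow> w C' p \<le> w C p" "j \<in> uncovered C" "l < k"
    and "(\<Sum>p\<in>S j. D (X p) (C' l)) \<le> (1 + \<beta>) * dev (S j)"
  shows "card (uncovered C') < card (uncovered C)"
proof (rule psubset_card_mono)
  have "j \<notin> uncovered C'" using assms(4) w_center[OF assms(3), of C' j] by (auto simp: uncovered_def)
  moreover have "uncovered C' \<subseteq> uncovered C"
    unfolding uncovered_def using Wj_mono[OF assms(1)] by (auto intro: less_le_trans)
  ultimately show "uncovered C' \<subset> uncovered C" using assms(2) by blast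
qed simp

text \<open>Points of an uncovered cluster that are relatively close to the current centers are too light to be
  sampled; as the cluster is uncovered they are far from its centroid, so they may be moved
  to their nearest center.\<close>

lemma near_bound:
  assumes j: "j \<in> uncovered C" and p: "p \<in> S j" and l: "l < k" "w C p = D (X p) (C l)"
    and near: "w C p < \<beta>\<^sup>2 / 64 * (Wj C j / card (S j))"
  shows "D (X p) (C l) \<le> \<beta> / 8 * D (X p) (centroid (S j))"
proof -
  define m where "m = real (card (S j))"
  define a where "a = Wj C j / m"
  define V where "V = dev (S j) / m"
  define \<delta> where "\<delta> = D (X p) (centroid (S j))"
  have "S j \<noteq> {}" using p by auto
  then have m: "m > 0" by (simp add: m_def card_gt_0_iff)
  have "(1 + \<beta>) * dev (S j) < Wj C j" using j by (simp add: uncovered_def)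
  then have aV: "(1 + \<beta>) * V \<le> a" unfolding a_def V_def times_divide_eq_right
    using m by (intro divide_right_mono) auto
  have V: "0 \<le> V" using m by (simp add: V_def)
  have a: "0 \<le> a" using m by (simp add: a_def)
  have "Wj C j \<le> dev (S j) + m * D (centroid (S j)) (C l)"
    using w_center[OF l(1), of C j] parallel_axis[OF S_finite] by (simp add: m_def)
  then have "a \<le> V + D (centroid (S j)) (C l)" using m by (simp add: a_def V_def field_simps)
  also have "D (centroid (S j)) (C l) \<le> 2 * \<delta> + 2 * D (X p) (C l)"
    unfolding \<delta>_def D_commute[of "X p" "centroid (S j)"] by (rule D_triangle)
  also have "D (X p) (C l) \<le> \<beta>\<^sup>2 / 64 * a" using near l by (simp add: a_def m_def)
  finally have 1: "a \<le> V + (2 * \<delta> + 2 * (\<beta>\<^sup>2 / 64 * a))" by simp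
  \<comment> \<open>Uncovered: the mean cost \<open>a\<close> exceeds the mean deviation
    \<open>V\<close> by at least half of \<open>\<beta> * a\<close>.\<close>
  have "\<beta> * a \<le> (1 + \<beta>) * (a - V) "
    using aV by (simp add: algebra_simps)
  also have "\<dots> \<le> 2 * (a - V)"
  proof (rule mult_right_mono)
    have "1 * V \<le> (1 + \<beta>) * V" using V \<beta> by (intro mult_right_mono) auto
    then show "0 \<le> a - V" using aV by simp
  qed (use \<beta> in simp)
  finally have 2: "\<beta> * a \<le> 2 * (a - V)" .
  have "\<beta>\<^sup>2 * a \<le> \<beta> * a"
    using \<beta> a by (intro mult_right_mono) (auto simp: power2_eq_square mult_left_le)
  moreover have "a \<le> V + 2 * \<delta> + \<beta>\<^sup>2 * a / 32" using 1 by (simp add: mult.commute)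
  moreover have "0 \<le> \<delta>" by (simp add: \<delta>_def)
  \<comment> \<open>Combined with the triangle bound: \<beta>a/2 \<le> a - V \<le> 2\<delta> +
    \<beta>a/32, hence \<beta>a \<le> 64\<delta>/15; the 8 is a convenient larger constant.\<close>
  moreover have "y \<le> 8 * \<delta>" if "x \<le> y" "a \<le> V + 2 * \<delta> + x / 32" "0 \<le> \<delta>" "y \<le> 2 * (a - V)" for x y :: real
  proof -
    have "15 * y \<le> 64 * \<delta>" using that by (simp add: field_simps)
    then show ?thesis using that by linarith
  qed
  ultimately have "\<beta> * a \<le> 8 * \<delta>" using 2 by blast
  then have "\<beta> / 64 * (\<beta> * a) \<le> \<beta> / 64 * (8 * \<delta>)" using \<beta> by (intro mult_left_mono) auto
  then have "\<beta>\<^sup>2 / 64 * a \<le> \<beta> / 8 * \<delta>" by (simp add: power2_eq_square)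
  then show ?thesis using near l by (simp add: a_def m_def \<delta>_def)
qed

text \<open>A point is moved if its cost is below \<beta>^2/64 times the average of its cluster. A
  point that stays is costly enough to be drawn with probability at least \<kappa>/m, as the cluster
  is heavy; a moved one is represented by a center, drawn with probability at least 1/(3k).\<close>

lemma stage_covers:
  assumes "\<not> good C"
  obtains j where "j \<in> uncovered C" "pr (stage i C) (\<lambda>C'. (\<forall>l<i. C' l = C l) \<and> (\<exists>c. (\<forall>l\<ge>i. C' l = c) \<and>
      (\<Sum>p\<in>S j. D (X p) c) \<le> (1 + \<beta>) * dev (S j))) \<ge> \<kappa> ^ M / 2"
proof -
  obtain j where j: "j \<in> uncovered C" "\<beta> * W C \<le> 3 * k * Wj C j"
    using heavy_uncovered[OF assms] .
  define m where "m = real (card (S j))"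
  have Wj: "0 < Wj C j"
  proof -
    have "0 \<le> (1 + \<beta>) * dev (S j)" using \<beta> by (intro mult_nonneg_nonneg) auto
    also have "\<dots> < Wj C j" using j(1) by (simp add: uncovered_def)
    finally show ?thesis .
  qed
  then have ne: "S j \<noteq> {}" by (auto simp: Wj_def)
  then have m: "m > 0" by (simp add: m_def card_gt_0_iff)
  have "Wj C j \<le> W C" unfolding W_split by (rule member_le_sum) (use j in \<open>auto simp: uncovered_def\<close>)
  with Wj have W: "W C > 0" by simp
  obtain nl where nl: "\<And>p. nl p < k \<and> w C p = D (X p) (C (nl p))" using w_attained[of C] by metis
  define far where "far p \<longleftrightarrow> \<beta>\<^sup>2 / 64 * (Wj C j / m) \<le> w C p" for p
  define \<pi> where "\<pi> p = (if far p then p else n + nl p)" for p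
  have "pr (stage i C) (\<lambda>C'. (\<forall>l<i. C' l = C l) \<and> (\<exists>c. (\<forall>l\<ge>i. C' l = c) \<and>
      (\<Sum>p\<in>S j. D (X p) c) \<le> (1 + \<beta>) * dev (S j))) \<ge> \<kappa> ^ M / 2"
  proof (rule pr_stage[OF S_finite ne M1])
    show "0 < \<beta>" by (rule \<beta>)
    show "2 / M + 2 * (\<beta> / 8) \<le> \<beta> / 2" using M4 by simp
    show "0 \<le> \<kappa>" by (rule \<kappa>)
    fix p assume p: "p \<in> S j"
    show "D (X p) (row C (\<pi> p)) \<le> \<beta> / 8 * D (X p) (centroid (S j))"
    proof (cases "far p")
      case True
      then show ?thesis using S_less[OF p] \<beta> by (simp add: \<pi>_def row_def)
    next
      case False
      then have "D (X p) (C (nl p)) \<le> \<beta> / 8 * D (X p) (centroid (S j))"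
        using near_bound[OF j(1) p] nl[of p] by (simp add: far_def m_def not_le)
      then show ?thesis using False by (simp add: \<pi>_def row_def)
    qed
    show "\<kappa> * card {p' \<in> S j. \<pi> p' = \<pi> p} / card (S j) \<le> pr (sample C) (\<lambda>r. r = \<pi> p)"
    proof (cases "far p")
      case True
      \<comment> \<open>Moved points have indices from \<open>n\<close> on, so the fibre of a point
        that stays is a singleton.\<close>
      have "{p' \<in> S j. \<pi> p' = \<pi> p} = {p}"
        using p S_less[OF p] True by (auto simp: \<pi>_def split: if_splits)
      then have "\<kappa> * card {p' \<in> S j. \<pi> p' = \<pi> p} / card (S j) = \<kappa> / m" by (simp add: m_def)
      also have "\<dots> \<le> \<beta> ^ 3 / (4608 * k) / m" using \<kappa> m by (intro divide_right_mono) auto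
      also have "\<dots> \<le> w C p / (24 * W C)"
      proof -
        have "\<beta> ^ 3 * W C = \<beta>\<^sup>2 * (\<beta> * W C)" by (simp add: power3_eq_cube power2_eq_square)
        also have "\<dots> \<le> \<beta>\<^sup>2 * (3 * k * Wj C j)" by (intro mult_left_mono j) simp
        also have "\<dots> = 192 * k * m * (\<beta>\<^sup>2 / 64 * (Wj C j / m))" using m by simp
        also have "\<dots> \<le> 192 * k * m * w C p"
          by (rule mult_left_mono) (use True m in \<open>auto simp: far_def\<close>)
        finally have "\<beta> ^ 3 * W C \<le> 192 * k * m * w C p" .
        then show ?thesis using W m k_pos by (simp add: field_simps)
      qed
      also have "\<dots> \<le> pr (sample C) (\<lambda>r. r = p)"
        by (rule pr_sample_far[OF s_def h W S_less[OF p]])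
      finally show ?thesis using True by (simp add: \<pi>_def)
    next
      case False
      \<comment> \<open>Possibly the whole cluster is moved to one center, so its fibre is bounded
        by the cluster.\<close>
      have "card {p' \<in> S j. \<pi> p' = \<pi> p} \<le> card (S j)" by (rule card_mono) auto
      then have "\<kappa> * card {p' \<in> S j. \<pi> p' = \<pi> p} / card (S j) \<le> \<kappa> * card (S j) / card (S j)"
        using \<kappa> by (intro divide_right_mono mult_left_mono) auto
      also have "\<dots> \<le> 1 / (3 * k)" using \<kappa>_le m by (simp add: m_def)
      also have "\<dots> \<le> pr (sample C) (\<lambda>r. r = n + nl p)"
        by (rule pr_sample_center) (use nl in auto)
      finally show ?thesis using False by (simp add: \<pi>_def)
    qed
  qed
  with j(1) show thesis by (rule that)
qed

text \<open>The starting centers are arbitrary and tell nothing, but some cluster contains at least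
  n/k points, and the uniform mode alone samples it well enough.\<close>

lemma first_stage: "pr (stage 0 C) (trial_inv 1) \<ge> \<kappa> ^ M / 2"
proof -
  obtain j where j: "j < k" "n \<le> k * card (S j)"
  proof (rule ccontr)
    note ob = that
    assume *: "\<not> thesis"
    have "k * card (S j) < n" if "j < k" for j
      using * ob[of j] that by (meson not_less)
    then have "(\<Sum>j<k. k * card (S j)) < (\<Sum>j<k. n)"
      by (intro sum_strict_mono) auto
    moreover have "(\<Sum>j<k. \<Sum>p\<in>S j. 1::nat) = (\<Sum>p<n. 1)"
      unfolding S_def by (rule sum.group) (use f in auto)
    then have "(\<Sum>j<k. card (S j)) = n" by simp
    ultimately show False by (simp add: sum_distrib_left[symmetric])
  qed
  define m where "m = real (card (S j))"
  have "card (S j) > 0" using j n_pos by (cases "card (S j)") auto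
  then have m: "m > 0" and ne: "S j \<noteq> {}" by (auto simp: m_def)
  have nm: "real n \<le> k * m" unfolding m_def of_nat_mult[symmetric] by (rule of_nat_mono) (rule j)
  have "pr (stage 0 C) (\<lambda>C'. (\<forall>l<0. C' l = C l) \<and> (\<exists>c. (\<forall>l\<ge>0. C' l = c) \<and>
      (\<Sum>p\<in>S j. D (X p) c) \<le> (1 + \<beta>) * dev (S j))) \<ge> \<kappa> ^ M / 2"
  proof (rule pr_stage[OF S_finite ne M1, where \<theta> = 0 and \<pi> = "\<lambda>p. p"])
    show "0 < \<beta>" by (rule \<beta>)
    show "2 / M + 2 * 0 \<le> \<beta> / 2" using M4 \<beta> by simp
    show "0 \<le> \<kappa>" by (rule \<kappa>)
    fix p assume p: "p \<in> S j"
    show "D (X p) (row C p) \<le> 0 * D (X p) (centroid (S j))"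
      using S_less[OF p] by (simp add: row_def)
    have "{p' \<in> S j. p' = p} = {p}" using p by auto
    then have "\<kappa> * card {p' \<in> S j. p' = p} / card (S j) = \<kappa> / m" by (simp add: m_def)
    also have "\<dots> \<le> 1 / (3 * k) / m" by (rule divide_right_mono[OF \<kappa>_le]) (use m in simp)
    also have "\<dots> \<le> 1 / (3 * n)" using m n_pos k_pos nm by (simp add: field_simps)
    also have "\<dots> \<le> pr (sample C) (\<lambda>r. r = p)" by (rule pr_sample_point[OF S_less[OF p]])
    finally show "\<kappa> * card {p' \<in> S j. p' = p} / card (S j) \<le> pr (sample C) (\<lambda>r. r = p)" .
  qed
  also have "\<dots> \<le> pr (stage 0 C) (trial_inv 1)"
  proof (rule pr_mono)
    fix C' assume "(\<forall>l<0. C' l = C l) \<and> (\<exists>c. (\<forall>l\<ge>0. C' l = c) \<and> (\<Sum>p\<in>S j. D (X p) c) \<le> (1 + \<beta>) * dev (S j))"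
    then obtain c where c: "\<And>l. C' l = c" "(\<Sum>p\<in>S j. D (X p) c) \<le> (1 + \<beta>) * dev (S j)" by auto
    have "j \<notin> uncovered C'" using c w_center[OF j(1), of C' j] by (auto simp: uncovered_def)
    then have "uncovered C' \<subseteq> {..<k} - {j}" by (auto simp: uncovered_def)
    then have "card (uncovered C') \<le> card ({..<k} - {j})" by (intro card_mono) auto
    then show "trial_inv 1 C'" using c(1) j(1) by (simp add: trial_inv_def)
  qed
  finally show ?thesis .
qed

text \<open>The overwritten slots repeat slot \<open>i - 1\<close>, so no point gets farther from
  the centers: goodness and covered clusters persist. If \<open>C\<close> is not yet good, a
  successful stage covers one more cluster.\<close>

lemma later_stage:
  assumes "trial_inv i C" "1 \<le> i" "i < k"
  shows "pr (stage i C) (trial_inv (Suc i)) \<ge> \<kappa> ^ M / 2"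
proof -
  let ?Q = "\<lambda>C'. (\<forall>l<i. C' l = C l) \<and> (\<exists>c. \<forall>l\<ge>i. C' l = c)"
  have w: "w C' p \<le> w C p" if C': "\<And>l. l < i \<Longrightarrow> C' l = C l" for C' p
  proof -
    obtain l where l: "l < k" "w C p = D (X p) (C l)" using w_attained by blast
    show ?thesis
    proof (cases "l < i")
      case True
      then show ?thesis using C'[of l] l w_le[OF l(1), of C' p] by simp
    next
      case False
      then have "C l = C (i - 1)" using assms(1) by (simp add: trial_inv_def)
      moreover have "C' (i - 1) = C (i - 1)" using C' assms(2) by simp
      ultimately show ?thesis using l w_le[of "i - 1" C' p] assms(3) by simp
    qed
  qed
  have good_mono: "good C'" if "good C" "\<And>l. l < i \<Longrightarrow> C' l = C l" for C'
  proof -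
    have "W C' \<le> W C" unfolding W_def by (intro sum_mono w that)
    then show ?thesis using that(1) by (simp add: good_def)
  qed
  show ?thesis
  proof (cases "good C")
    case True
    have "pr (stage i C) (trial_inv (Suc i)) = 1"
    proof (rule pr_True)
      fix C' assume "C' \<in> set_pmf (stage i C)"
      then have "C' \<in> (\<lambda>rs l. if l < i then C l else mean C rs) ` set_pmf (reps M (sample C))"
        by (simp only: stage_def set_map_pmf)
      then obtain rs where C': "C' = (\<lambda>l. if l < i then C l else mean C rs)" by (rule imageE)
      have "good C'" by (rule good_mono[OF True]) (simp add: C')
      moreover have "C' l = C' i" if "l \<ge> Suc i" for l using that by (simp add: C')
      ultimately show "trial_inv (Suc i) C'" by (simp add: trial_inv_def)
    qed
    moreover have "\<kappa> \<le> 1"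
    proof -
      have "1 / (3 * real k) \<le> 1" using k_pos by (simp add: field_simps)
      then show ?thesis using \<kappa>_le by linarith
    qed
    ultimately show ?thesis using power_le_one[of \<kappa> M] \<kappa> by simp
  next
    case False
    obtain j where j: "j \<in> uncovered C" "pr (stage i C) (\<lambda>C'. (\<forall>l<i. C' l = C l) \<and> (\<exists>c. (\<forall>l\<ge>i. C' l = c) \<and>
      (\<Sum>p\<in>S j. D (X p) c) \<le> (1 + \<beta>) * dev (S j))) \<ge> \<kappa> ^ M / 2" (is "_ \<le> pr _ ?P")
      using stage_covers[OF False] .
    have "pr (stage i C) ?P \<le> pr (stage i C) (trial_inv (Suc i))"
    proof (rule pr_mono)
      fix C' assume "?P C'"
      then obtain c where c: "\<And>l. l < i \<Longrightarrow> C' l = C l" "\<And>l. l \<ge> i \<Longrightarrow> C' l = c"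
        "(\<Sum>p\<in>S j. D (X p) c) \<le> (1 + \<beta>) * dev (S j)" by auto
      have "card (uncovered C') < card (uncovered C)"
        by (rule uncovered_less[OF w j(1) assms(3)]) (use c in auto)
      moreover have "card (uncovered C) \<le> k - i" using assms(1) False by (simp add: trial_inv_def)
      ultimately have "card (uncovered C') \<le> k - Suc i" by simp
      then show "trial_inv (Suc i) C'" using c(2) by (simp add: trial_inv_def)
    qed
    with j(2) show ?thesis by linarith
  qed
qed

lemma pr_trial_inv: "1 \<le> i \<Longrightarrow> i \<le> k \<Longrightarrow> pr (iterM i stage C) (trial_inv i) \<ge> (\<kappa> ^ M / 2) ^ i"
proof (induction i rule: dec_induct)
  case base
  then show ?case using first_stage by (simp add: bind_return_pmf)
next
  case (step i)
  have "(\<kappa> ^ M / 2) ^ Suc i \<le> \<kappa> ^ M / 2 * pr (iterM i stage C) (trial_inv i)"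
    using step \<kappa> by (simp add: mult_left_mono)
  also have "\<dots> \<le> pr (iterM (Suc i) stage C) (trial_inv (Suc i))"
    unfolding iterM.simps
    by (rule pr_bind_ge) (use later_stage step \<kappa> in \<open>auto intro: fin_iterM\<close>)
  finally show ?case .
qed

lemma pr_trial: "pr (trial C) good \<ge> (\<kappa> ^ M / 2) ^ k"
proof -
  have "(\<kappa> ^ M / 2) ^ k \<le> pr (trial C) (trial_inv k)"
    unfolding trial_def by (rule pr_trial_inv) (use k_pos in auto)
  also have "\<dots> \<le> pr (trial C) good"
    by (rule pr_mono) (auto simp: trial_inv_def intro: all_covered_good)
  finally show ?thesis .
qed

section \<open>Repeated trials\<close>

text \<open>One-sided: only an underestimate can let a bad solution win, whereas overestimates
  merely delay success.\<close>

definition accurate :: "real \<Rightarrow> centers \<times> real \<Rightarrow> bool" where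
  "accurate \<tau> x \<longleftrightarrow> (1 - \<tau>) * s * W (fst x) \<le> snd x"

text \<open>Whatever the history, a round attains the value with probability at least q/2: its trial
  is good with probability at least \<open>q\<close>, and the evaluation is right with probability
  at least one half. Stored values never increase, so the failures multiply.\<close>

lemma pr_search_value:
  fixes \<tau> :: real
  assumes "0 < \<tau>" "q \<le> (\<kappa> ^ M / 2) ^ k" "k / (h * \<tau>) \<le> q / 2" "0 \<le> q" "q \<le> 1"
  shows "pr (iterM T (\<lambda>_. round) st) (\<lambda>st. \<not> snd (snd st) \<le> (1 + \<tau>) * s * (1 + 2 * \<beta>) * OPT) \<le> (1 - q / 2) ^ T"
proof (induction T)
  case (Suc T)
  let ?V = "(1 + \<tau>) * s * (1 + 2 * \<beta>) * OPT"
  have step: "pr (round st) (\<lambda>st'. \<not> snd (snd st') \<le> ?V) \<le> (1 - q / 2) * of_bool (\<not> snd (snd st) \<le> ?V)" for st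
  proof (cases "snd (snd st) \<le> ?V")
    case True
    then have "pr (round st) (\<lambda>st'. \<not> snd (snd st') \<le> ?V) \<le> pr (round st) (\<lambda>_. False)"
      by (intro pr_mono) (auto simp: round_def split: if_splits)
    then show ?thesis using True by (simp add: pr_E)
  next
    case False
    have 1: "(1 - k / (h * \<tau>)) * pr (trial (fst st)) good \<le> pr (round st) (\<lambda>st'. snd (snd st') \<le> ?V)"
      unfolding round_def
    proof (rule pr_bind_ge)
      show "0 \<le> 1 - k / (h * \<tau>)" using assms by linarith
      fix C assume C: "good C"
      have "1 - k / (h * \<tau>) \<le> pr (total C) (\<lambda>v. (1 - \<tau>) * s * W C \<le> v \<and> v \<le> (1 + \<tau>) * s * W C)"
        using total_accurate[OF s_def h(1) assms(1), of C] unfolding pr_not by linarith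
      also have "\<dots> \<le> pr (map_pmf (\<lambda>v. if v < snd (snd st) then (C, C, v) else (C, snd st)) (total C))
          (\<lambda>st'. snd (snd st') \<le> ?V)"
        unfolding pr_map
      proof (rule pr_mono)
        fix v assume v: "(1 - \<tau>) * s * W C \<le> v \<and> v \<le> (1 + \<tau>) * s * W C"
        have "(1 + \<tau>) * s * W C \<le> (1 + \<tau>) * s * ((1 + 2 * \<beta>) * OPT)"
          using C assms(1) by (intro mult_left_mono) (auto simp: good_def)
        then have "v \<le> ?V" using v by (simp add: mult.assoc)
        then show "snd (snd (if v < snd (snd st) then (C, C, v) else (C, snd st))) \<le> ?V" using False by auto
      qed
      finally show "1 - k / (h * \<tau>) \<le> pr (map_pmf (\<lambda>v. if v < snd (snd st) then (C, C, v) else (C, snd st)) (total C))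
          (\<lambda>st'. snd (snd st') \<le> ?V)" .
    qed auto
    have "q / 2 \<le> (1 - k / (h * \<tau>)) * q"
    proof -
      have "1 / 2 * q \<le> (1 - k / (h * \<tau>)) * q"
        using assms by (intro mult_right_mono) linarith+
      then show ?thesis by simp
    qed
    also have "\<dots> \<le> (1 - k / (h * \<tau>)) * pr (trial (fst st)) good"
      using assms(2) pr_trial[of "fst st"] assms by (intro mult_left_mono) linarith+
    finally have "q / 2 \<le> pr (round st) (\<lambda>st'. snd (snd st') \<le> ?V)" using 1 by linarith
    then show ?thesis using False unfolding pr_not by simp
  qed
  have fin: "fin (iterM T (\<lambda>_. round) st)" by (rule fin_iterM) simp
  have "pr (iterM (Suc T) (\<lambda>_. round) st) (\<lambda>st. \<not> snd (snd st) \<le> ?V)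
      = E (iterM T (\<lambda>_. round) st) (\<lambda>st. pr (round st) (\<lambda>st'. \<not> snd (snd st') \<le> ?V))"
    unfolding iterM.simps by (rule pr_bind[OF fin]) simp
  also have "\<dots> \<le> E (iterM T (\<lambda>_. round) st) (\<lambda>st. (1 - q / 2) * of_bool (\<not> snd (snd st) \<le> ?V))"
    by (rule E_mono[OF fin step])
  also have "\<dots> = (1 - q / 2) * pr (iterM T (\<lambda>_. round) st) (\<lambda>st. \<not> snd (snd st) \<le> ?V)"
    by (simp add: pr_E)
  also have "\<dots> \<le> (1 - q / 2) ^ Suc T"
    using Suc.IH assms by (simp add: mult_left_mono)
  finally show ?case .
qed simp

text \<open>Union bound over the initial evaluation and the \<open>T\<close> later ones: a stored
  accurate pair can only be replaced by a freshly evaluated one.\<close>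

lemma pr_search_accurate:
  fixes \<tau> :: real
  assumes "0 < \<tau>"
  shows "pr (search T C) (\<lambda>st. \<not> accurate \<tau> (snd st)) \<le> (real T + 1) * (k / (h * \<tau>))"
proof -
  define \<alpha> where "\<alpha> = k / (h * \<tau>)"
  have \<alpha>: "pr (total C) (\<lambda>v. \<not> accurate \<tau> (C, v)) \<le> \<alpha>" for C
    using total_accurate[OF s_def h(1) assms, of C] unfolding \<alpha>_def
    by (rule order_trans[rotated]) (auto intro: pr_mono simp: accurate_def)
  have \<alpha>0: "0 \<le> \<alpha>" using assms by (simp add: \<alpha>_def)
  have step: "pr (round st) (\<lambda>st'. \<not> accurate \<tau> (snd st')) \<le> of_bool (\<not> accurate \<tau> (snd st)) + \<alpha>" for st
  proof (cases "accurate \<tau> (snd st)")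
    case True
    have "pr (round st) (\<lambda>st'. \<not> accurate \<tau> (snd st')) = E (trial (fst st)) (\<lambda>C. pr (total C)
        (\<lambda>v. \<not> accurate \<tau> (snd (if v < snd (snd st) then (C, C, v) else (C, snd st)))))"
      unfolding round_def by (subst pr_bind) (simp_all add: pr_map)
    also have "\<dots> \<le> E (trial (fst st)) (\<lambda>_. \<alpha>)"
    proof (rule E_mono)
      fix C
      have "pr (total C) (\<lambda>v. \<not> accurate \<tau> (snd (if v < snd (snd st) then (C, C, v) else (C, snd st))))
          \<le> pr (total C) (\<lambda>v. \<not> accurate \<tau> (C, v))"
        by (rule pr_mono) (use True in \<open>auto split: if_splits\<close>)
      then show "pr (total C) (\<lambda>v. \<not> accurate \<tau> (snd (if v < snd (snd st) then (C, C, v) else (C, snd st)))) \<le> \<alpha>"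
        using \<alpha>[of C] by linarith
    qed simp
    finally show ?thesis using True by simp
  qed (use \<alpha>0 in \<open>simp add: add_increasing2\<close>)
  have "pr (iterM T (\<lambda>_. round) st) (\<lambda>st'. \<not> accurate \<tau> (snd st')) \<le> of_bool (\<not> accurate \<tau> (snd st)) + T * \<alpha>" for st
  proof (induction T)
    case (Suc T)
    have fin: "fin (iterM T (\<lambda>_. round) st)" by (rule fin_iterM) simp
    have "pr (iterM (Suc T) (\<lambda>_. round) st) (\<lambda>st. \<not> accurate \<tau> (snd st))
        = E (iterM T (\<lambda>_. round) st) (\<lambda>st. pr (round st) (\<lambda>st'. \<not> accurate \<tau> (snd st')))"
      unfolding iterM.simps by (rule pr_bind[OF fin]) simp
    also have "\<dots> \<le> E (iterM T (\<lambda>_. round) st) (\<lambda>st. of_bool (\<not> accurate \<tau> (snd st)) + \<alpha>)"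
      by (rule E_mono[OF fin step])
    also have "\<dots> = pr (iterM T (\<lambda>_. round) st) (\<lambda>st. \<not> accurate \<tau> (snd st)) + \<alpha>"
      using fin by (simp add: pr_E E_add)
    finally show ?case using Suc.IH by (simp add: algebra_simps)
  qed simp
  note iter = this
  have fin: "fin (iterM T (\<lambda>_. round) st)" for st by (rule fin_iterM) simp
  have "pr (search T C) (\<lambda>st. \<not> accurate \<tau> (snd st))
      = E (total C) (\<lambda>v. pr (iterM T (\<lambda>_. round) (C, C, v)) (\<lambda>st. \<not> accurate \<tau> (snd st)))"
    unfolding search_def by (rule pr_bind) (simp_all add: fin)
  also have "\<dots> \<le> E (total C) (\<lambda>v. of_bool (\<not> accurate \<tau> (C, v)) + T * \<alpha>)"
    by (rule E_mono) (use iter[of "(C, C, v)" for v] in auto)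
  also have "\<dots> = pr (total C) (\<lambda>v. \<not> accurate \<tau> (C, v)) + T * \<alpha>"
    by (simp add: pr_E E_add)
  also have "\<dots> \<le> (real T + 1) * \<alpha>" using \<alpha>[of C] by (simp add: algebra_simps)
  finally show ?thesis unfolding \<alpha>_def .
qed

text \<open>Two events suffice: the stored value is small, and it does not underestimate the
  solution stored with it.\<close>

lemma pr_search:
  fixes \<tau> :: real
  assumes \<tau>: "0 < \<tau>" "\<tau> < 1" and q: "q \<le> (\<kappa> ^ M / 2) ^ k" "k / (h * \<tau>) \<le> q / 2" "0 \<le> q" "q \<le> 1"
  shows "pr (search T C) (\<lambda>st. (1 - \<tau>) * W (fst (snd st)) \<le> (1 + \<tau>) * (1 + 2 * \<beta>) * OPT)
     \<ge> 1 - (1 - q / 2) ^ T - (real T + 1) * (k / (h * \<tau>))"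
proof -
  let ?V = "(1 + \<tau>) * s * (1 + 2 * \<beta>) * OPT"
  have fin: "fin (iterM T (\<lambda>_. round) st)" for st by (rule fin_iterM) simp
  have "pr (search T C) (\<lambda>st. \<not> snd (snd st) \<le> ?V)
      = E (total C) (\<lambda>v. pr (iterM T (\<lambda>_. round) (C, C, v)) (\<lambda>st. \<not> snd (snd st) \<le> ?V))"
    unfolding search_def by (rule pr_bind) (simp_all add: fin)
  also have "\<dots> \<le> E (total C) (\<lambda>v. (1 - q / 2) ^ T)"
    by (intro E_mono pr_search_value[OF \<tau>(1) q]) simp
  finally have 1: "pr (search T C) (\<lambda>st. \<not> snd (snd st) \<le> ?V) \<le> (1 - q / 2) ^ T" by simp
  have s: "real s > 0" using s_def h by simp
  have "pr (search T C) (\<lambda>st. \<not> (1 - \<tau>) * W (fst (snd st)) \<le> (1 + \<tau>) * (1 + 2 * \<beta>) * OPT)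
      \<le> pr (search T C) (\<lambda>st. \<not> snd (snd st) \<le> ?V \<or> \<not> accurate \<tau> (snd st))"
  proof (rule pr_mono)
    fix st :: "centers \<times> centers \<times> real"
    assume *: "\<not> (1 - \<tau>) * W (fst (snd st)) \<le> (1 + \<tau>) * (1 + 2 * \<beta>) * OPT"
    show "\<not> snd (snd st) \<le> ?V \<or> \<not> accurate \<tau> (snd st)"
    proof (rule ccontr)
      assume "\<not> ?thesis"
      then have "(1 - \<tau>) * s * W (fst (snd st)) \<le> ?V" by (auto simp: accurate_def)
      then have "s * ((1 - \<tau>) * W (fst (snd st))) \<le> s * ((1 + \<tau>) * (1 + 2 * \<beta>) * OPT)"
        by (simp only: mult.assoc mult.left_commute)
      then show False using * s by (simp only: mult_le_cancel_left_pos)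
    qed
  qed
  also have "\<dots> \<le> (1 - q / 2) ^ T + (real T + 1) * (k / (h * \<tau>))"
    by (rule order_trans[OF pr_disj add_mono[OF 1 pr_search_accurate[OF \<tau>(1)]]])
  finally show ?thesis unfolding pr_not by linarith
qed

end

section \<open>The program\<close>

primrec blk :: "instr list \<Rightarrow> cmd" where
  "blk [] = Skip"
| "blk (i # is) = Sq (Ins i) (blk is)"

text \<open>Loops over coordinates are unrolled, \<open>d\<close> being fixed with the program, and
  need no counter.\<close>

primrec unr :: "(nat \<Rightarrow> cmd) \<Rightarrow> nat \<Rightarrow> cmd" where
  "unr f 0 = Skip"
| "unr f (Suc m) = Sq (unr f m) (f m)"

text \<open>The sketch matrix has \<open>2^d\<close> possible rows, which are hardwired into the leaves of a decision tree on
  register 16; so a row is applied in time \<open>O(d)\<close>. The subtree at \<open>m\<close> serves the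
  values \<open>m \<le> x < m + 2^l\<close>.\<close>

primrec tree :: "(nat \<Rightarrow> cmd) \<Rightarrow> nat \<Rightarrow> nat \<Rightarrow> cmd" where
  "tree leaf 0 m = leaf m"
| "tree leaf (Suc l) m = Sq (Ins (NConst 17 (m + 2 ^ l)))
     (Ifc (NLess 16 17) (tree leaf l m) (tree leaf l (m + 2 ^ l)))"

text \<open>The real memory is a matrix with rows of length \<open>d\<close>: points in rows \<open>0..<n\<close>, current centers from
  row \<open>n\<close>, best centers from row \<open>n + k\<close>, an accumulator in row \<open>n + 2k\<close>, prefix sums after that.
  Natural registers: 0: n, 1: k, 2: s, 3: number of rounds, 4: M, 6: n - 1, 7: k - 1, 8: 2, 9: 0, 19: 2^d - 1,
  22: address of the prefix sums, 29: n + 2k, 30: n + k, 31: 1.\<close>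

definition ld :: "nat \<Rightarrow> nat \<Rightarrow> nat \<Rightarrow> nat \<Rightarrow> cmd" where
  "ld d r \<rho> j = blk [NConst 20 d, NArith 20 Times \<rho> 20, NConst 21 j, NArith 20 Plus 20 21, RLoad r 20]"

definition st :: "nat \<Rightarrow> nat \<Rightarrow> nat \<Rightarrow> cmd" where
  "st d \<rho> j = blk [NConst 20 d, NArith 20 Times \<rho> 20, NConst 21 j, NArith 20 Plus 20 21, RStore 20 7]"

definition leafp :: "nat \<Rightarrow> (nat \<Rightarrow> nat \<Rightarrow> real) \<Rightarrow> nat \<Rightarrow> cmd" where
  "leafp d G x = Sq (Ins (RConst 1 0)) (unr (\<lambda>j. Sq (ld d 2 12 j) (Sq (ld d 3 18 j)
     (blk [RArith 2 Minus 2 3, RConst 3 (G x j), RArith 2 Times 3 2, RArith 1 Plus 1 2]))) d)"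

definition estp :: "nat \<Rightarrow> (nat \<Rightarrow> nat \<Rightarrow> real) \<Rightarrow> cmd" where
  "estp d G = Sq (Ins (RConst 4 0)) (For 10 2 (Sq (Ins (NLoad 16 10)) (Sq (tree (leafp d G) d 0)
     (blk [RArith 1 Times 1 1, RArith 4 Plus 4 1]))))"

text \<open>Register 9 is zero, so the first test asks whether a later center is considered; the
  first one initializes the minimum. Adding the constant 0 copies a real register.\<close>

definition wtp :: "nat \<Rightarrow> (nat \<Rightarrow> nat \<Rightarrow> real) \<Rightarrow> cmd" where
  "wtp d G = For 11 1 (Sq (Ins (NArith 18 Plus 0 11)) (Sq (estp d G)
     (Ifc (NLess 9 11) (Ifc (RLess 4 5) (blk [RConst 7 0, RArith 5 Plus 4 7]) Skip) (blk [RConst 7 0, RArith 5 Plus 4 7]))))"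

definition sump :: "nat \<Rightarrow> (nat \<Rightarrow> nat \<Rightarrow> real) \<Rightarrow> cmd" where
  "sump d G = Sq (Ins (RConst 6 0)) (For 12 0 (Sq (wtp d G)
     (blk [RArith 6 Plus 6 5, NArith 23 Plus 22 12, RStore 23 6])))"

definition drawp :: cmd where
  "drawp = For 10 2 (Sq (Ins (NRand 16 19)) (Ins (NStore 10 16)))"

definition passp :: "nat \<Rightarrow> (nat \<Rightarrow> nat \<Rightarrow> real) \<Rightarrow> cmd" where
  "passp d G = Sq drawp (sump d G)"

definition pickp :: cmd where
  "pickp = Sq (blk [NConst 27 0, ROfNat 7 25, RArith 7 Times 7 6, ROfNat 8 0])
     (For 12 0 (Sq (blk [NArith 23 Plus 22 12, RLoad 9 23, RArith 9 Times 8 9])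
       (Ifc (RLess 7 9) Skip (Ins (NArith 27 Plus 27 31)))))"

text \<open>All three candidates are prepared before the mode in register 24 selects one, so the
  code draws in the same order as \<open>sample\<close>.\<close>

definition samplep :: "nat \<Rightarrow> (nat \<Rightarrow> nat \<Rightarrow> real) \<Rightarrow> cmd" where
  "samplep d G = Sq (passp d G) (Sq (Ins (NRand 24 8)) (Sq (Ins (NRand 25 6)) (Sq (Ins (NRand 26 7)) (Sq pickp
     (Ifc (NLess 9 24) (Ifc (NLess 31 24) (Ins (NArith 28 Plus 0 26)) (Ins (NArith 28 Plus 27 9)))
       (Ins (NArith 28 Plus 25 9)))))))"

definition cprow :: "nat \<Rightarrow> nat \<Rightarrow> nat \<Rightarrow> cmd" where
  "cprow d \<sigma> \<rho> = unr (\<lambda>j. Sq (ld d 7 \<sigma> j) (st d \<rho> j)) d"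

definition zerop :: "nat \<Rightarrow> cmd" where
  "zerop d = unr (\<lambda>j. Sq (Ins (RConst 7 0)) (st d 29 j)) d"

definition addp :: "nat \<Rightarrow> cmd" where
  "addp d = unr (\<lambda>j. Sq (Sq (ld d 7 28 j) (Sq (ld d 9 29 j) (Ins (RArith 7 Plus 9 7)))) (st d 29 j)) d"

definition divp :: "nat \<Rightarrow> cmd" where
  "divp d = unr (\<lambda>j. Sq (Sq (ld d 7 29 j) (Ins (RDiv 7 7 8))) (st d 29 j)) d"

text \<open>The mean is built up in a row of its own, since the samples still depend on the current
  centers while it grows.\<close>

definition stagep :: "nat \<Rightarrow> (nat \<Rightarrow> nat \<Rightarrow> real) \<Rightarrow> cmd" where
  "stagep d G = Sq (Sq (zerop d) (For 14 4 (Sq (samplep d G) (addp d))))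
     (Sq (Ins (ROfNat 8 4)) (Sq (divp d)
       (For 11 1 (Ifc (NLess 11 13) Skip (Sq (Ins (NArith 18 Plus 0 11)) (cprow d 29 18))))))"

definition trialp :: "nat \<Rightarrow> (nat \<Rightarrow> nat \<Rightarrow> real) \<Rightarrow> cmd" where
  "trialp d G = For 13 1 (stagep d G)"

definition roundp :: "nat \<Rightarrow> (nat \<Rightarrow> nat \<Rightarrow> real) \<Rightarrow> cmd" where
  "roundp d G = Sq (trialp d G) (Sq (passp d G) (Ifc (RLess 6 10)
     (Sq (blk [RConst 7 0, RArith 10 Plus 6 7]) (For 11 1 (Sq (blk [NArith 18 Plus 0 11, NArith 23 Plus 30 11]) (cprow d 18 23))))
     Skip))"

definition searchp :: "nat \<Rightarrow> (nat \<Rightarrow> nat \<Rightarrow> real) \<Rightarrow> cmd" where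
  "searchp d G = Sq (Sq (passp d G) (blk [RConst 7 0, RArith 10 Plus 6 7])) (For 15 3 (roundp d G))"

section \<open>Registers touched by the parts of the program\<close>

definition keep :: "cmd \<Rightarrow> nat set \<Rightarrow> nat set \<Rightarrow> bool" where
  "keep c N R \<longleftrightarrow> wn c \<subseteq> N \<and> wr c \<subseteq> R"

lemma frame_nreg: "frame c s s' \<Longrightarrow> keep c N R \<Longrightarrow> x \<notin> N \<Longrightarrow> nreg s' x = nreg s x"
  and frame_rreg: "frame c s s' \<Longrightarrow> keep c N R \<Longrightarrow> x \<notin> R \<Longrightarrow> rreg s' x = rreg s x"
  by (auto simp: frame_def keep_def)

lemma keep_simps [simp]:
  "keep Skip N R"
  "keep (Ins ins) N R \<longleftrightarrow> iwn ins \<subseteq> N \<and> iwr ins \<subseteq> R"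
  "keep (Sq a b) N R \<longleftrightarrow> keep a N R \<and> keep b N R"
  "keep (Ifc t a b) N R \<longleftrightarrow> keep a N R \<and> keep b N R"
  "keep (For i m c) N R \<longleftrightarrow> i \<in> N \<and> 5 \<in> N \<and> keep c N R"
  by (auto simp: keep_def)

lemma keep_unr: "(\<And>j. keep (f j) N R) \<Longrightarrow> keep (unr f m) N R"
  by (induction m) auto

lemma keep_tree: "(\<And>x. keep (leaf x) N R) \<Longrightarrow> 17 \<in> N \<Longrightarrow> keep (tree leaf l m) N R"
  by (induction l arbitrary: m) auto

lemma keep_mono: "keep c N R \<Longrightarrow> N \<subseteq> N' \<Longrightarrow> R \<subseteq> R' \<Longrightarrow> keep c N' R'"
  by (auto simp: keep_def)

lemma keep_ld: "keep (ld d r \<rho> j) {20, 21} {r}" and keep_st: "keep (st d \<rho> j) {20, 21} {}"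
  by (simp_all add: ld_def st_def)

abbreviation NP :: "nat set" where "NP \<equiv> {5, 10, 11, 12, 16, 17, 18, 20, 21, 23}"
abbreviation RP :: "nat set" where "RP \<equiv> {1, 2, 3, 4, 5, 6, 7}"

lemma keep_leafp: "keep (leafp d G x) {20, 21} {1, 2, 3}"
  unfolding leafp_def by (auto intro!: keep_unr intro: keep_mono[OF keep_ld])

lemma keep_estp: "keep (estp d G) {5, 10, 16, 17, 20, 21} {1, 2, 3, 4}"
  unfolding estp_def by (auto intro!: keep_tree intro: keep_mono[OF keep_leafp])

lemma keep_wtp: "keep (wtp d G) {5, 10, 11, 16, 17, 18, 20, 21} {1, 2, 3, 4, 5, 7}"
  unfolding wtp_def by (auto intro: keep_mono[OF keep_estp])

lemma keep_passp: "keep (passp d G) NP RP"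
  unfolding passp_def drawp_def sump_def by (auto intro: keep_mono[OF keep_wtp])

abbreviation NS :: "nat set" where "NS \<equiv> {5, 10, 11, 12, 16, 17, 18, 20, 21, 23, 24, 25, 26, 27, 28}"
abbreviation RS :: "nat set" where "RS \<equiv> {1, 2, 3, 4, 5, 6, 7, 8, 9}"

lemma keep_samplep: "keep (samplep d G) NS RS"
  unfolding samplep_def pickp_def by (auto intro: keep_mono[OF keep_passp])

lemma keep_rows: "keep (zerop d) {20, 21} {7}" "keep (addp d) {20, 21} {7, 9}" "keep (divp d) {20, 21} {7}"
  "keep (cprow d \<sigma> \<rho>) {20, 21} {7}"
  unfolding zerop_def addp_def divp_def cprow_def
  by (auto intro!: keep_unr intro: keep_mono[OF keep_ld] keep_mono[OF keep_st])

lemma keep_stagep: "keep (stagep d G) (insert 14 NS) RS"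
  unfolding stagep_def by (auto intro: keep_mono[OF keep_samplep] keep_mono[OF keep_rows(1)]
      keep_mono[OF keep_rows(2)] keep_mono[OF keep_rows(3)] keep_mono[OF keep_rows(4)])

lemma keep_trialp: "keep (trialp d G) (insert 13 (insert 14 NS)) RS"
  unfolding trialp_def by (auto intro: keep_mono[OF keep_stagep])

lemma keep_roundp: "keep (roundp d G) (insert 13 (insert 14 NS)) (insert 10 RS)"
  unfolding roundp_def by (auto intro: keep_mono[OF keep_trialp] keep_mono[OF keep_passp] keep_mono[OF keep_rows(4)])

lemma keep_searchp: "keep (searchp d G) (insert 13 (insert 14 (insert 15 NS))) (insert 10 RS)"
  unfolding searchp_def by (auto intro: keep_mono[OF keep_roundp] keep_mono[OF keep_passp])

lemma keep_notin: "keep c N R \<Longrightarrow> x \<notin> N \<Longrightarrow> x \<notin> wn c"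
  by (auto simp: keep_def)

section \<open>Rules for instructions, decision trees and rows\<close>

lemma hoare_unr:
  assumes "Inv 0 s" "\<And>j s'. j < m \<Longrightarrow> Inv j s' \<Longrightarrow> hoare (f j) s' (Inv (Suc j))"
  shows "hoare (unr f m) s (Inv m)"
  using assms(2)
proof (induction m)
  case 0
  then show ?case using assms(1) by simp
next
  case (Suc m)
  then have "hoare (unr f m) s (Inv m)" by simp
  then show ?case unfolding unr.simps hoare_Sq
    by (rule hoare_conseq) (use Suc.prems in simp)
qed

lemma hoare_det [simp]:
  "hoare (Ins (NConst i a)) s Q \<longleftrightarrow> Q (s\<lparr>nreg := (nreg s)(i := a)\<rparr>)"
  "hoare (Ins (NArith i f j l)) s Q \<longleftrightarrow> Q (s\<lparr>nreg := (nreg s)(i := arith f (nreg s j) (nreg s l))\<rparr>)"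
  "hoare (Ins (NLoad i j)) s Q \<longleftrightarrow> Q (s\<lparr>nreg := (nreg s)(i := nmem s (nreg s j))\<rparr>)"
  "hoare (Ins (NStore i j)) s Q \<longleftrightarrow> Q (s\<lparr>nmem := (nmem s)(nreg s i := nreg s j)\<rparr>)"
  "hoare (Ins (RConst i b)) s Q \<longleftrightarrow> Q (s\<lparr>rreg := (rreg s)(i := b)\<rparr>)"
  "hoare (Ins (RArith i f j l)) s Q \<longleftrightarrow> Q (s\<lparr>rreg := (rreg s)(i := arith f (rreg s j) (rreg s l))\<rparr>)"
  "hoare (Ins (RDiv i j l)) s Q \<longleftrightarrow> Q (s\<lparr>rreg := (rreg s)(i := rreg s j / rreg s l)\<rparr>)"
  "hoare (Ins (ROfNat i j)) s Q \<longleftrightarrow> Q (s\<lparr>rreg := (rreg s)(i := real (nreg s j))\<rparr>)"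
  "hoare (Ins (RLoad i j)) s Q \<longleftrightarrow> Q (s\<lparr>rreg := (rreg s)(i := rmem s (nreg s j))\<rparr>)"
  "hoare (Ins (RStore i j)) s Q \<longleftrightarrow> Q (s\<lparr>rmem := (rmem s)(nreg s i := rreg s j)\<rparr>)"
  by (simp_all add: hoare_Ins)

lemma coup_NRand: "coup (Ins (NRand i j)) s (pmf_of_set {0..nreg s j}) (\<lambda>r s'. s' = s\<lparr>nreg := (nreg s)(i := r)\<rparr>)"
  by (simp add: coup_def pmf.rel_map rel_pmf_reflI)

text \<open>Only the selected leaf has to be right. The tests on the way down leave an unknown
  number in register 17, hence the quantified \<open>a\<close>.\<close>

lemma hoare_tree:
  assumes "m \<le> nreg s 16" "nreg s 16 < m + 2 ^ l"
    and "\<And>a. hoare (leaf (nreg s 16)) (s\<lparr>nreg := (nreg s)(17 := a)\<rparr>) Q"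
  shows "hoare (tree leaf l m) s Q"
  using assms
proof (induction l arbitrary: m s)
  case 0
  then have "nreg s 16 = m" by simp
  moreover have "s\<lparr>nreg := (nreg s)(17 := nreg s 17)\<rparr> = s" by simp
  ultimately show ?case using 0(3)[of "nreg s 17"] by simp
next
  case (Suc l)
  let ?s = "s\<lparr>nreg := (nreg s)(17 := m + 2 ^ l)\<rparr>"
  have leaf: "hoare (leaf (nreg ?s 16)) (?s\<lparr>nreg := (nreg ?s)(17 := a)\<rparr>) Q" for a
  proof -
    have "?s\<lparr>nreg := (nreg ?s)(17 := a)\<rparr> = s\<lparr>nreg := (nreg s)(17 := a)\<rparr>" "nreg ?s 16 = nreg s 16"
      by simp_all
    then show ?thesis using Suc.prems(3)[of a] by (simp only:)
  qed
  show ?case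
  proof (cases "nreg s 16 < m + 2 ^ l")
    case True
    then have "hoare (tree leaf l m) ?s Q" using Suc.prems by (intro Suc.IH leaf) auto
    then show ?thesis using True by simp
  next
    case False
    then have "hoare (tree leaf l (m + 2 ^ l)) ?s Q" using Suc.prems by (intro Suc.IH leaf) auto
    then show ?thesis using False by simp
  qed
qed

lemma cell_eq_iff: "j < d \<Longrightarrow> j' < d \<Longrightarrow> \<rho> * d + j = \<rho>' * d + j' \<longleftrightarrow> \<rho> = \<rho>' \<and> j = j'" for d :: nat
proof
  assume j: "j < d" "j' < d" and eq: "\<rho> * d + j = \<rho>' * d + j'"
  have "(\<rho> * d + j) div d = \<rho>" "(\<rho> * d + j) mod d = j" using j by auto
  moreover have "(\<rho>' * d + j') div d = \<rho>'" "(\<rho>' * d + j') mod d = j'" using j by auto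
  ultimately show "\<rho> = \<rho>' \<and> j = j'" unfolding eq by simp
qed simp

definition cell :: "nat \<Rightarrow> ram_state \<Rightarrow> nat \<Rightarrow> nat \<Rightarrow> real" where
  "cell d s \<rho> j = rmem s (\<rho> * d + j)"

lemma hoare_ld:
  assumes "\<rho> \<notin> {20, 21}" "\<And>a b. Q (s\<lparr>nreg := (nreg s)(20 := a, 21 := b), rreg := (rreg s)(r := cell d s (nreg s \<rho>) j)\<rparr>)"
  shows "hoare (ld d r \<rho> j) s Q"
  using assms(1) assms(2)[of "nreg s \<rho> * d + j" j] by (simp add: ld_def cell_def fun_upd_twist)

lemma hoare_st:
  assumes "\<rho> \<notin> {20, 21}" "\<And>a b. Q (s\<lparr>nreg := (nreg s)(20 := a, 21 := b), rmem := (rmem s)(nreg s \<rho> * d + j := rreg s 7)\<rparr>)"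
  shows "hoare (st d \<rho> j) s Q"
  using assms(1) assms(2)[of "nreg s \<rho> * d + j" j] by (simp add: st_def fun_upd_twist)

text \<open>Row operations: the new entries \<open>v j\<close> of row \<open>\<rho>\<close> are computed in real register 7.\<close>

lemma hoare_row:
  assumes \<rho>: "\<rho> \<notin> {20, 21}"
    and g: "\<And>j s'. j < d \<Longrightarrow> (\<And>x. x \<notin> {20, 21} \<Longrightarrow> nreg s' x = nreg s x) \<Longrightarrow> rreg s' 8 = rreg s 8 \<Longrightarrow>
      (\<And>\<rho>'. \<rho>' \<noteq> nreg s \<rho> \<Longrightarrow> cell d s' \<rho>' j = cell d s \<rho>' j) \<Longrightarrow> cell d s' (nreg s \<rho>) j = cell d s (nreg s \<rho>) j \<Longrightarrow>
      hoare (g j) s' (\<lambda>s''::ram_state. rreg s'' 7 = v j \<and> (\<forall>x. x \<notin> {20, 21} \<longrightarrow> nreg s'' x = nreg s x) \<and>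
        rreg s'' 8 = rreg s 8 \<and> rmem s'' = rmem s')"
  shows "hoare (unr (\<lambda>j. Sq (g j) (st d \<rho> j)) d) s (\<lambda>s'. \<forall>\<rho>'. \<forall>j<d.
      cell d s' \<rho>' j = (if \<rho>' = nreg s \<rho> then v j else cell d s \<rho>' j))"
proof -
  define Inv where "Inv j s' \<longleftrightarrow> (\<forall>x. x \<notin> {20, 21} \<longrightarrow> nreg s' x = nreg s x) \<and> rreg s' 8 = rreg s 8 \<and>
    (\<forall>\<rho>'. \<forall>j'<d. cell d s' \<rho>' j' = (if \<rho>' = nreg s \<rho> \<and> j' < j then v j' else cell d s \<rho>' j'))" for j s'
  have "hoare (unr (\<lambda>j. Sq (g j) (st d \<rho> j)) d) s (Inv d)"
  proof (rule hoare_unr)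
    show "Inv 0 s" by (simp add: Inv_def)
    fix j s' assume j: "j < d" and I: "Inv j s'"
    have "hoare (g j) s' (\<lambda>s''::ram_state. rreg s'' 7 = v j \<and> (\<forall>x. x \<notin> {20, 21} \<longrightarrow> nreg s'' x = nreg s x) \<and>
        rreg s'' 8 = rreg s 8 \<and> rmem s'' = rmem s')"
      by (rule g[OF j]) (use I j in \<open>auto simp: Inv_def\<close>)
    then show "hoare (Sq (g j) (st d \<rho> j)) s' (Inv (Suc j))"
      unfolding hoare_Sq
    proof (rule hoare_conseq)
      fix s'' :: ram_state assume s'': "rreg s'' 7 = v j \<and> (\<forall>x. x \<notin> {20, 21} \<longrightarrow> nreg s'' x = nreg s x) \<and>
        rreg s'' 8 = rreg s 8 \<and> rmem s'' = rmem s'"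
      show "hoare (st d \<rho> j) s'' (Inv (Suc j))"
      proof (rule hoare_st[OF \<rho>])
        fix a b
        let ?t = "s''\<lparr>nreg := (nreg s'')(20 := a, 21 := b), rmem := (rmem s'')(nreg s'' \<rho> * d + j := rreg s'' 7)\<rparr>"
        have "cell d ?t \<rho>' j' = (if \<rho>' = nreg s \<rho> \<and> j' < Suc j then v j' else cell d s \<rho>' j')" if "j' < d" for \<rho>' j'
        proof -
          have "cell d s' \<rho>' j' = (if \<rho>' = nreg s \<rho> \<and> j' < j then v j' else cell d s \<rho>' j')"
            using I that by (simp add: Inv_def)
          moreover have "cell d ?t \<rho>' j' = (if \<rho>' = nreg s \<rho> \<and> j' = j then v j else cell d s' \<rho>' j')"
            using s'' \<rho> cell_eq_iff[OF that j] by (auto simp: cell_def)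
          ultimately show ?thesis by (auto simp: less_Suc_eq)
        qed
        then show "Inv (Suc j) ?t" using s'' by (simp add: Inv_def)
      qed
    qed
  qed
  then show ?thesis by (rule hoare_conseq) (auto simp: Inv_def)
qed

lemma hoare_cprow:
  assumes "\<rho> \<notin> {20, 21}" "\<sigma> \<notin> {20, 21}" "nreg s \<sigma> \<noteq> nreg s \<rho>"
  shows "hoare (cprow d \<sigma> \<rho>) s (\<lambda>s'. \<forall>\<rho>'. \<forall>j<d.
      cell d s' \<rho>' j = (if \<rho>' = nreg s \<rho> then cell d s (nreg s \<sigma>) j else cell d s \<rho>' j))"
  unfolding cprow_def
  by (rule hoare_row[OF assms(1)], rule hoare_ld) (use assms in auto)

lemma hoare_zerop:
  "hoare (zerop d) s (\<lambda>s'. \<forall>\<rho>'. \<forall>j<d. cell d s' \<rho>' j = (if \<rho>' = nreg s 29 then 0 else cell d s \<rho>' j))"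
  unfolding zerop_def by (rule hoare_row) auto

lemma hoare_addp:
  assumes "nreg s 28 \<noteq> nreg s 29"
  shows "hoare (addp d) s (\<lambda>s'. \<forall>\<rho>'. \<forall>j<d.
      cell d s' \<rho>' j = (if \<rho>' = nreg s 29 then cell d s (nreg s 29) j + cell d s (nreg s 28) j else cell d s \<rho>' j))"
  unfolding addp_def
  by (rule hoare_row, simp, unfold hoare_Sq, rule hoare_ld, simp, rule hoare_ld) (use assms in \<open>auto simp: cell_def\<close>)

lemma hoare_divp:
  "hoare (divp d) s (\<lambda>s'. \<forall>\<rho>'. \<forall>j<d.
      cell d s' \<rho>' j = (if \<rho>' = nreg s 29 then cell d s (nreg s 29) j / rreg s 8 else cell d s \<rho>' j))"
  unfolding divp_def
  by (rule hoare_row, simp, unfold hoare_Sq, rule hoare_ld) auto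

section \<open>Correctness of sketching and sampling\<close>

definition ro :: "cmd \<Rightarrow> bool" where
  "ro c \<longleftrightarrow> \<not> wm c \<and> \<not> wd c"

lemma ro_simps [simp]:
  "ro Skip" "ro (Ins a) \<longleftrightarrow> \<not> iwm a \<and> \<not> iwd a" "ro (Sq c c') \<longleftrightarrow> ro c \<and> ro c'"
  "ro (Ifc b c c') \<longleftrightarrow> ro c \<and> ro c'" "ro (For i m c) \<longleftrightarrow> ro c"
  by (auto simp: ro_def)

lemma ro_unr: "(\<And>j. ro (f j)) \<Longrightarrow> ro (unr f m)"
  by (induction m) auto

lemma ro_tree: "(\<And>x. ro (leaf x)) \<Longrightarrow> ro (tree leaf l m)"
  by (induction l arbitrary: m) auto

lemma frame_ro: "frame c t t' \<Longrightarrow> ro c \<Longrightarrow> nmem t' = nmem t \<and> rmem t' = rmem t"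
  by (auto simp: frame_def ro_def)

lemma ro_leafp: "ro (leafp d G x)"
  unfolding leafp_def ld_def by (auto intro!: ro_unr)

lemma ro_estp: "ro (estp d G)"
  unfolding estp_def by (auto intro!: ro_tree ro_leafp)

lemma ro_wtp: "ro (wtp d G)"
  unfolding wtp_def by (auto intro: ro_estp)

lemma wm_sump: "\<not> wm (sump d G)"
  using ro_wtp[of d G] by (simp add: sump_def ro_def)

lemma wd_drawp: "\<not> wd drawp"
  by (simp add: drawp_def)

lemma addr_less: "\<rho> < R \<Longrightarrow> j < d \<Longrightarrow> \<rho> * d + j < R * d" for d :: nat
proof -
  assume "\<rho> < R" "j < d"
  then have "\<rho> * d + j < Suc \<rho> * d" by simp
  also have "\<dots> \<le> R * d" using \<open>\<rho> < R\<close> by (intro mult_le_mono1) simp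
  finally show ?thesis .
qed

lemma hoare_leafp:
  "hoare (leafp d G x) t (\<lambda>t'. rreg t' 1 = (\<Sum>j<d. G x j * (cell d t (nreg t 12) j - cell d t (nreg t 18) j)))"
proof -
  define Inv where "Inv j t' \<longleftrightarrow> nreg t' 12 = nreg t 12 \<and> nreg t' 18 = nreg t 18 \<and> rmem t' = rmem t \<and>
    rreg t' 1 = (\<Sum>j'<j. G x j' * (cell d t (nreg t 12) j' - cell d t (nreg t 18) j'))" for j and t' :: ram_state
  have "hoare (leafp d G x) t (Inv d)"
    unfolding leafp_def hoare_Sq hoare_det
  proof (rule hoare_unr)
    show "Inv 0 (t\<lparr>rreg := (rreg t)(1 := 0)\<rparr>)" by (simp add: Inv_def)
    fix j t' assume "j < d" and I: "Inv j t'"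
    show "hoare (Sq (ld d 2 12 j) (Sq (ld d 3 18 j)
       (blk [RArith 2 Minus 2 3, RConst 3 (G x j), RArith 2 Times 3 2, RArith 1 Plus 1 2]))) t' (Inv (Suc j))"
      unfolding hoare_Sq by (rule hoare_ld, simp, rule hoare_ld) (use I in \<open>simp_all add: Inv_def cell_def\<close>)
  qed
  then show ?thesis by (rule hoare_conseq) (simp add: Inv_def)
qed

context clustering
begin

abbreviation G :: "nat \<Rightarrow> nat \<Rightarrow> real" where
  "G \<equiv> sketch_row d B"

text \<open>The first address after the accumulator row: writing prefix sums from here on leaves
  points, centers and accumulator intact.\<close>

abbreviation F :: nat where
  "F \<equiv> (n + 2 * k + 1) * d"

definition envr :: "ram_state \<Rightarrow> bool" where
  "envr t \<longleftrightarrow> nreg t 0 = n \<and> nreg t 1 = k \<and> nreg t 2 = s \<and> nreg t 4 = M \<and> nreg t 6 = n - 1 \<and> nreg t 7 = k - 1 \<and>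
     nreg t 8 = 2 \<and> nreg t 9 = 0 \<and> nreg t 19 = 2 ^ d - 1 \<and> nreg t 22 = F \<and> nreg t 29 = n + 2 * k \<and>
     nreg t 30 = n + k \<and> nreg t 31 = 1"

definition pts :: "ram_state \<Rightarrow> bool" where
  "pts t \<longleftrightarrow> (\<forall>p<n. \<forall>j<d. cell d t p j = X p j)"

definition slots :: "centers \<Rightarrow> ram_state \<Rightarrow> bool" where
  "slots C t \<longleftrightarrow> (\<forall>l<k. \<forall>j<d. cell d t (n + l) j = C l j)"

definition best :: "centers \<Rightarrow> ram_state \<Rightarrow> bool" where
  "best C t \<longleftrightarrow> (\<forall>l<k. \<forall>j<d. cell d t (n + k + l) j = C l j)"

definition sketched :: "nat list \<Rightarrow> ram_state \<Rightarrow> bool" where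
  "sketched xs t \<longleftrightarrow> length xs = s \<and> (\<forall>x\<in>set xs. x < 2 ^ d) \<and> (\<forall>i<s. nmem t i = xs ! i)"

lemma envr_frame:
  assumes "frame c t t'" "keep c N R" "N \<inter> {0, 1, 2, 4, 6, 7, 8, 9, 19, 22, 29, 30, 31} = {}" "envr t"
  shows "envr t'"
proof -
  have "nreg t' x = nreg t x" if "x \<in> {0, 1, 2, 4, 6, 7, 8, 9, 19, 22, 29, 30, 31}" for x
    by (rule frame_nreg[OF assms(1,2)]) (use that assms(3) in blast)
  then show ?thesis using assms(4) by (simp add: envr_def)
qed

lemma below_F:
  assumes "\<And>a. a < F \<Longrightarrow> rmem t' a = rmem t a" "\<rho> < n + 2 * k + 1" "j < d"
  shows "cell d t' \<rho> j = cell d t \<rho> j"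
  unfolding cell_def by (rule assms(1)) (rule addr_less[OF assms(2,3)])

lemma hoare_estp:
  assumes "envr t" "sketched xs t" "\<And>j. j < d \<Longrightarrow> cell d t (nreg t 12) j = u j" "\<And>j. j < d \<Longrightarrow> cell d t (nreg t 18) j = v j"
  shows "hoare (estp d G) t (\<lambda>t'. rreg t' 4 = est xs u v)"
proof -
  let ?t = "t\<lparr>rreg := (rreg t)(4 := 0)\<rparr>"
  let ?c = "Sq (Ins (NLoad 16 10)) (Sq (tree (leafp d G) d 0) (blk [RArith 1 Times 1 1, RArith 4 Plus 4 1]))"
  define Inv where "Inv j t' \<longleftrightarrow> rreg t' 4 = (\<Sum>i<j. (proj (xs ! i) u v)\<^sup>2)" for j :: nat and t' :: ram_state
  have k1: "keep (tree (leafp d G) d 0) {17, 20, 21} {1, 2, 3}"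
    by (rule keep_tree) (auto intro: keep_mono[OF keep_leafp])
  have k2: "keep (For 10 2 ?c) {5, 10, 16, 17, 20, 21} {1, 2, 3, 4}" using keep_mono[OF k1] by auto
  have ro2: "ro (For 10 2 ?c)" by (simp add: ro_tree ro_leafp)
  have "hoare (For 10 2 ?c) ?t (\<lambda>t'. Inv (nreg ?t 2) t')"
  proof (rule hoare_For)
    show "10 \<notin> wn ?c" using keep_notin[OF k1] by simp
    show "Inv 0 (setn 10 0 ?t)" by (simp add: Inv_def)
    fix j t' assume j: "j < nreg ?t 2" and I: "Inv j t'" and fr: "frame (For 10 2 ?c) ?t t'" and t10: "nreg t' 10 = j"
    have js: "j < s" using j assms(1) by (simp add: envr_def)
    have mem: "nmem t' = nmem t" "rmem t' = rmem t" using frame_ro[OF fr ro2] by simp_all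
    have regs: "nreg t' 12 = nreg t 12" "nreg t' 18 = nreg t 18" using frame_nreg[OF fr k2] by simp_all
    define x where "x = xs ! j"
    have x: "nmem t' j = x" "x < 2 ^ d" using assms(2) js by (auto simp: mem sketched_def x_def)
    let ?t' = "t'\<lparr>nreg := (nreg t')(16 := x)\<rparr>"
    have "hoare (tree (leafp d G) d 0) ?t' (\<lambda>t''. rreg t'' 1 = proj x u v)"
    proof (rule hoare_tree)
      fix a
      show "hoare (leafp d G (nreg ?t' 16)) (?t'\<lparr>nreg := (nreg ?t')(17 := a)\<rparr>) (\<lambda>t''. rreg t'' 1 = proj x u v)"
        by (rule hoare_conseq[OF hoare_leafp])
           (use assms(3,4) in \<open>auto simp: proj_def cell_def regs mem intro!: sum.cong\<close>)
    qed (use x in auto)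
    then have "hoare (tree (leafp d G) d 0) ?t' (\<lambda>t''. rreg t'' 1 = proj x u v \<and> rreg t'' 4 = rreg t' 4)"
      by (rule hoare_conseq) (use frame_rreg[OF _ k1, where x = 4] in force)
    then show "hoare ?c t' (\<lambda>t''. Inv (Suc j) (incr 10 t''))"
      unfolding hoare_Sq hoare_det t10 x(1)
      by (rule hoare_conseq) (use I in \<open>simp add: Inv_def x_def power2_eq_square\<close>)
  qed simp
  then show ?thesis
    unfolding estp_def hoare_Sq hoare_det
    by (rule hoare_conseq)
       (use assms(1,2) in \<open>simp add: Inv_def est_def envr_def sketched_def sum_list_sum_nth atLeast0LessThan\<close>)
qed

lemma hoare_wtp:
  assumes "envr t" "sketched xs t" "pts t" "slots C t" "nreg t 12 = p" "p < n"
  shows "hoare (wtp d G) t (\<lambda>t'. rreg t' 5 = wt xs C p)"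
proof -
  let ?e = "\<lambda>l. est xs (X p) (C l)"
  let ?mv = "blk [RConst 7 0, RArith 5 Plus 4 7]"
  let ?c = "Sq (Ins (NArith 18 Plus 0 11)) (Sq (estp d G) (Ifc (NLess 9 11) (Ifc (RLess 4 5) ?mv Skip) ?mv))"
  \<comment> \<open>Before the first pass register 5 is arbitrary, and \<open>Min\<close> of the
    empty set has no meaning.\<close>
  define Inv where "Inv j t' \<longleftrightarrow> (j > 0 \<longrightarrow> rreg t' 5 = Min (?e ` {..<j}))" for j :: nat and t' :: ram_state
  have kp: "keep (For 11 1 ?c) {5, 10, 11, 16, 17, 18, 20, 21} {1, 2, 3, 4, 5, 7}"
    using keep_mono[OF keep_estp] by auto
  have ro2: "ro (For 11 1 ?c)" by (simp add: ro_estp)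
  have "hoare (For 11 1 ?c) t (\<lambda>t'. Inv (nreg t 1) t')"
  proof (rule hoare_For)
    show "11 \<notin> wn ?c" using keep_notin[OF keep_estp] by simp
    show "Inv 0 (setn 11 0 t)" by (simp add: Inv_def)
    fix j t' assume j: "j < nreg t 1" and I: "Inv j t'" and fr: "frame (For 11 1 ?c) t t'" and t11: "nreg t' 11 = j"
    have jk: "j < k" using j assms(1) by (simp add: envr_def)
    have mem: "nmem t' = nmem t" "rmem t' = rmem t" using frame_ro[OF fr ro2] by simp_all
    have env: "envr t'" by (rule envr_frame[OF fr kp _ assms(1)]) simp
    have n0: "nreg t' 0 = n" using env by (simp add: envr_def)
    have p: "nreg t' 12 = p" using frame_nreg[OF fr kp] assms(5) by simp
    let ?t = "t'\<lparr>nreg := (nreg t')(18 := n + j)\<rparr>"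
    have "hoare (estp d G) ?t (\<lambda>t''. rreg t'' 4 = ?e j)"
    proof (rule hoare_estp)
      show "envr ?t" using env by (simp add: envr_def)
      show "sketched xs ?t" using assms(2) mem by (simp add: sketched_def)
      show "cell d ?t (nreg ?t 12) i = X p i" if "i < d" for i
        using assms(3,6) that p mem by (simp add: pts_def cell_def)
      show "cell d ?t (nreg ?t 18) i = C j i" if "i < d" for i
        using assms(4) jk that mem by (simp add: slots_def cell_def)
    qed
    then show "hoare ?c t' (\<lambda>t''. Inv (Suc j) (incr 11 t''))"
      unfolding hoare_Sq hoare_det arith.simps t11 n0
    proof (rule hoare_conseq)
      fix t'' assume e: "rreg t'' 4 = ?e j" and fr': "frame (estp d G) ?t t''"
      have r5: "rreg t'' 5 = rreg t' 5" using frame_rreg[OF fr' keep_estp] by simp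
      have n: "nreg t'' 9 = 0" "nreg t'' 11 = j"
        using frame_nreg[OF fr' keep_estp, of 9] frame_nreg[OF fr' keep_estp, of 11] env t11 by (simp_all add: envr_def)
      have min: "Min (?e ` {..<Suc j}) = (if j = 0 then ?e j else min (?e j) (Min (?e ` {..<j})))"
        by (cases j) (simp_all add: lessThan_Suc)
      show "hoare (Ifc (NLess 9 11) (Ifc (RLess 4 5) ?mv Skip) ?mv) t'' (\<lambda>t''. Inv (Suc j) (incr 11 t''))"
        using I e r5 n unfolding Inv_def min by (auto simp: min_def)
    qed
  qed simp
  then show ?thesis unfolding wtp_def
    by (rule hoare_conseq) (use assms(1) k_pos in \<open>simp add: Inv_def wt_def envr_def\<close>)
qed

lemma hoare_sump:
  assumes "envr t" "sketched xs t" "pts t" "slots C t"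
  shows "hoare (sump d G) t (\<lambda>t'. rreg t' 6 = cum xs C n \<and> (\<forall>p<n. rmem t' (F + p) = cum xs C (Suc p)) \<and>
     (\<forall>a<F. rmem t' a = rmem t a))"
proof -
  let ?c = "Sq (wtp d G) (blk [RArith 6 Plus 6 5, NArith 23 Plus 22 12, RStore 23 6])"
  let ?t = "t\<lparr>rreg := (rreg t)(6 := 0)\<rparr>"
  define Inv where "Inv j t' \<longleftrightarrow> rreg t' 6 = cum xs C j \<and> (\<forall>p<j. rmem t' (F + p) = cum xs C (Suc p)) \<and>
     (\<forall>a<F. rmem t' a = rmem t a)" for j :: nat and t' :: ram_state
  have kp: "keep (For 12 0 ?c) {5, 10, 11, 12, 16, 17, 18, 20, 21, 23} {1, 2, 3, 4, 5, 6, 7}"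
    using keep_mono[OF keep_wtp] by auto
  have wm: "\<not> wm (For 12 0 ?c)" using wm_sump[of d G] by (simp add: sump_def)
  have "hoare (For 12 0 ?c) ?t (\<lambda>t'. Inv (nreg ?t 0) t')"
  proof (rule hoare_For)
    show "12 \<notin> wn ?c" using keep_notin[OF keep_wtp] by simp
    show "Inv 0 (setn 12 0 ?t)" by (simp add: Inv_def cum_def)
    fix j t' assume j: "j < nreg ?t 0" and I: "Inv j t'" and fr: "frame (For 12 0 ?c) ?t t'" and t12: "nreg t' 12 = j"
    have jn: "j < n" using j assms(1) by (simp add: envr_def)
    have nm: "nmem t' = nmem t" using fr wm by (simp add: frame_def)
    have env: "envr t'" by (rule envr_frame[OF fr kp]) (use assms(1) in \<open>simp_all add: envr_def\<close>)
    have cell: "cell d t' \<rho> i = cell d t \<rho> i" if "\<rho> < n + 2 * k + 1" "i < d" for \<rho> i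
      by (rule below_F[OF _ that]) (use I in \<open>simp add: Inv_def\<close>)
    have "hoare (wtp d G) t' (\<lambda>t'. rreg t' 5 = wt xs C j)"
    proof (rule hoare_wtp[OF env _ _ _ t12 jn])
      show "sketched xs t'" using assms(2) nm by (simp add: sketched_def)
      show "pts t'" using assms(3) by (simp add: pts_def cell)
      show "slots C t'" using assms(4) by (simp add: slots_def cell)
    qed
    then show "hoare ?c t' (\<lambda>t''. Inv (Suc j) (incr 12 t''))"
      unfolding hoare_Sq
    proof (rule hoare_conseq)
      fix t'' assume w: "rreg t'' 5 = wt xs C j" and fr': "frame (wtp d G) t' t''"
      have "rreg t'' 6 = rreg t' 6" "nreg t'' 12 = j" "nreg t'' 22 = F"
        using frame_rreg[OF fr' keep_wtp, of 6] frame_nreg[OF fr' keep_wtp, of 12] t12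
          frame_nreg[OF fr' keep_wtp, of 22] env by (simp_all add: envr_def)
      moreover have "rmem t'' = rmem t'" using frame_ro[OF fr' ro_wtp] by simp
      ultimately show "hoare (blk [RArith 6 Plus 6 5, NArith 23 Plus 22 12, RStore 23 6]) t'' (\<lambda>t''. Inv (Suc j) (incr 12 t''))"
        using I w by (auto simp: Inv_def cum_def less_Suc_eq)
    qed
  qed simp
  then show ?thesis unfolding sump_def hoare_Sq hoare_det
    by (rule hoare_conseq) (use assms(1) in \<open>simp add: Inv_def envr_def\<close>)
qed

lemma coup_drawp:
  assumes "envr t"
  shows "coup drawp t sk sketched"
proof -
  let ?c = "Sq (Ins (NRand 16 19)) (Ins (NStore 10 16))"
  define Inv where "Inv j xs t' \<longleftrightarrow> length xs = j \<and> (\<forall>i<j. nmem t' i = xs ! i)" for j and xs :: "nat list" and t' :: ram_state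
  have kp: "keep (For 10 2 ?c) {5, 10, 16} {}" by simp
  have "coup (For 10 2 ?c) t (iterM (nreg t 2) (\<lambda>_ xs. map_pmf (\<lambda>x. xs @ [x]) bits) []) (Inv (nreg t 2))"
  proof (rule coup_For)
    show "Inv 0 [] (setn 10 0 t)" by (simp add: Inv_def)
    fix j xs t' assume I: "Inv j xs t'" and fr: "frame (For 10 2 ?c) t t'" and t10: "nreg t' 10 = j"
    have "nreg t' 19 = 2 ^ d - 1" using frame_nreg[OF fr kp, of 19] assms by (simp add: envr_def)
    then have bits: "bits = pmf_of_set {0..nreg t' 19}" by (simp add: bits_def)
    show "coup ?c t' (map_pmf (\<lambda>x. xs @ [x]) bits) (\<lambda>y t''. Inv (Suc j) y (incr 10 t''))"
      unfolding bits
    proof (rule coup_Sq_hoare[OF coup_NRand])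
      fix x t'' assume "t'' = t'\<lparr>nreg := (nreg t')(16 := x)\<rparr>"
      then show "hoare (Ins (NStore 10 16)) t'' (\<lambda>t''. Inv (Suc j) (xs @ [x]) (incr 10 t''))"
        using I t10 by (auto simp: Inv_def nth_append less_Suc_eq)
    qed
  qed simp_all
  then have "coup drawp t sk (Inv s)"
    using assms by (simp add: drawp_def sk_def reps_def envr_def)
  then show ?thesis
  proof (rule coup_conseq)
    fix xs t' assume xs: "xs \<in> set_pmf sk" and I: "Inv s xs t'"
    have "x < 2 ^ d" if "x \<in> set xs" for x
    proof -
      have "set xs \<subseteq> {0..2 ^ d - 1}" using set_reps[of xs s bits] xs by (simp add: sk_def bits_def)
      then have "x \<le> 2 ^ d - 1" using that by auto
      also have "\<dots> < 2 ^ d" by simp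
      finally show ?thesis .
    qed
    then show "sketched xs t'" using I by (auto simp: sketched_def Inv_def)
  qed
qed

definition passed :: "centers \<Rightarrow> ram_state \<Rightarrow> nat list \<Rightarrow> ram_state \<Rightarrow> bool" where
  "passed C t xs t' \<longleftrightarrow> rreg t' 6 = cum xs C n \<and> (\<forall>p<n. rmem t' (F + p) = cum xs C (Suc p)) \<and>
     (\<forall>a<F. rmem t' a = rmem t a)"

lemma coup_passp:
  assumes "envr t" "pts t" "slots C t"
  shows "coup (passp d G) t sk (passed C t)"
proof -
  have "coup (passp d G) t (map_pmf (\<lambda>xs. xs) sk) (passed C t)"
    unfolding passp_def
  proof (rule coup_Sq_hoare[OF coup_drawp[OF assms(1)]])
    fix xs t' assume xs: "sketched xs t'" and fr: "frame drawp t t'"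
    have kp: "keep drawp {5, 10, 16} {}" by (simp add: drawp_def)
    have rm: "rmem t' = rmem t" using fr wd_drawp by (simp add: frame_def)
    show "hoare (sump d G) t' (passed C t xs)"
    proof (rule hoare_conseq[OF hoare_sump[OF _ xs]])
      show "envr t'" by (rule envr_frame[OF fr kp _ assms(1)]) simp
      show "pts t'" using assms(2) by (simp add: pts_def cell_def rm)
      show "slots C t'" using assms(3) by (simp add: slots_def cell_def rm)
    qed (simp add: passed_def rm)
  qed
  then show ?thesis by simp
qed

lemma hoare_pickp:
  assumes "envr t" "nreg t 25 = r" "rreg t 6 = cum xs C n" "\<And>p. p < n \<Longrightarrow> rmem t (F + p) = cum xs C (Suc p)"
  shows "hoare pickp t (\<lambda>t'. nreg t' 27 = pick xs C r)"
proof -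
  let ?c = "Sq (blk [NArith 23 Plus 22 12, RLoad 9 23, RArith 9 Times 8 9])
       (Ifc (RLess 7 9) Skip (Ins (NArith 27 Plus 27 31)))"
  let ?t = "t\<lparr>nreg := (nreg t)(27 := 0), rreg := (rreg t)(7 := real r * cum xs C n, 8 := real n)\<rparr>"
  define Inv where "Inv j t' \<longleftrightarrow> nreg t' 27 = card {p. p < j \<and> real n * cum xs C (Suc p) \<le> real r * cum xs C n}"
    for j :: nat and t' :: ram_state
  have kp: "keep (For 12 0 ?c) {5, 12, 23, 27} {9}" by simp
  have ro2: "ro (For 12 0 ?c)" by simp
  have "hoare (For 12 0 ?c) ?t (\<lambda>t'. Inv (nreg ?t 0) t')"
  proof (rule hoare_For)
    show "Inv 0 (setn 12 0 ?t)" by (simp add: Inv_def)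
    fix j t' assume j: "j < nreg ?t 0" and I: "Inv j t'" and fr: "frame (For 12 0 ?c) ?t t'" and t12: "nreg t' 12 = j"
    have jn: "j < n" using j assms(1) by (simp add: envr_def)
    have env: "envr t'" by (rule envr_frame[OF fr kp]) (use assms(1) in \<open>simp_all add: envr_def\<close>)
    have mem: "rmem t' (F + j) = cum xs C (Suc j)" using frame_ro[OF fr ro2] assms(4)[OF jn] by simp
    have regs: "rreg t' 7 = real r * cum xs C n" "rreg t' 8 = real n"
      using frame_rreg[OF fr kp, of 7] frame_rreg[OF fr kp, of 8] by simp_all
    let ?P = "\<lambda>p. real n * cum xs C (Suc p) \<le> real r * cum xs C n"
    have "{p. p < Suc j \<and> ?P p} = (if ?P j then insert j {p. p < j \<and> ?P p} else {p. p < j \<and> ?P p})"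
      by (auto simp: less_Suc_eq)
    then have "card {p. p < Suc j \<and> ?P p} = card {p. p < j \<and> ?P p} + (if ?P j then 1 else 0)" by simp
    then show "hoare ?c t' (\<lambda>t''. Inv (Suc j) (incr 12 t''))"
      using I env mem regs t12 by (simp add: Inv_def envr_def not_less)
  qed simp_all
  then have "hoare (For 12 0 ?c) ?t (\<lambda>t'. nreg t' 27 = pick xs C r)"
    by (rule hoare_conseq) (use assms(1) in \<open>simp add: Inv_def pick_def envr_def\<close>)
  moreover have "t\<lparr>nreg := (nreg t)(27 := 0), rreg := (rreg t)(7 := real r, 7 := real r * cum xs C n, 8 := real n)\<rparr> = ?t"
    by simp
  ultimately show ?thesis unfolding pickp_def using assms by (simp add: envr_def)
qed

definition sampled :: "ram_state \<Rightarrow> nat \<Rightarrow> ram_state \<Rightarrow> bool" where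
  "sampled t r t' \<longleftrightarrow> nreg t' 28 = r \<and> (\<forall>a<F. rmem t' a = rmem t a)"

lemma coup_samplep:
  assumes "envr t" "pts t" "slots C t"
  shows "coup (samplep d G) t (sample C) (sampled t)"
  unfolding samplep_def sample_def
proof (rule coup_Sq[OF coup_passp[OF assms]])
  fix xs t1 assume p: "passed C t xs t1" and fr: "frame (passp d G) t t1"
  have env1: "envr t1" by (rule envr_frame[OF fr keep_passp _ assms(1)]) simp
  let ?sel = "Ifc (NLess 9 24) (Ifc (NLess 31 24) (Ins (NArith 28 Plus 0 26)) (Ins (NArith 28 Plus 27 9)))
       (Ins (NArith 28 Plus 25 9))"
  have r8: "{0..2::nat} = {0..nreg t1 8}" using env1 by (simp add: envr_def)
  show "coup (Sq (Ins (NRand 24 8)) (Sq (Ins (NRand 25 6)) (Sq (Ins (NRand 26 7)) (Sq pickp ?sel)))) t1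
     (bind_pmf (pmf_of_set {0..2::nat}) (\<lambda>m. bind_pmf (pmf_of_set {0..n - 1}) (\<lambda>r. map_pmf (\<lambda>l.
       if m = 0 then r else if m = 1 then pick xs C r else n + l) (pmf_of_set {0..k - 1})))) (sampled t)"
    unfolding r8
  proof (rule coup_Sq[OF coup_NRand])
    fix m t2 assume t2: "t2 = t1\<lparr>nreg := (nreg t1)(24 := m)\<rparr>"
    have r6: "{0..n - 1} = {0..nreg t2 6}" using env1 by (simp add: envr_def t2)
    show "coup (Sq (Ins (NRand 25 6)) (Sq (Ins (NRand 26 7)) (Sq pickp ?sel))) t2
     (bind_pmf (pmf_of_set {0..n - 1}) (\<lambda>r. map_pmf (\<lambda>l.
       if m = 0 then r else if m = 1 then pick xs C r else n + l) (pmf_of_set {0..k - 1}))) (sampled t)"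
      unfolding r6
    proof (rule coup_Sq[OF coup_NRand])
      fix r t3 assume t3: "t3 = t2\<lparr>nreg := (nreg t2)(25 := r)\<rparr>"
      have r7: "{0..k - 1} = {0..nreg t3 7}" using env1 by (simp add: envr_def t2 t3)
      show "coup (Sq (Ins (NRand 26 7)) (Sq pickp ?sel)) t3 (map_pmf (\<lambda>l.
        if m = 0 then r else if m = 1 then pick xs C r else n + l) (pmf_of_set {0..k - 1})) (sampled t)"
        unfolding r7
      proof (rule coup_Sq_hoare[OF coup_NRand])
        fix l t4 assume t4: "t4 = t3\<lparr>nreg := (nreg t3)(26 := l)\<rparr>"
        have env4: "envr t4" using env1 by (simp add: envr_def t2 t3 t4)
        have rp: "ro pickp" and kp: "keep pickp {5, 12, 23, 27} {7, 8, 9}" by (simp_all add: pickp_def)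
        have "hoare pickp t4 (\<lambda>t'. nreg t' 27 = pick xs C r)"
          by (rule hoare_pickp[OF env4]) (use p in \<open>simp_all add: passed_def t2 t3 t4\<close>)
        then show "hoare (Sq pickp ?sel) t4 (sampled t (if m = 0 then r else if m = 1 then pick xs C r else n + l))"
          unfolding hoare_Sq
        proof (rule hoare_conseq)
          fix t5 assume pk: "nreg t5 27 = pick xs C r" and fr5: "frame pickp t4 t5"
          have "envr t5" by (rule envr_frame[OF fr5 kp _ env4]) simp
          moreover have "nreg t5 24 = m" "nreg t5 25 = r" "nreg t5 26 = l"
            using frame_nreg[OF fr5 kp, of 24] frame_nreg[OF fr5 kp, of 25] frame_nreg[OF fr5 kp, of 26]
            by (simp_all add: t2 t3 t4)
          moreover have "rmem t5 = rmem t1" using frame_ro[OF fr5 rp] by (simp add: t2 t3 t4)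
          ultimately show "hoare ?sel t5 (sampled t (if m = 0 then r else if m = 1 then pick xs C r else n + l))"
            using pk p by (auto simp: sampled_def passed_def envr_def)
        qed
      qed
    qed
  qed
qed

end

section \<open>Correctness of stages, trials and the search\<close>

context clustering
begin

text \<open>What a trial leaves alone: the points and the best centers found so far.\<close>

definition same :: "ram_state \<Rightarrow> ram_state \<Rightarrow> bool" where
  "same t t' \<longleftrightarrow> (\<forall>\<rho><n + 2 * k. \<rho> < n \<or> n + k \<le> \<rho> \<longrightarrow> (\<forall>j<d. cell d t' \<rho> j = cell d t \<rho> j))"

lemma same_pts: "same t t' \<Longrightarrow> pts t \<Longrightarrow> pts t'"
  by (simp add: same_def pts_def)

lemma same_best: "same t t' \<Longrightarrow> best C t \<Longrightarrow> best C t'"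
  by (simp add: same_def best_def)

lemma same_trans: "same t t' \<Longrightarrow> same t' t'' \<Longrightarrow> same t t''"
  by (simp add: same_def)

text \<open>A sampled row lies below the accumulator \<open>n + 2 * k\<close>, so adding it to the
  accumulator never reads the row being written.\<close>

lemma sample_range: "r \<in> set_pmf (sample C) \<Longrightarrow> r < n + k"
proof -
  have pk: "pick xs C r \<le> n" for xs r
    unfolding pick_def by (rule order_trans[OF card_mono[of "{..<n}"]]) auto
  have pn: "pick xs C r < n + k" for xs r using pk[of xs r] k_pos by linarith
  have "set_pmf (sample C) \<subseteq> {..<n + k}"
    unfolding sample_def set_bind_pmf set_map_pmf
  proof (intro UN_least image_subsetI)
    fix xs and m r l :: nat
    assume "r \<in> set_pmf (pmf_of_set {0..n - 1})" "l \<in> set_pmf (pmf_of_set {0..k - 1})"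
    then have "r \<le> n - 1" "l \<le> k - 1" by simp_all
    then have "r < n + k" "n + l < n + k" using n_pos k_pos by linarith+
    then show "(if m = 0 then r else if m = 1 then pick xs C r else n + l) \<in> {..<n + k}"
      using pn by simp
  qed
  then show "r \<in> set_pmf (sample C) \<Longrightarrow> r < n + k" by auto
qed

lemma row_cell:
  assumes "pts t" "slots C t" "r < n + k" "j < d"
  shows "row C r j = cell d t r j"
proof (cases "r < n")
  case True
  then show ?thesis using assms by (simp add: row_def pts_def)
next
  case False
  then have "r - n < k" using assms(3) by linarith
  then have "cell d t (n + (r - n)) j = C (r - n) j" using assms(2,4) unfolding slots_def by blast
  then show ?thesis using False by (simp add: row_def)
qed

definition summed :: "centers \<Rightarrow> ram_state \<Rightarrow> nat list \<Rightarrow> ram_state \<Rightarrow> bool" where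
  "summed C t rs t' \<longleftrightarrow> (\<forall>j<d. cell d t' (n + 2 * k) j = sum_list (map (\<lambda>r. row C r j) rs)) \<and>
     (\<forall>\<rho><n + 2 * k. \<forall>j<d. cell d t' \<rho> j = cell d t \<rho> j)"

lemma coup_sum_samples:
  assumes "envr t" "pts t" "slots C t"
  shows "coup (Sq (zerop d) (For 14 4 (Sq (samplep d G) (addp d)))) t (reps M (sample C)) (summed C t)"
proof (rule coup_hoare_Sq[OF hoare_zerop])
  let ?c = "Sq (samplep d G) (addp d)"
  fix t0 assume z: "\<forall>\<rho>'. \<forall>j<d. cell d t0 \<rho>' j = (if \<rho>' = nreg t 29 then 0 else cell d t \<rho>' j)"
    and fr0: "frame (zerop d) t t0"
  have env0: "envr t0" by (rule envr_frame[OF fr0 keep_rows(1) _ assms(1)]) simp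
  have kp: "keep (For 14 4 ?c) (insert 14 NS) RS"
    using keep_mono[OF keep_samplep] keep_mono[OF keep_rows(2)] by auto
  have "coup (For 14 4 ?c) t0 (iterM (nreg t0 4) (\<lambda>_ rs. map_pmf (\<lambda>r. rs @ [r]) (sample C)) []) (\<lambda>rs t'. summed C t rs t')"
  proof (rule coup_For[where Inv = "\<lambda>_. summed C t"])
    show "14 \<notin> wn ?c" using keep_notin[OF keep_samplep] keep_notin[OF keep_rows(2)] by simp
    show "summed C t [] (setn 14 0 t0)"
      using z assms(1) by (simp add: summed_def envr_def cell_def)
    fix j rs t' assume I: "summed C t rs t'" and fr: "frame (For 14 4 ?c) t0 t'"
    have env: "envr t'" by (rule envr_frame[OF fr kp _ env0]) simp
    have pts: "pts t'" using I assms(2) by (simp add: pts_def summed_def)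
    have slots: "slots C t'" using I assms(3) by (simp add: slots_def summed_def)
    show "coup ?c t' (map_pmf (\<lambda>r. rs @ [r]) (sample C)) (\<lambda>y t''. summed C t y (incr 14 t''))"
    proof (rule coup_Sq_hoare[OF coup_samplep[OF env pts slots]])
      fix r t1 assume r: "r \<in> set_pmf (sample C)" and sm: "sampled t' r t1" and fr1: "frame (samplep d G) t' t1"
      have env1: "envr t1" by (rule envr_frame[OF fr1 keep_samplep _ env]) simp
      have cell1: "cell d t1 \<rho> i = cell d t' \<rho> i" if "\<rho> < n + 2 * k + 1" "i < d" for \<rho> i
        by (rule below_F[OF _ that]) (use sm in \<open>simp add: sampled_def\<close>)
      have rk: "r < n + k" by (rule sample_range[OF r])
      have regs: "nreg t1 28 = r" "nreg t1 29 = n + 2 * k" using sm env1 by (simp_all add: sampled_def envr_def)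
      show "hoare (addp d) t1 (\<lambda>t''. summed C t (rs @ [r]) (incr 14 t''))"
      proof (rule hoare_conseq[OF hoare_addp])
        show "nreg t1 28 \<noteq> nreg t1 29" using regs rk by simp
        fix t2 assume a: "\<forall>\<rho>'. \<forall>j<d. cell d t2 \<rho>' j = (if \<rho>' = nreg t1 29
          then cell d t1 (nreg t1 29) j + cell d t1 (nreg t1 28) j else cell d t1 \<rho>' j)"
        have "cell d t1 r j = row C r j" if "j < d" for j
          using row_cell[OF pts slots rk that] cell1[of r j] rk that by simp
        moreover have "cell d (incr 14 t2) \<rho> j = cell d t2 \<rho> j" for \<rho> j by (simp add: cell_def)
        ultimately show "summed C t (rs @ [r]) (incr 14 t2)"
          using a I cell1 regs by (simp add: summed_def)
      qed
    qed
  qed simp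
  then show "coup (For 14 4 ?c) t0 (reps M (sample C)) (summed C t)"
    using env0 by (simp add: reps_def envr_def)
qed

lemma hoare_fill:
  assumes "envr t" "nreg t 13 = a"
  shows "hoare (For 11 1 (Ifc (NLess 11 13) Skip (Sq (Ins (NArith 18 Plus 0 11)) (cprow d 29 18)))) t
    (\<lambda>t'. \<forall>\<rho>. \<forall>j<d. cell d t' \<rho> j = (if n + a \<le> \<rho> \<and> \<rho> < n + k then cell d t (n + 2 * k) j else cell d t \<rho> j))"
proof -
  let ?c = "Ifc (NLess 11 13) Skip (Sq (Ins (NArith 18 Plus 0 11)) (cprow d 29 18))"
  define Inv where "Inv l t' \<longleftrightarrow> (\<forall>\<rho>. \<forall>j<d. cell d t' \<rho> j =
     (if n + a \<le> \<rho> \<and> \<rho> < n + l then cell d t (n + 2 * k) j else cell d t \<rho> j))" for l and t' :: ram_state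
  have kp: "keep (For 11 1 ?c) {5, 11, 18, 20, 21} {7}"
    using keep_mono[OF keep_rows(4)] by auto
  have "hoare (For 11 1 ?c) t (\<lambda>t'. Inv (nreg t 1) t')"
  proof (rule hoare_For)
    show "11 \<notin> wn ?c" using keep_notin[OF keep_rows(4)] by simp
    show "Inv 0 (setn 11 0 t)" by (simp add: Inv_def cell_def)
    fix l t' assume l: "l < nreg t 1" and I: "Inv l t'" and fr: "frame (For 11 1 ?c) t t'" and t11: "nreg t' 11 = l"
    have lk: "l < k" using l assms(1) by (simp add: envr_def)
    have env: "envr t'" by (rule envr_frame[OF fr kp _ assms(1)]) simp
    have t13: "nreg t' 13 = a" using frame_nreg[OF fr kp] assms(2) by simp
    have cell_incr: "cell d (incr 11 u) \<rho> j = cell d u \<rho> j" for u \<rho> j by (simp add: cell_def)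
    show "hoare ?c t' (\<lambda>t''. Inv (Suc l) (incr 11 t''))"
    proof (cases "l < a")
      case True
      then show ?thesis using I t11 t13 by (auto simp: Inv_def cell_incr less_Suc_eq)
    next
      case False
      let ?t = "t'\<lparr>nreg := (nreg t')(18 := n + l)\<rparr>"
      have n0: "nreg t' 0 = n" and t29: "nreg ?t 29 = n + 2 * k" using env by (simp_all add: envr_def)
      have cell_t: "cell d ?t \<rho> j = cell d t' \<rho> j" for \<rho> j by (simp add: cell_def)
      have "hoare (cprow d 29 18) ?t (\<lambda>t''. Inv (Suc l) (incr 11 t''))"
      proof (rule hoare_conseq[OF hoare_cprow])
        show "nreg ?t 29 \<noteq> nreg ?t 18" using lk t29 by simp
        fix t'' assume "\<forall>\<rho>'. \<forall>j<d. cell d t'' \<rho>' j = (if \<rho>' = nreg ?t 18 then cell d ?t (nreg ?t 29) j else cell d ?t \<rho>' j)"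
        then have c: "cell d t'' \<rho> j = (if \<rho> = n + l then cell d t' (n + 2 * k) j else cell d t' \<rho> j)" if "j < d" for \<rho> j
          using that unfolding t29 cell_t by simp
        have acc: "cell d t' (n + 2 * k) j = cell d t (n + 2 * k) j" if "j < d" for j
          using I that lk by (simp add: Inv_def)
        show "Inv (Suc l) (incr 11 t'')"
          unfolding Inv_def cell_incr
        proof (intro allI impI)
          fix \<rho> j assume j: "j < d"
          show "cell d t'' \<rho> j = (if n + a \<le> \<rho> \<and> \<rho> < n + Suc l then cell d t (n + 2 * k) j else cell d t \<rho> j)"
            using c[OF j, of \<rho>] acc[OF j] I j False by (auto simp: Inv_def)
        qed
      qed simp_all
      then show ?thesis using False t11 t13 n0 by simp
    qed
  qed simp
  then show ?thesis
    by (rule hoare_conseq) (use assms(1) in \<open>simp add: Inv_def envr_def\<close>)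
qed

definition staged :: "ram_state \<Rightarrow> centers \<Rightarrow> ram_state \<Rightarrow> bool" where
  "staged t C t' \<longleftrightarrow> slots C t' \<and> same t t'"

lemma coup_stagep:
  assumes "envr t" "pts t" "slots C t" "nreg t 13 = a"
  shows "coup (stagep d G) t (stage a C) (staged t)"
  unfolding stagep_def stage_def
proof (rule coup_Sq_hoare[OF coup_sum_samples[OF assms(1-3)]])
  let ?p = "Sq (zerop d) (For 14 4 (Sq (samplep d G) (addp d)))"
  let ?fill = "For 11 1 (Ifc (NLess 11 13) Skip (Sq (Ins (NArith 18 Plus 0 11)) (cprow d 29 18)))"
  fix rs t1 assume sm: "summed C t rs t1" and fr: "frame ?p t t1"
  have kp: "keep ?p (insert 14 NS) RS"
    using keep_mono[OF keep_samplep] keep_mono[OF keep_rows(2)] keep_mono[OF keep_rows(1)] by auto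
  have env1: "envr t1" by (rule envr_frame[OF fr kp _ assms(1)]) simp
  have t13: "nreg t1 13 = a" using frame_nreg[OF fr kp] assms(4) by simp
  let ?t1 = "t1\<lparr>rreg := (rreg t1)(8 := real M)\<rparr>"
  have M: "nreg t1 4 = M" using env1 by (simp add: envr_def)
  show "hoare (Sq (Ins (ROfNat 8 4)) (Sq (divp d) ?fill)) t1 (staged t (\<lambda>l. if l < a then C l else mean C rs))"
    unfolding hoare_Sq hoare_det M
  proof (rule hoare_conseq[OF hoare_divp])
    fix t2 assume d: "\<forall>\<rho>'. \<forall>j<d. cell d t2 \<rho>' j = (if \<rho>' = nreg ?t1 29 then cell d ?t1 (nreg ?t1 29) j / rreg ?t1 8 else cell d ?t1 \<rho>' j)"
      and fr2: "frame (divp d) ?t1 t2"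
    have env2: "envr t2" by (rule envr_frame[OF fr2 keep_rows(3)]) (use env1 in \<open>simp_all add: envr_def\<close>)
    have t13': "nreg t2 13 = a" using frame_nreg[OF fr2 keep_rows(3)] t13 by simp
    have acc: "cell d t2 (n + 2 * k) j = mean C rs j" if "j < d" for j
      using d that sm env1 by (simp add: summed_def mean_def envr_def cell_def)
    have other: "cell d t2 \<rho> j = cell d t \<rho> j" if "\<rho> < n + 2 * k" "j < d" for \<rho> j
      using d that sm env1 by (simp add: summed_def envr_def cell_def)
    show "hoare ?fill t2 (staged t (\<lambda>l. if l < a then C l else mean C rs))"
    proof (rule hoare_conseq[OF hoare_fill[OF env2 t13']])
      fix t3 assume f: "\<forall>\<rho>. \<forall>j<d. cell d t3 \<rho> j = (if n + a \<le> \<rho> \<and> \<rho> < n + k then cell d t2 (n + 2 * k) j else cell d t2 \<rho> j)"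
      have "slots (\<lambda>l. if l < a then C l else mean C rs) t3"
        using f acc other assms(3) by (simp add: slots_def)
      moreover have "same t t3"
        using f other by (auto simp: same_def)
      ultimately show "staged t (\<lambda>l. if l < a then C l else mean C rs) t3" by (simp add: staged_def)
    qed
  qed
qed

lemma coup_trialp:
  assumes "envr t" "pts t" "slots C t"
  shows "coup (trialp d G) t (trial C) (staged t)"
proof -
  have "coup (For 13 1 (stagep d G)) t (iterM (nreg t 1) stage C) (\<lambda>C t'. staged t C t')"
  proof (rule coup_For[where Inv = "\<lambda>_. staged t"])
    show "13 \<notin> wn (stagep d G)" using keep_notin[OF keep_stagep] by simp
    show "staged t C (setn 13 0 t)" using assms(3) by (simp add: staged_def slots_def same_def cell_def)
    fix j x t' assume I: "staged t x t'" and fr: "frame (For 13 1 (stagep d G)) t t'" and t13: "nreg t' 13 = j"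
    have env: "envr t'" by (rule envr_frame[OF fr keep_trialp[unfolded trialp_def] _ assms(1)]) simp
    have pts: "pts t'" using I same_pts assms(2) by (auto simp: staged_def)
    have slots: "slots x t'" using I by (simp add: staged_def)
    show "coup (stagep d G) t' (stage j x) (\<lambda>y t''. staged t y (incr 13 t''))"
    proof (rule coup_conseq[OF coup_stagep[OF env pts slots t13]])
      fix y t'' assume "staged t' y t''"
      then have "slots y t''" "same t t''" using I same_trans by (auto simp: staged_def)
      then show "staged t y (incr 13 t'')" by (simp add: staged_def slots_def same_def cell_def)
    qed
  qed simp
  then show ?thesis using assms(1) by (simp add: trialp_def trial_def envr_def)
qed

text \<open>Source and target blocks are disjoint, so the rows still to be copied are the original
  ones.\<close>

lemma hoare_copy:
  assumes "envr t"
  shows "hoare (For 11 1 (Sq (blk [NArith 18 Plus 0 11, NArith 23 Plus 30 11]) (cprow d 18 23))) t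
    (\<lambda>t'. \<forall>\<rho>. \<forall>j<d. cell d t' \<rho> j = (if n + k \<le> \<rho> \<and> \<rho> < n + k + k then cell d t (\<rho> - k) j else cell d t \<rho> j))"
proof -
  let ?c = "Sq (blk [NArith 18 Plus 0 11, NArith 23 Plus 30 11]) (cprow d 18 23)"
  define Inv where "Inv l t' \<longleftrightarrow> (\<forall>\<rho>. \<forall>j<d. cell d t' \<rho> j =
     (if n + k \<le> \<rho> \<and> \<rho> < n + k + l then cell d t (\<rho> - k) j else cell d t \<rho> j))" for l and t' :: ram_state
  have kp: "keep (For 11 1 ?c) {5, 11, 18, 20, 21, 23} {7}"
    using keep_mono[OF keep_rows(4)] by auto
  have "hoare (For 11 1 ?c) t (\<lambda>t'. Inv (nreg t 1) t')"
  proof (rule hoare_For)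
    show "11 \<notin> wn ?c" using keep_notin[OF keep_rows(4)] by simp
    show "Inv 0 (setn 11 0 t)" by (simp add: Inv_def cell_def)
    fix l t' assume l: "l < nreg t 1" and I: "Inv l t'" and fr: "frame (For 11 1 ?c) t t'" and t11: "nreg t' 11 = l"
    have lk: "l < k" using l assms(1) by (simp add: envr_def)
    have env: "envr t'" by (rule envr_frame[OF fr kp _ assms(1)]) simp
    have cell_incr: "cell d (incr 11 u) \<rho> j = cell d u \<rho> j" for u \<rho> j by (simp add: cell_def)
    let ?t = "t'\<lparr>nreg := (nreg t')(18 := n + l, 23 := n + k + l)\<rparr>"
    have cell_t: "cell d ?t \<rho> j = cell d t' \<rho> j" for \<rho> j by (simp add: cell_def)
    have "hoare (cprow d 18 23) ?t (\<lambda>t''. Inv (Suc l) (incr 11 t''))"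
    proof (rule hoare_conseq[OF hoare_cprow])
      show "nreg ?t 18 \<noteq> nreg ?t 23" using k_pos by simp
      fix t'' assume "\<forall>\<rho>'. \<forall>j<d. cell d t'' \<rho>' j = (if \<rho>' = nreg ?t 23 then cell d ?t (nreg ?t 18) j else cell d ?t \<rho>' j)"
      then have c: "cell d t'' \<rho> j = (if \<rho> = n + k + l then cell d t' (n + l) j else cell d t' \<rho> j)" if "j < d" for \<rho> j
        using that unfolding cell_t by simp
      have src: "cell d t' (n + l) j = cell d t (n + l) j" if "j < d" for j
        using I that lk by (simp add: Inv_def)
      show "Inv (Suc l) (incr 11 t'')"
        unfolding Inv_def cell_incr
      proof (intro allI impI)
        fix \<rho> j assume j: "j < d"
        show "cell d t'' \<rho> j = (if n + k \<le> \<rho> \<and> \<rho> < n + k + Suc l then cell d t (\<rho> - k) j else cell d t \<rho> j)"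
        proof (cases "\<rho> = n + k + l")
          case True
          then show ?thesis using c[OF j, of \<rho>] src[OF j] by simp
        next
          case False
          then show ?thesis using c[OF j, of \<rho>] I j by (auto simp: Inv_def)
        qed
      qed
    qed simp_all
    then show "hoare ?c t' (\<lambda>t''. Inv (Suc l) (incr 11 t''))" using t11 env by (simp add: envr_def)
  qed simp
  then show ?thesis
    by (rule hoare_conseq) (use assms in \<open>simp add: Inv_def envr_def\<close>)
qed

definition searching :: "centers \<times> centers \<times> real \<Rightarrow> ram_state \<Rightarrow> bool" where
  "searching x t \<longleftrightarrow> envr t \<and> pts t \<and> slots (fst x) t \<and> best (fst (snd x)) t \<and> rreg t 10 = snd (snd x)"

lemma passed_cells:
  assumes "passed C t xs t'" "\<rho> < n + 2 * k + 1" "j < d"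
  shows "cell d t' \<rho> j = cell d t \<rho> j"
  by (rule below_F[OF _ assms(2,3)]) (use assms(1) in \<open>simp add: passed_def\<close>)

lemma coup_roundp:
  assumes "searching x t"
  shows "coup (roundp d G) t (round x) searching"
  unfolding roundp_def round_def
proof (rule coup_Sq)
  have *: "envr t" "pts t" "slots (fst x) t" "best (fst (snd x)) t" "rreg t 10 = snd (snd x)"
    using assms by (simp_all add: searching_def)
  show "coup (trialp d G) t (trial (fst x)) (staged t)" by (rule coup_trialp) (use * in simp_all)
  let ?cp = "For 11 1 (Sq (blk [NArith 18 Plus 0 11, NArith 23 Plus 30 11]) (cprow d 18 23))"
  let ?if = "Ifc (RLess 6 10) (Sq (blk [RConst 7 0, RArith 10 Plus 6 7]) ?cp) Skip"
  fix C t1 assume st: "staged t C t1" and fr1: "frame (trialp d G) t t1"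
  have env1: "envr t1" by (rule envr_frame[OF fr1 keep_trialp _ *(1)]) simp
  have pts1: "pts t1" and best1: "best (fst (snd x)) t1" and slots1: "slots C t1"
    using st * same_pts same_best by (auto simp: staged_def)
  have v1: "rreg t1 10 = snd (snd x)" using frame_rreg[OF fr1 keep_trialp] * by simp
  have "coup (Sq (passp d G) ?if) t1 (map_pmf (\<lambda>xs. if cum xs C n < snd (snd x) then (C, C, cum xs C n) else (C, snd x)) sk) searching"
  proof (rule coup_Sq_hoare[OF coup_passp[OF env1 pts1 slots1]])
    fix xs t2 assume p: "passed C t1 xs t2" and fr2: "frame (passp d G) t1 t2"
    note cell2 = passed_cells[OF p]
    have env2: "envr t2" by (rule envr_frame[OF fr2 keep_passp _ env1]) simp
    have v2: "rreg t2 10 = snd (snd x)" using frame_rreg[OF fr2 keep_passp] v1 by simp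
    have tot: "rreg t2 6 = cum xs C n" using p by (simp add: passed_def)
    have pts2: "pts t2" using pts1 cell2 by (simp add: pts_def)
    have slots2: "slots C t2" using slots1 cell2 by (simp add: slots_def)
    have best2: "best (fst (snd x)) t2" using best1 cell2 by (simp add: best_def)
    show "hoare ?if t2 (searching (if cum xs C n < snd (snd x) then (C, C, cum xs C n) else (C, snd x)))"
    proof (cases "cum xs C n < snd (snd x)")
      case False
      then show ?thesis using env2 v2 tot pts2 slots2 best2 by (simp add: searching_def)
    next
      case True
      let ?t = "t2\<lparr>rreg := (rreg t2)(7 := 0, 10 := cum xs C n)\<rparr>"
      have kcp: "keep ?cp {5, 11, 18, 20, 21, 23} {7}" using keep_mono[OF keep_rows(4)] by auto
      have envt: "envr ?t" using env2 by (simp add: envr_def)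
      have "hoare ?cp ?t (searching (C, C, cum xs C n))"
      proof (rule hoare_conseq[OF hoare_copy[OF envt]])
        fix t3 assume c: "\<forall>\<rho>. \<forall>j<d. cell d t3 \<rho> j = (if n + k \<le> \<rho> \<and> \<rho> < n + k + k then cell d ?t (\<rho> - k) j else cell d ?t \<rho> j)"
          and fr3: "frame ?cp ?t t3"
        have t: "cell d ?t \<rho> j = cell d t2 \<rho> j" for \<rho> j by (simp add: cell_def)
        have "envr t3" by (rule envr_frame[OF fr3 kcp _ envt]) simp
        moreover have "rreg t3 10 = cum xs C n" using frame_rreg[OF fr3 kcp] by simp
        moreover have "pts t3" using pts2 c t by (simp add: pts_def)
        moreover have "slots C t3" using slots2 c t by (simp add: slots_def)
        moreover have "best C t3" using slots2 c t by (simp add: best_def slots_def)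
        ultimately show "searching (C, C, cum xs C n) t3" by (simp add: searching_def)
      qed
      then show ?thesis using True v2 tot by simp
    qed
  qed
  then show "coup (Sq (passp d G) ?if) t1 (map_pmf (\<lambda>v. if v < snd (snd x) then (C, C, v) else (C, snd x)) (total C)) searching"
    by (simp add: total_def pmf.map_comp o_def)
qed

lemma coup_searchp:
  assumes "envr t" "pts t" "slots C t" "best C t" "nreg t 3 = T"
  shows "coup (searchp d G) t (search T C) searching"
  unfolding searchp_def search_def
proof (rule coup_Sq)
  let ?p = "Sq (passp d G) (blk [RConst 7 0, RArith 10 Plus 6 7])"
  show "coup ?p t (total C) (\<lambda>v. searching (C, C, v))"
    unfolding total_def
  proof (rule coup_Sq_hoare[OF coup_passp[OF assms(1-3)]])
    fix xs t2 assume p: "passed C t xs t2" and fr2: "frame (passp d G) t t2"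
    note cell2 = passed_cells[OF p]
    have env2: "envr t2" by (rule envr_frame[OF fr2 keep_passp _ assms(1)]) simp
    have "rreg t2 6 = cum xs C n" using p by (simp add: passed_def)
    moreover have "pts t2" using assms(2) cell2 by (simp add: pts_def)
    moreover have "slots C t2" using assms(3) cell2 by (simp add: slots_def)
    moreover have "best C t2" using assms(4) cell2 by (simp add: best_def)
    ultimately show "hoare (blk [RConst 7 0, RArith 10 Plus 6 7]) t2 (searching (C, C, cum xs C n))"
      using env2 by (simp add: searching_def envr_def pts_def slots_def best_def cell_def)
  qed
  fix v t1 assume s: "searching (C, C, v) t1" and fr: "frame ?p t t1"
  have kp: "keep ?p NP (insert 10 RP)" using keep_mono[OF keep_passp] by auto
  have T: "nreg t1 3 = T" using frame_nreg[OF fr kp] assms(5) by simp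
  have "coup (For 15 3 (roundp d G)) t1 (iterM (nreg t1 3) (\<lambda>_. round) (C, C, v)) (\<lambda>x t'. searching x t')"
  proof (rule coup_For[where Inv = "\<lambda>_. searching"])
    show "15 \<notin> wn (roundp d G)" using keep_notin[OF keep_roundp] by simp
    show "searching (C, C, v) (setn 15 0 t1)"
      using s by (simp add: searching_def envr_def pts_def slots_def best_def cell_def)
    fix j x t' assume x: "searching x t'"
    show "coup (roundp d G) t' (round x) (\<lambda>y t''. searching y (incr 15 t''))"
      by (rule coup_conseq[OF coup_roundp[OF x]])
         (simp add: searching_def envr_def pts_def slots_def best_def cell_def)
  qed simp
  then show "coup (For 15 3 (roundp d G)) t1 (iterM T (\<lambda>_. round) (C, C, v)) searching"
    by (simp add: T)
qed

end

section \<open>Output\<close>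

text \<open>The machine compares reals only by \<open><\<close>. Coordinatewise equality is
  therefore tested through a sum of squares, which is positive exactly if the rows differ.\<close>

definition distp :: "nat \<Rightarrow> cmd" where
  "distp d = Sq (Ins (RConst 1 0)) (unr (\<lambda>j. Sq (ld d 2 11 j) (Sq (ld d 3 13 j)
     (blk [RArith 2 Minus 2 3, RArith 2 Times 2 2, RArith 1 Plus 1 2]))) d)"

text \<open>Register 24 flags a duplicate. Register 4, started at 1 by \<open>dupp\<close>, collects
  the squares of the first coordinates of the earlier rows; as y < 1 + y^2, it ends above each of
  these coordinates.\<close>

definition checkp :: "nat \<Rightarrow> cmd" where
  "checkp d = Sq (distp d) (Sq (Ins (RConst 2 0)) (Sq (Ifc (RLess 2 1) Skip (Ins (NConst 24 1)))
     (Sq (ld d 3 11 0) (blk [RArith 3 Times 3 3, RArith 4 Plus 4 3]))))"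

definition dupp :: "nat \<Rightarrow> cmd" where
  "dupp d = Sq (blk [NConst 24 0, RConst 4 1]) (For 11 1 (Ifc (NLess 11 13) (checkp d) Skip))"

text \<open>A center that repeats an earlier one gets a first coordinate larger than those of all earlier
  centers.\<close>

definition outp :: "nat \<Rightarrow> cmd" where
  "outp d = For 13 1 (Sq (Ins (NArith 23 Plus 30 13)) (Sq (cprow d 23 13) (Sq (dupp d)
     (Ifc (NLess 9 24) (Sq (blk [RConst 3 0, RArith 7 Plus 4 3]) (st d 13 0)) Skip))))"

lemma keep_distp: "keep (distp d) {20, 21} {1, 2, 3}" and ro_distp: "ro (distp d)"
  unfolding distp_def by (auto intro!: keep_unr ro_unr intro: keep_mono[OF keep_ld] simp: ld_def)

lemma keep_checkp: "keep (checkp d) {20, 21, 24} {1, 2, 3, 4}" and ro_checkp: "ro (checkp d)"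
  unfolding checkp_def using ro_distp by (auto intro: keep_mono[OF keep_distp] simp: ld_def)

lemma keep_dupp: "keep (dupp d) {5, 11, 20, 21, 24} {1, 2, 3, 4}" and ro_dupp: "ro (dupp d)"
  unfolding dupp_def using ro_checkp by (auto intro: keep_mono[OF keep_checkp])

lemma hoare_distp:
  "hoare (distp d) t (\<lambda>t'. rreg t' 1 = (\<Sum>j<d. (cell d t (nreg t 11) j - cell d t (nreg t 13) j)\<^sup>2))"
proof -
  define Inv where "Inv j t' \<longleftrightarrow> nreg t' 11 = nreg t 11 \<and> nreg t' 13 = nreg t 13 \<and> rmem t' = rmem t \<and>
    rreg t' 1 = (\<Sum>j'<j. (cell d t (nreg t 11) j' - cell d t (nreg t 13) j')\<^sup>2)" for j and t' :: ram_state
  have "hoare (distp d) t (Inv d)"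
    unfolding distp_def hoare_Sq hoare_det
  proof (rule hoare_unr)
    show "Inv 0 (t\<lparr>rreg := (rreg t)(1 := 0)\<rparr>)" by (simp add: Inv_def)
    fix j t' assume "j < d" and I: "Inv j t'"
    show "hoare (Sq (ld d 2 11 j) (Sq (ld d 3 13 j)
       (blk [RArith 2 Minus 2 3, RArith 2 Times 2 2, RArith 1 Plus 1 2]))) t' (Inv (Suc j))"
      unfolding hoare_Sq by (rule hoare_ld, simp, rule hoare_ld)
        (use I in \<open>simp_all add: Inv_def cell_def power2_eq_square\<close>)
  qed
  then show ?thesis by (rule hoare_conseq) (simp add: Inv_def)
qed

definition agree :: "nat \<Rightarrow> ram_state \<Rightarrow> nat \<Rightarrow> nat \<Rightarrow> bool" where
  "agree d t a i \<longleftrightarrow> (\<forall>j<d. cell d t a j = cell d t i j)"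

lemma agree_iff: "agree d t a i \<longleftrightarrow> \<not> 0 < (\<Sum>j<d. (cell d t a j - cell d t i j)\<^sup>2)"
proof -
  have "(\<Sum>j<d. (cell d t a j - cell d t i j)\<^sup>2) = 0 \<longleftrightarrow> agree d t a i"
    unfolding agree_def by (subst sum_nonneg_eq_0_iff) auto
  moreover have "0 \<le> (\<Sum>j<d. (cell d t a j - cell d t i j)\<^sup>2)" by (simp add: sum_nonneg)
  ultimately show ?thesis by linarith
qed

lemma hoare_checkp:
  "hoare (checkp d) t (\<lambda>t'. nreg t' 24 = (if agree d t (nreg t 11) (nreg t 13) then 1 else nreg t 24) \<and>
     rreg t' 4 = rreg t 4 + (cell d t (nreg t 11) 0)\<^sup>2)"
  unfolding checkp_def hoare_Sq
proof (rule hoare_conseq[OF hoare_distp])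
  fix t1 assume d: "rreg t1 1 = (\<Sum>j<d. (cell d t (nreg t 11) j - cell d t (nreg t 13) j)\<^sup>2)" and fr: "frame (distp d) t t1"
  have regs: "nreg t1 11 = nreg t 11" "nreg t1 24 = nreg t 24" "rreg t1 4 = rreg t 4" "rmem t1 = rmem t"
    using frame_nreg[OF fr keep_distp, of 11] frame_nreg[OF fr keep_distp, of 24] frame_rreg[OF fr keep_distp, of 4]
      frame_ro[OF fr ro_distp] by simp_all
  have a: "agree d t (nreg t 11) (nreg t 13) \<longleftrightarrow> \<not> 0 < rreg t1 1" unfolding agree_iff d ..
  let ?Q = "\<lambda>t'. nreg t' 24 = (if agree d t (nreg t 11) (nreg t 13) then 1 else nreg t 24) \<and>
     rreg t' 4 = rreg t 4 + (cell d t (nreg t 11) 0)\<^sup>2"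
  define R where "R u \<longleftrightarrow> hoare (ld d 3 11 0) u (\<lambda>u'. hoare (blk [RArith 3 Times 3 3, RArith 4 Plus 4 3]) u' ?Q)" for u
  have rest: "R u"
    if "nreg u 11 = nreg t 11" "nreg u 24 = (if agree d t (nreg t 11) (nreg t 13) then 1 else nreg t 24)"
      "rreg u 4 = rreg t 4" "rmem u = rmem t" for u
    unfolding R_def by (rule hoare_ld) (use that in \<open>simp_all add: cell_def power2_eq_square\<close>)
  show "hoare (Ins (RConst 2 0)) t1 (\<lambda>t2. hoare (Ifc (RLess 2 1) Skip (Ins (NConst 24 1))) t2
      (\<lambda>t3. hoare (ld d 3 11 0) t3 (\<lambda>t4. hoare (blk [RArith 3 Times 3 3, RArith 4 Plus 4 3]) t4 ?Q)))"
    unfolding R_def[symmetric] using regs a by (auto intro!: rest)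
qed

context clustering
begin

lemma hoare_dupp:
  assumes "envr t" "nreg t 13 = i" "i < k"
  shows "hoare (dupp d) t (\<lambda>t'. (nreg t' 24 = 0 \<longleftrightarrow> (\<forall>a<i. \<not> agree d t a i)) \<and> (\<forall>a<i. cell d t a 0 < rreg t' 4))"
proof -
  let ?c = "Ifc (NLess 11 13) (checkp d) Skip"
  let ?t = "t\<lparr>nreg := (nreg t)(24 := 0), rreg := (rreg t)(4 := 1)\<rparr>"
  \<comment> \<open>The loop runs over all \<open>k\<close> rows but acts on the earlier ones only,
    hence both bounds on \<open>a\<close>.\<close>
  define Inv where "Inv l t' \<longleftrightarrow> (nreg t' 24 = 0 \<longleftrightarrow> (\<forall>a<i. a < l \<longrightarrow> \<not> agree d t a i)) \<and>
     rreg t' 4 = 1 + (\<Sum>a\<in>{a. a < i \<and> a < l}. (cell d t a 0)\<^sup>2)" for l and t' :: ram_state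
  have kp: "keep (For 11 1 ?c) {5, 11, 20, 21, 24} {1, 2, 3, 4}" using keep_mono[OF keep_checkp] by auto
  have ro2: "ro (For 11 1 ?c)" by (simp add: ro_checkp)
  have "hoare (For 11 1 ?c) ?t (\<lambda>t'. Inv (nreg ?t 1) t')"
  proof (rule hoare_For)
    show "11 \<notin> wn ?c" using keep_notin[OF keep_checkp] by simp
    show "Inv 0 (setn 11 0 ?t)" by (simp add: Inv_def)
    fix l t' assume I: "Inv l t'" and fr: "frame (For 11 1 ?c) ?t t'" and t11: "nreg t' 11 = l"
    have t13: "nreg t' 13 = i" using frame_nreg[OF fr kp] assms(2) by simp
    have mem: "cell d t' \<rho> j = cell d t \<rho> j" for \<rho> j using frame_ro[OF fr ro2] by (simp add: cell_def)
    have ag: "agree d t' a b = agree d t a b" for a b by (simp add: agree_def mem)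
    show "hoare ?c t' (\<lambda>t''. Inv (Suc l) (incr 11 t''))"
    proof (cases "l < i")
      case False
      then have "{a. a < i \<and> a < Suc l} = {a. a < i \<and> a < l}" by auto
      then show ?thesis using False I t11 t13 by (auto simp: Inv_def less_Suc_eq)
    next
      case True
      then have "{a. a < i \<and> a < Suc l} = insert l {a. a < i \<and> a < l}" by auto
      then have sum: "(\<Sum>a\<in>{a. a < i \<and> a < Suc l}. (cell d t a 0)\<^sup>2) = (cell d t l 0)\<^sup>2 + (\<Sum>a\<in>{a. a < i \<and> a < l}. (cell d t a 0)\<^sup>2)"
        by simp
      have "hoare (checkp d) t' (\<lambda>t''. Inv (Suc l) (incr 11 t''))"
      proof (rule hoare_conseq[OF hoare_checkp])
        fix t'' :: ram_state assume c: "nreg t'' 24 = (if agree d t' (nreg t' 11) (nreg t' 13) then 1 else nreg t' 24) \<and>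
           rreg t'' 4 = rreg t' 4 + (cell d t' (nreg t' 11) 0)\<^sup>2"
        have "nreg t'' 24 = 0 \<longleftrightarrow> \<not> agree d t l i \<and> (\<forall>a<i. a < l \<longrightarrow> \<not> agree d t a i)"
          using c I unfolding t11 t13 ag mem Inv_def by simp
        also have "\<dots> \<longleftrightarrow> (\<forall>a<i. a < Suc l \<longrightarrow> \<not> agree d t a i)"
          using True by (auto simp: less_Suc_eq)
        finally show "Inv (Suc l) (incr 11 t'')"
          using c I sum unfolding t11 t13 ag mem Inv_def by simp
      qed
      then show ?thesis using True t11 t13 by simp
    qed
  qed simp
  then have "hoare (For 11 1 ?c) ?t (\<lambda>t'. (nreg t' 24 = 0 \<longleftrightarrow> (\<forall>a<i. \<not> agree d t a i)) \<and> (\<forall>a<i. cell d t a 0 < rreg t' 4))"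
  proof (rule hoare_conseq)
    fix t' assume I: "Inv (nreg ?t 1) t'"
    have k: "nreg ?t 1 = k" using assms(1) by (simp add: envr_def)
    have "(a < i \<and> a < k) = (a < i)" for a using assms(3) by auto
    then have I': "(nreg t' 24 = 0 \<longleftrightarrow> (\<forall>a<i. \<not> agree d t a i))" "rreg t' 4 = 1 + (\<Sum>a<i. (cell d t a 0)\<^sup>2)"
      using I unfolding k Inv_def lessThan_def by auto
    have "cell d t a 0 < rreg t' 4" if "a < i" for a
    proof -
      have "(cell d t a 0)\<^sup>2 \<le> (\<Sum>a<i. (cell d t a 0)\<^sup>2)"
        by (rule member_le_sum) (use that in auto)
      moreover have "cell d t a 0 < 1 + (cell d t a 0)\<^sup>2"
      proof -
        have "0 < (cell d t a 0 - 1/2)\<^sup>2 + 3/4" by (rule add_nonneg_pos) auto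
        then show ?thesis by (simp add: power2_eq_square algebra_simps)
      qed
      ultimately show ?thesis using I' by simp
    qed
    with I' show "(nreg t' 24 = 0 \<longleftrightarrow> (\<forall>a<i. \<not> agree d t a i)) \<and> (\<forall>a<i. cell d t a 0 < rreg t' 4)" by blast
  qed
  then show ?thesis by (simp add: dupp_def)
qed

text \<open>A further center cannot raise a minimum, so it suffices that every center of
  \<open>C\<close> occurs among the rows.\<close>

definition output_ok :: "centers \<Rightarrow> ram_state \<Rightarrow> bool" where
  "output_ok C t \<longleftrightarrow> (\<forall>i<k. \<forall>a<i. \<not> agree d t a i) \<and> (\<forall>i<k. \<exists>l<k. \<forall>j<d. cell d t l j = C i j)"

text \<open>The output overwrites the rows below \<open>k\<close>, possibly points and current
  centers, whereas the best centers lie from row \<open>n + k\<close> on. A changed duplicate is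
  harmless, as its earlier copy still represents the center; \<open>l \<le> b\<close> in the
  invariant keeps that copy among the finished rows.\<close>

lemma hoare_outp:
  assumes "envr t" "best C t" "d \<ge> 1"
  shows "hoare (outp d) t (output_ok C)"
proof -
  let ?body = "Sq (Ins (NArith 23 Plus 30 13)) (Sq (cprow d 23 13) (Sq (dupp d)
     (Ifc (NLess 9 24) (Sq (blk [RConst 3 0, RArith 7 Plus 4 3]) (st d 13 0)) Skip)))"
  let ?N = "{5, 11, 13, 20, 21, 23, 24}"
  let ?R = "{1, 2, 3, 4, 7}"
  define Inv where "Inv i t' \<longleftrightarrow> (\<forall>b<i. \<forall>a<b. \<not> agree d t' a b) \<and> (\<forall>b<i. \<exists>l\<le>b. \<forall>j<d. cell d t' l j = C b j) \<and>
    (\<forall>\<rho>\<ge>k. \<forall>j<d. cell d t' \<rho> j = cell d t \<rho> j)" for i and t' :: ram_state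
  have kp: "keep (For 13 1 ?body) ?N ?R"
    using keep_mono[OF keep_rows(4)] keep_mono[OF keep_dupp] keep_mono[OF keep_st] by auto
  have "hoare (For 13 1 ?body) t (\<lambda>t'. Inv (nreg t 1) t')"
  proof (rule hoare_For)
    show "13 \<notin> wn ?body" using keep_notin[OF keep_rows(4)] keep_notin[OF keep_dupp] keep_notin[OF keep_st] by simp
    show "Inv 0 (setn 13 0 t)" by (simp add: Inv_def cell_def)
    fix i t' assume i: "i < nreg t 1" and I: "Inv i t'" and fr: "frame (For 13 1 ?body) t t'" and t13: "nreg t' 13 = i"
    have ik: "i < k" using i assms(1) by (simp add: envr_def)
    have env: "envr t'" by (rule envr_frame[OF fr kp _ assms(1)]) simp
    let ?t = "t'\<lparr>nreg := (nreg t')(23 := n + k + i)\<rparr>"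
    have t30: "nreg t' 30 = n + k" using env by (simp add: envr_def)
    show "hoare ?body t' (\<lambda>t''. Inv (Suc i) (incr 13 t''))"
      unfolding hoare_Sq hoare_det arith.simps t13 t30
    proof (rule hoare_conseq[OF hoare_cprow])
      show "nreg ?t 23 \<noteq> nreg ?t 13" using ik t13 by simp
      fix t1 assume "\<forall>\<rho>'. \<forall>j<d. cell d t1 \<rho>' j = (if \<rho>' = nreg ?t 13 then cell d ?t (nreg ?t 23) j else cell d ?t \<rho>' j)"
        and fr1: "frame (cprow d 23 13) ?t t1"
      then have c1: "cell d t1 \<rho> j = (if \<rho> = i then cell d t' (n + k + i) j else cell d t' \<rho> j)" if "j < d" for \<rho> j
        using that t13 by (simp add: cell_def)
      have Ci: "cell d t1 i j = C i j" if "j < d" for j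
        using c1[OF that, of i] I that ik assms(2) by (simp add: Inv_def best_def)
      have env1: "envr t1" by (rule envr_frame[OF fr1 keep_rows(4)]) (use env in \<open>simp_all add: envr_def\<close>)
      have t13': "nreg t1 13 = i" using frame_nreg[OF fr1 keep_rows(4), of 13] t13 by simp
      have ag1: "agree d t1 a b = agree d t' a b" if "a < i" "b < i" for a b
        unfolding agree_def using c1 that by simp
      have I1: "\<forall>b<i. \<forall>a<b. \<not> agree d t1 a b" "\<forall>b<i. \<exists>l<i. l \<le> b \<and> (\<forall>j<d. cell d t1 l j = C b j)"
        "\<forall>\<rho>\<ge>k. \<forall>j<d. cell d t1 \<rho> j = cell d t \<rho> j"
      proof -
        show "\<forall>b<i. \<forall>a<b. \<not> agree d t1 a b" using I ag1 by (auto simp: Inv_def)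
        show "\<forall>b<i. \<exists>l<i. l \<le> b \<and> (\<forall>j<d. cell d t1 l j = C b j)"
        proof (intro allI impI)
          fix b assume b: "b < i"
          then obtain l where l: "l \<le> b" "\<forall>j<d. cell d t' l j = C b j" using I unfolding Inv_def by blast
          then have "l < i" "\<forall>j<d. cell d t1 l j = C b j" using b c1 by simp_all
          with l(1) show "\<exists>l<i. l \<le> b \<and> (\<forall>j<d. cell d t1 l j = C b j)" by blast
        qed
        show "\<forall>\<rho>\<ge>k. \<forall>j<d. cell d t1 \<rho> j = cell d t \<rho> j" using I c1 ik by (simp add: Inv_def)
      qed
      show "hoare (dupp d) t1 (\<lambda>t2. hoare (Ifc (NLess 9 24) (Sq (blk [RConst 3 0, RArith 7 Plus 4 3]) (st d 13 0)) Skip) t2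
         (\<lambda>t''. Inv (Suc i) (incr 13 t'')))"
      proof (rule hoare_conseq[OF hoare_dupp[OF env1 t13' ik]])
        fix t2 assume dup: "(nreg t2 24 = 0 \<longleftrightarrow> (\<forall>a<i. \<not> agree d t1 a i)) \<and> (\<forall>a<i. cell d t1 a 0 < rreg t2 4)"
          and fr2: "frame (dupp d) t1 t2"
        have mem: "rmem t2 = rmem t1" using frame_ro[OF fr2 ro_dupp] by simp
        have "envr t2" by (rule envr_frame[OF fr2 keep_dupp _ env1]) simp
        then have t9: "nreg t2 9 = 0" by (simp add: envr_def)
        have t13'': "nreg t2 13 = i" using frame_nreg[OF fr2 keep_dupp] t13' by simp
        have cell_incr: "cell d (incr 13 u) \<rho> j = cell d u \<rho> j" for u \<rho> j by (simp add: cell_def)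
        have step: "Inv (Suc i) (incr 13 u)"
          if u: "\<And>\<rho> j. \<rho> \<noteq> i \<Longrightarrow> j < d \<Longrightarrow> cell d u \<rho> j = cell d t1 \<rho> j" and new: "\<And>a. a < i \<Longrightarrow> \<not> agree d u a i"
            and cov: "\<exists>l\<le>i. \<forall>j<d. cell d u l j = C i j" for u
        proof -
          have ag: "agree d u a b = agree d t1 a b" if "a < i" "b < i" for a b
            unfolding agree_def using u that by simp
          have "\<not> agree d u a b" if "b < Suc i" "a < b" for a b
            using new I1(1) ag that by (cases "b = i") auto
          moreover have "\<exists>l\<le>b. \<forall>j<d. cell d u l j = C b j" if "b < Suc i" for b
          proof (cases "b = i")
            case False
            then have "b < i" using that by simp
            then obtain l where "l < i" "l \<le> b" "\<forall>j<d. cell d t1 l j = C b j" using I1(2) by blast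
            then show ?thesis using u by (intro exI[of _ l]) auto
          qed (use cov in simp)
          moreover have "\<forall>\<rho>\<ge>k. \<forall>j<d. cell d u \<rho> j = cell d t \<rho> j" using I1(3) u ik by simp
          ultimately show ?thesis unfolding Inv_def agree_def cell_incr by blast
        qed
        show "hoare (Ifc (NLess 9 24) (Sq (blk [RConst 3 0, RArith 7 Plus 4 3]) (st d 13 0)) Skip) t2
         (\<lambda>t''. Inv (Suc i) (incr 13 t''))"
        proof (cases "nreg t2 24 = 0")
          case True
          have "Inv (Suc i) (incr 13 t2)"
          proof (rule step)
            show c: "cell d t2 \<rho> j = cell d t1 \<rho> j" for \<rho> j by (simp add: cell_def mem)
            show "\<not> agree d t2 a i" if "a < i" for a
              using dup True that unfolding agree_def c by blast
            show "\<exists>l\<le>i. \<forall>j<d. cell d t2 l j = C i j" unfolding c using Ci by blast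
          qed
          then show ?thesis using True t9 by simp
        next
          case False
          then have "\<not> (\<forall>a<i. \<not> agree d t1 a i)" using dup by simp
          then obtain a where a: "a < i" "agree d t1 a i" by blast
          let ?u = "t2\<lparr>rreg := (rreg t2)(3 := 0, 7 := rreg t2 4)\<rparr>"
          have "hoare (st d 13 0) ?u (\<lambda>t''. Inv (Suc i) (incr 13 t''))"
          proof (rule hoare_st)
            fix x y
            let ?v = "?u\<lparr>nreg := (nreg ?u)(20 := x, 21 := y), rmem := (rmem ?u)(nreg ?u 13 * d + 0 := rreg ?u 7)\<rparr>"
            have v: "cell d ?v \<rho> j = (if \<rho> = i \<and> j = 0 then rreg t2 4 else cell d t1 \<rho> j)" if "j < d" for \<rho> j
              using cell_eq_iff[OF that, of 0 \<rho> i] assms(3) t13'' mem by (auto simp: cell_def)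
            show "Inv (Suc i) (incr 13 ?v)"
            proof (rule step)
              show "cell d ?v \<rho> j = cell d t1 \<rho> j" if "\<rho> \<noteq> i" "j < d" for \<rho> j using v that by simp
              show "\<not> agree d ?v b i" if "b < i" for b
              proof
                assume "agree d ?v b i"
                then have "cell d ?v b 0 = cell d ?v i 0" using assms(3) by (simp add: agree_def)
                then have "cell d t1 b 0 = rreg t2 4" using v[of 0] that assms(3) by simp
                then show False using dup that by force
              qed
              \<comment> \<open>The earlier copy \<open>a\<close> stands in for the altered row
                \<open>i\<close>.\<close>
              show "\<exists>l\<le>i. \<forall>j<d. cell d ?v l j = C i j"
                using a v Ci by (intro exI[of _ a]) (auto simp: agree_def)
            qed
          qed simp
          then show ?thesis using False t9 by simp
        qed
      qed
    qed simp_all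
  qed simp
  then show ?thesis unfolding outp_def
  proof (rule hoare_conseq)
    fix t' assume "Inv (nreg t 1) t'"
    then have "Inv k t'" using assms(1) by (simp add: envr_def)
    then show "output_ok C t'" unfolding Inv_def output_ok_def by (meson le_less_trans)
  qed
qed

end

section \<open>Running time\<close>

lemma tm_unr: "(\<And>j. tm \<nu> (f j) \<le> a) \<Longrightarrow> tm \<nu> (unr f m) \<le> m * (a + 1)"
proof (induction m)
  case (Suc m)
  then have "tm \<nu> (unr f m) \<le> m * (a + 1)" "tm \<nu> (f m) \<le> a" by blast+
  then show ?case by simp
qed simp

lemma tm_tree: "(\<And>x. tm \<nu> (leaf x) \<le> a) \<Longrightarrow> tm \<nu> (tree leaf l m) \<le> 3 * l + a"
proof (induction l arbitrary: m)
  case (Suc l)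
  then have "max (tm \<nu> (tree leaf l m)) (tm \<nu> (tree leaf l (m + 2 ^ l))) \<le> 3 * l + a" by simp
  then show ?case by simp
qed simp

text \<open>With \<open>Q\<close> at least 1, additive overheads are absorbed into the constant
  \<open>a\<close>, so that sequential composition only adds constants.\<close>

definition tb :: "(nat \<Rightarrow> nat) \<Rightarrow> cmd \<Rightarrow> nat \<Rightarrow> nat \<Rightarrow> bool" where
  "tb \<nu> c a Q \<longleftrightarrow> Q \<ge> 1 \<and> tm \<nu> c \<le> a * Q"

lemma tb_const: "Q \<ge> 1 \<Longrightarrow> tm \<nu> c \<le> a \<Longrightarrow> tb \<nu> c a Q"
  unfolding tb_def by (metis le_trans mult_le_mono2 mult.right_neutral)

lemma tb_mono: "tb \<nu> c a Q \<Longrightarrow> a \<le> a' \<Longrightarrow> Q \<le> Q' \<Longrightarrow> tb \<nu> c a' Q'"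
  unfolding tb_def by (meson le_trans mult_le_mono)

lemma tb_Sq: "tb \<nu> c a Q \<Longrightarrow> tb \<nu> c' a' Q \<Longrightarrow> tb \<nu> (Sq c c') (a + a' + 1) Q"
  by (auto simp: tb_def algebra_simps)

lemma tb_If: "tb \<nu> c a Q \<Longrightarrow> tb \<nu> c' a' Q \<Longrightarrow> tb \<nu> (Ifc b c c') (a + a' + 1) Q"
  by (auto simp: tb_def algebra_simps)

text \<open>The 9 consists of 6 steps per pass and 3 per loop, the latter absorbed because
  \<open>\<nu> m * Q\<close> is at least 1.\<close>

lemma tb_For: "tb \<nu> c a Q \<Longrightarrow> \<nu> m \<ge> 1 \<Longrightarrow> tb \<nu> (For i m c) (a + 9) (\<nu> m * Q)"
proof -
  assume c: "tb \<nu> c a Q" and m: "\<nu> m \<ge> 1"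
  then have Q: "Q \<ge> 1" "tm \<nu> c \<le> a * Q" by (simp_all add: tb_def)
  then have pos: "\<nu> m * Q \<ge> 1" using m by simp
  have "\<nu> m * (tm \<nu> c + 6) \<le> \<nu> m * (a * Q + 6 * Q)" using Q by (intro mult_le_mono2 add_mono) auto
  also have "\<dots> = (a + 6) * (\<nu> m * Q)" by (simp add: algebra_simps)
  finally have "\<nu> m * (tm \<nu> c + 6) + 3 \<le> (a + 6) * (\<nu> m * Q) + 3 * (\<nu> m * Q)" using pos by linarith
  then show ?thesis using pos by (simp add: tb_def algebra_simps)
qed

lemma tb_unr: "(\<And>j. tm \<nu> (f j) \<le> a) \<Longrightarrow> d \<ge> 1 \<Longrightarrow> tb \<nu> (unr f d) (a + 1) d"
  using tm_unr[of \<nu> f a d] by (simp add: tb_def mult.commute)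

lemma tm_ld: "tm \<nu> (ld d r \<rho> j) = 10" and tm_st: "tm \<nu> (st d \<rho> j) = 10"
  by (simp_all add: ld_def st_def)

lemma tm_leafp: "tm \<nu> (leafp d G x) \<le> 31 * d + 2"
proof -
  let ?f = "\<lambda>j. Sq (ld d 2 12 j) (Sq (ld d 3 18 j) (blk [RArith 2 Minus 2 3, RConst 3 (G x j), RArith 2 Times 3 2, RArith 1 Plus 1 2]))"
  have "tm \<nu> (unr ?f d) \<le> d * (30 + 1)" by (rule tm_unr) (simp add: tm_ld)
  then show ?thesis by (simp add: leafp_def)
qed

lemma tb_tree: "d \<ge> 1 \<Longrightarrow> tb \<nu> (tree (leafp d G) d 0) 36 d"
  using tm_tree[of \<nu> "leafp d G" "31 * d + 2" d 0] tm_leafp[of \<nu> d G] by (simp add: tb_def)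

lemma tb_rows:
  assumes "d \<ge> 1"
  shows "tb \<nu> (zerop d) 40 d" "tb \<nu> (addp d) 40 d" "tb \<nu> (divp d) 40 d" "tb \<nu> (cprow d \<sigma> \<rho>) 40 d"
  unfolding zerop_def addp_def divp_def cprow_def
  by (rule tb_mono[OF tb_unr[where a = 39]], simp add: tm_ld tm_st, use assms in simp_all)+

lemma tb_passp:
  assumes "d \<ge> 1" "\<nu> 0 \<ge> 1" "\<nu> 1 \<ge> 1" "\<nu> 2 \<ge> 1"
  shows "tb \<nu> (passp d G) 200 (\<nu> 0 * (\<nu> 1 * (\<nu> 2 * d)))"
proof -
  note [simp] = assms[unfolded One_nat_def]
  have est: "tb \<nu> (estp d G) 60 (\<nu> 2 * d)"
    unfolding estp_def
    by (rule tb_mono[OF tb_Sq[OF tb_const[where a = 1] tb_For[OF tb_Sq[OF tb_const[where a = 1] tb_Sq[OF tb_tree tb_const[where a = 4]]]]]]) simp_all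
  have wt: "tb \<nu> (wtp d G) 100 (\<nu> 1 * (\<nu> 2 * d))"
    unfolding wtp_def
    by (rule tb_mono[OF tb_For[OF tb_Sq[OF tb_const[where a = 1] tb_Sq[OF est tb_const[where a = 6]]]]]) simp_all
  have sum: "tb \<nu> (sump d G) 130 (\<nu> 0 * (\<nu> 1 * (\<nu> 2 * d)))"
    unfolding sump_def
    by (rule tb_mono[OF tb_Sq[OF tb_const[where a = 1] tb_For[OF tb_Sq[OF wt tb_const[where a = 6]]]]]) simp_all
  have draw: "tb \<nu> drawp 20 (\<nu> 2 * 1)"
    unfolding drawp_def by (rule tb_mono[OF tb_For[OF tb_const[where a = 3 and Q = 1]]]) simp_all
  have draw': "tb \<nu> drawp 20 (\<nu> 0 * (\<nu> 1 * (\<nu> 2 * d)))"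
  proof (rule tb_mono[OF draw])
    have "\<nu> 2 * 1 \<le> \<nu> 2 * d" by (rule mult_le_mono2) simp
    also have "\<dots> \<le> \<nu> 1 * (\<nu> 2 * d)" by simp
    also have "\<dots> \<le> \<nu> 0 * (\<nu> 1 * (\<nu> 2 * d))" by simp
    finally show "\<nu> 2 * 1 \<le> \<nu> 0 * (\<nu> 1 * (\<nu> 2 * d))" .
  qed simp
  show ?thesis unfolding passp_def by (rule tb_mono[OF tb_Sq[OF draw' sum]]) simp_all
qed

lemma tb_searchp:
  assumes "d \<ge> 1" "\<nu> 0 \<ge> 1" "\<nu> 1 \<ge> 1" "\<nu> 2 \<ge> 1" "\<nu> 3 \<ge> 1" "\<nu> 4 \<ge> 1"
  shows "tb \<nu> (searchp d G) 2000 (\<nu> 3 * (\<nu> 1 * (\<nu> 4 * (\<nu> 0 * (\<nu> 1 * (\<nu> 2 * d))))))"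
proof -
  note [simp] = assms[unfolded One_nat_def]
  \<comment> \<open>The cost of one pass over points, centers and sketch rows, which dominates
    everything else done for a single sample.\<close>
  define P where "P = \<nu> 0 * (\<nu> 1 * (\<nu> 2 * d))"
  have pass: "tb \<nu> (passp d G) 200 P" unfolding P_def by (rule tb_passp) simp_all
  have P: "P \<ge> 1" using pass by (simp add: tb_def)
  then have [simp]: "Suc 0 \<le> P" by simp
  have dP: "d \<le> P" "\<nu> 0 * 1 \<le> P" "\<nu> 1 * d \<le> P"
  proof -
    have "d \<le> \<nu> 2 * d" by simp
    then have "\<nu> 1 * d \<le> \<nu> 1 * (\<nu> 2 * d)" by (rule mult_le_mono2)
    also have "\<dots> \<le> P" by (simp add: P_def)
    finally show kd: "\<nu> 1 * d \<le> P" .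
    have "d \<le> \<nu> 1 * d" by simp
    then show "d \<le> P" using kd by linarith
    have "1 \<le> \<nu> 1 * (\<nu> 2 * d)" by simp
    then show "\<nu> 0 * 1 \<le> P" unfolding P_def by (rule mult_le_mono2)
  qed
  note rows = tb_rows[OF assms(1), THEN tb_mono, OF order_refl]
  have pick0: "tb \<nu> pickp 50 (\<nu> 0 * 1)"
    unfolding pickp_def by (rule tb_mono[OF tb_Sq[OF tb_const[where a = 8] tb_For[OF tb_const[where a = 12 and Q = 1]]]]) simp_all
  have pick: "tb \<nu> pickp 50 P" by (rule tb_mono[OF pick0 _ dP(2)]) simp
  have sample: "tb \<nu> (samplep d G) 280 P"
    unfolding samplep_def
    by (rule tb_mono[OF tb_Sq[OF pass tb_Sq[OF tb_const[where a = 1] tb_Sq[OF tb_const[where a = 1]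
        tb_Sq[OF tb_const[where a = 1] tb_Sq[OF pick tb_const[where a = 3]]]]]]]) (simp_all add: P)
  have zero: "tb \<nu> (zerop d) 40 P" and add: "tb \<nu> (addp d) 40 P" and "div": "tb \<nu> (divp d) 40 P"
    by (rule tb_mono[OF tb_rows(1)] tb_mono[OF tb_rows(2)] tb_mono[OF tb_rows(3)], simp_all add: dP)+
  have fill0: "tb \<nu> (For 11 1 (Ifc (NLess 11 13) Skip (Sq (Ins (NArith 18 Plus 0 11)) (cprow d 29 18)))) 60 (\<nu> 1 * d)"
    by (rule tb_mono[OF tb_For[OF tb_If[OF tb_const[where a = 0] tb_Sq[OF tb_const[where a = 1] tb_rows(4)]]]]) simp_all
  have fill: "tb \<nu> (For 11 1 (Ifc (NLess 11 13) Skip (Sq (Ins (NArith 18 Plus 0 11)) (cprow d 29 18)))) 60 P"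
    by (rule tb_mono[OF fill0 _ dP(3)]) simp
  have MP: "P \<le> \<nu> 4 * P" by simp
  have MP1: "1 \<le> \<nu> 4 * P" using P MP by linarith
  have stage: "tb \<nu> (stagep d G) 600 (\<nu> 4 * P)"
    unfolding stagep_def
    by (rule tb_mono[OF tb_Sq[OF tb_Sq[OF tb_mono[OF zero order_refl MP] tb_For[OF tb_Sq[OF sample add]]]
        tb_Sq[OF tb_const[where a = 1] tb_Sq[OF tb_mono[OF "div" order_refl MP] tb_mono[OF fill order_refl MP]]]]])
      (simp_all add: MP1)
  have trial: "tb \<nu> (trialp d G) 700 (\<nu> 1 * (\<nu> 4 * P))"
    unfolding trialp_def by (rule tb_mono[OF tb_For[OF stage]]) simp_all
  have "\<nu> 4 * P \<le> \<nu> 1 * (\<nu> 4 * P)" by simp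
  then have KP: "P \<le> \<nu> 1 * (\<nu> 4 * P)" using MP by linarith
  have KP1: "1 \<le> \<nu> 1 * (\<nu> 4 * P)" using P KP by linarith
  have copy0: "tb \<nu> (For 11 1 (Sq (blk [NArith 18 Plus 0 11, NArith 23 Plus 30 11]) (cprow d 18 23))) 60 (\<nu> 1 * d)"
    by (rule tb_mono[OF tb_For[OF tb_Sq[OF tb_const[where a = 4] tb_rows(4)]]]) simp_all
  have copy: "tb \<nu> (For 11 1 (Sq (blk [NArith 18 Plus 0 11, NArith 23 Plus 30 11]) (cprow d 18 23))) 60 (\<nu> 1 * (\<nu> 4 * P))"
    by (rule tb_mono[OF copy0 _ order_trans[OF dP(3) KP]]) simp
  have round: "tb \<nu> (roundp d G) 1100 (\<nu> 1 * (\<nu> 4 * P))"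
    unfolding roundp_def
    by (rule tb_mono[OF tb_Sq[OF trial tb_Sq[OF tb_mono[OF pass order_refl KP] tb_If[OF tb_Sq[OF tb_const[where a = 4] copy] tb_const[where a = 0]]]]])
      (simp_all add: KP1)
  have TP: "\<nu> 1 * (\<nu> 4 * P) \<le> \<nu> 3 * (\<nu> 1 * (\<nu> 4 * P))" by simp
  have "P \<le> \<nu> 3 * (\<nu> 1 * (\<nu> 4 * P))" using TP KP by linarith
  then show ?thesis
    unfolding searchp_def P_def[symmetric]
    by (intro tb_mono[OF tb_Sq[OF tb_Sq[OF tb_mono[OF pass order_refl] tb_const[where a = 4]] tb_For[OF round]]])
      (use P in simp_all)
qed

lemma tb_outp:
  assumes "d \<ge> 1" "\<nu> 1 \<ge> 1"
  shows "tb \<nu> (outp d) 400 (\<nu> 1 * (\<nu> 1 * d))"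
proof -
  note [simp] = assms[unfolded One_nat_def]
  have dist: "tb \<nu> (distp d) 40 d"
    unfolding distp_def by (rule tb_mono[OF tb_Sq[OF tb_const[where a = 1] tb_unr[where a = 28]]]) (simp_all add: tm_ld)
  have check: "tb \<nu> (checkp d) 80 d"
    unfolding checkp_def by (rule tb_mono[OF tb_Sq[OF dist tb_const[where a = 25]]]) (simp_all add: tm_ld)
  have dup: "tb \<nu> (dupp d) 120 (\<nu> 1 * d)"
    unfolding dupp_def by (rule tb_mono[OF tb_Sq[OF tb_const[where a = 4] tb_For[OF tb_If[OF check tb_const[where a = 0]]]]]) simp_all
  have cp: "tb \<nu> (cprow d 23 13) 40 (\<nu> 1 * d)" by (rule tb_mono[OF tb_rows(4)]) simp_all
  show ?thesis unfolding outp_def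
    by (rule tb_mono[OF tb_For[OF tb_Sq[OF tb_const[where a = 1] tb_Sq[OF cp tb_Sq[OF dup tb_const[where a = 16]]]]]]) (simp_all add: tm_st)
qed

section \<open>Factorization of positive definite forms\<close>

text \<open>Completing the square in the last variable. The remaining form is the Schur complement,
  again positive definite; the result is a Cholesky-type factor.\<close>

lemma pos_def_form_squares:
  fixes a :: "nat \<Rightarrow> nat \<Rightarrow> real"
  assumes "\<And>i j. i < m \<Longrightarrow> j < m \<Longrightarrow> a i j = a j i"
    and "\<And>x. \<exists>i<m. x i \<noteq> 0 \<Longrightarrow> 0 < (\<Sum>i<m. \<Sum>j<m. a i j * x i * x j)"
  shows "\<exists>b. \<forall>x. (\<Sum>i<m. \<Sum>j<m. a i j * x i * x j) = (\<Sum>q<m. (\<Sum>j<m. b q j * x j)\<^sup>2)"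
  using assms
proof (induction m arbitrary: a)
  case (Suc m)
  define \<alpha> where "\<alpha> = a m m"
  \<comment> \<open>The last unit vector yields the diagonal entry.\<close>
  have "0 < (\<Sum>i<Suc m. \<Sum>j<Suc m. a i j * of_bool (i = m) * of_bool (j = m))"
    by (rule Suc.prems(2)) auto
  then have \<alpha>: "\<alpha> > 0" by (simp add: \<alpha>_def)
  define l where "l x = (\<Sum>j<m. a m j * x j)" for x
  define a' where "a' i j = a i j - a m i * a m j / \<alpha>" for i j
  have split: "(\<Sum>i<Suc m. \<Sum>j<Suc m. a i j * x i * x j)
      = \<alpha> * (x m + l x / \<alpha>)\<^sup>2 + (\<Sum>i<m. \<Sum>j<m. a' i j * x i * x j)" for x
  proof -
    have col: "(\<Sum>i<m. a i m * x i * x m) = x m * l x"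
      unfolding l_def sum_distrib_left by (rule sum.cong) (use Suc.prems(1) in auto)
    have row: "(\<Sum>j<m. a m j * x m * x j) = x m * l x"
      unfolding l_def sum_distrib_left by (rule sum.cong) auto
    have sq: "(\<Sum>i<m. \<Sum>j<m. a m i * a m j / \<alpha> * x i * x j) = (l x)\<^sup>2 / \<alpha>"
      unfolding l_def power2_eq_square sum_product sum_divide_distrib by (intro sum.cong refl) simp
    have "(\<Sum>i<m. \<Sum>j<m. a' i j * x i * x j) = (\<Sum>i<m. \<Sum>j<m. a i j * x i * x j) - (l x)\<^sup>2 / \<alpha>"
      unfolding sq[symmetric] sum_subtractf[symmetric] a'_def by (intro sum.cong refl) (simp add: algebra_simps)
    moreover have "(\<Sum>i<Suc m. \<Sum>j<Suc m. a i j * x i * x j)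
        = (\<Sum>i<m. \<Sum>j<m. a i j * x i * x j) + x m * l x + (x m * l x + \<alpha> * x m * x m)"
      by (simp add: sum.distrib col row \<alpha>_def)
    moreover have "\<alpha> * (x m + l x / \<alpha>)\<^sup>2 = \<alpha> * x m * x m + 2 * (x m * l x) + (l x)\<^sup>2 / \<alpha>"
      using \<alpha> by (simp add: power2_eq_square field_simps)
    ultimately show ?thesis by simp
  qed
  have "\<exists>b. \<forall>x. (\<Sum>i<m. \<Sum>j<m. a' i j * x i * x j) = (\<Sum>q<m. (\<Sum>j<m. b q j * x j)\<^sup>2)"
  proof (rule Suc.IH)
    show "a' i j = a' j i" if "i < m" "j < m" for i j
      using Suc.prems(1)[of i j] that by (simp add: a'_def)
    fix x :: "nat \<Rightarrow> real" assume x: "\<exists>i<m. x i \<noteq> 0"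
    \<comment> \<open>The last coordinate is chosen to annihilate the completed square, so the Schur
      complement inherits positivity from the whole form.\<close>
    define y where "y = x(m := - l x / \<alpha>)"
    have ly: "l y = l x" unfolding l_def y_def by (rule sum.cong) auto
    have "(\<Sum>i<m. \<Sum>j<m. a' i j * y i * y j) = (\<Sum>i<m. \<Sum>j<m. a' i j * x i * x j)"
      by (intro sum.cong refl) (auto simp: y_def)
    moreover have "0 < (\<Sum>i<Suc m. \<Sum>j<Suc m. a i j * y i * y j)"
      by (rule Suc.prems(2)) (use x in \<open>auto simp: y_def intro: less_SucI\<close>)
    moreover have "y m + l y / \<alpha> = 0" unfolding ly by (simp add: y_def)
    ultimately show "0 < (\<Sum>i<m. \<Sum>j<m. a' i j * x i * x j)" unfolding split by simp
  qed
  then obtain b where b: "\<And>x. (\<Sum>i<m. \<Sum>j<m. a' i j * x i * x j) = (\<Sum>q<m. (\<Sum>j<m. b q j * x j)\<^sup>2)" by blast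
  \<comment> \<open>The new row carries the completed square; the earlier rows ignore the last
    variable.\<close>
  define b' where "b' q j = (if q < m then (if j < m then b q j else 0)
     else sqrt \<alpha> * (if j < m then a m j / \<alpha> else 1))" for q j
  have "(\<Sum>i<Suc m. \<Sum>j<Suc m. a i j * x i * x j) = (\<Sum>q<Suc m. (\<Sum>j<Suc m. b' q j * x j)\<^sup>2)" for x
  proof -
    have "(\<Sum>j<Suc m. b' m j * x j) = sqrt \<alpha> * (x m + l x / \<alpha>)"
      by (simp add: b'_def l_def sum_divide_distrib sum_distrib_left algebra_simps)
    then have "(\<Sum>j<Suc m. b' m j * x j)\<^sup>2 = \<alpha> * (x m + l x / \<alpha>)\<^sup>2"
      using \<alpha> by (simp add: power_mult_distrib del: sum.lessThan_Suc)
    moreover have "(\<Sum>j<Suc m. b' q j * x j) = (\<Sum>j<m. b q j * x j)" if "q < m" for q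
      using that by (simp add: b'_def)
    ultimately show ?thesis unfolding split b by (simp del: sum.lessThan_Suc add: sum.lessThan_Suc[of _ m])
  qed
  then show ?case by blast
qed simp

lemma pos_def_mat_squares:
  assumes "pos_def_mat d A"
  obtains B :: "nat \<Rightarrow> nat \<Rightarrow> real" where "\<And>p q. p \<in> carrier_vec d \<Longrightarrow> q \<in> carrier_vec d \<Longrightarrow>
     mahalanobis A p q = (\<Sum>r<d. (\<Sum>j<d. B r j * (p $ j - q $ j))\<^sup>2)"
proof -
  have A: "A \<in> carrier_mat d d" "transpose_mat A = A"
    "\<And>x. x \<in> carrier_vec d \<Longrightarrow> x \<noteq> 0\<^sub>v d \<Longrightarrow> scalar_prod x (A *\<^sub>v x) > 0"
    using assms by (auto simp: pos_def_mat_def)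
  have form: "scalar_prod v (A *\<^sub>v v) = (\<Sum>i<d. \<Sum>j<d. A $$ (i, j) * v $ i * v $ j)" if "v \<in> carrier_vec d" for v
  proof -
    have "scalar_prod v (A *\<^sub>v v) = (\<Sum>i<d. v $ i * (\<Sum>j<d. A $$ (i, j) * v $ j))"
      using A(1) that by (simp add: scalar_prod_def atLeast0LessThan)
    then show ?thesis by (simp add: sum_distrib_left algebra_simps)
  qed
  have "\<exists>b. \<forall>x. (\<Sum>i<d. \<Sum>j<d. A $$ (i, j) * x i * x j) = (\<Sum>q<d. (\<Sum>j<d. b q j * x j)\<^sup>2)"
  proof (rule pos_def_form_squares)
    fix i j assume "i < d" "j < d"
    then have "transpose_mat A $$ (i, j) = A $$ (j, i)" using A(1) by simp
    then show "A $$ (i, j) = A $$ (j, i)" using A(2) by simp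
  next
    fix x :: "nat \<Rightarrow> real" assume "\<exists>i<d. x i \<noteq> 0"
    then obtain i where i: "i < d" "x i \<noteq> 0" by blast
    have "vec d x $ i \<noteq> 0\<^sub>v d $ i" using i by simp
    then have "vec d x \<noteq> 0\<^sub>v d" by metis
    from A(3)[OF _ this] show "0 < (\<Sum>i<d. \<Sum>j<d. A $$ (i, j) * x i * x j)" by (simp add: form)
  qed
  then obtain b where b: "\<And>x. (\<Sum>i<d. \<Sum>j<d. A $$ (i, j) * x i * x j) = (\<Sum>q<d. (\<Sum>j<d. b q j * x j)\<^sup>2)" by blast
  show thesis
  proof (rule that[of b])
    fix p q :: "real vec" assume "p \<in> carrier_vec d" "q \<in> carrier_vec d"
    then show "mahalanobis A p q = (\<Sum>r<d. (\<Sum>j<d. b r j * (p $ j - q $ j))\<^sup>2)"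
      unfolding mahalanobis_def by (simp add: form b)
  qed
qed

section \<open>Optimal clusterings\<close>

context clustering
begin

definition assignment_cost :: "(nat \<Rightarrow> nat) \<Rightarrow> real" where
  "assignment_cost g = (\<Sum>j<k. dev {p \<in> {..<n}. g p = j})"

text \<open>There are finitely many assignments but infinitely many center sets: minimizing over
  assignments gives an attained optimum.\<close>

lemma optimal_assignment:
  obtains f where "\<And>p. p < n \<Longrightarrow> f p < k" "\<And>g. (\<And>p. p < n \<Longrightarrow> g p < k) \<Longrightarrow> assignment_cost f \<le> assignment_cost g"
proof -
  let ?F = "PiE {..<n} (\<lambda>_. {..<k})"
  have "finite ?F" by (rule finite_PiE) auto
  moreover have "restrict (\<lambda>_. 0) {..<n} \<in> ?F" using k_pos by auto
  then have "?F \<noteq> {}" by blast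
  ultimately obtain f where f: "f \<in> ?F" "\<And>g. g \<in> ?F \<Longrightarrow> assignment_cost f \<le> assignment_cost g"
    using ex_is_arg_min_if_finite[of ?F assignment_cost] by (auto simp: is_arg_min_linorder)
  show thesis
  proof (rule that[of f])
    show "f p < k" if "p < n" for p using f(1) that by auto
    fix g :: "nat \<Rightarrow> nat" assume g: "\<And>p. p < n \<Longrightarrow> g p < k"
    then have "restrict g {..<n} \<in> ?F" by auto
    then have "assignment_cost f \<le> assignment_cost (restrict g {..<n})" by (rule f)
    also have "{p \<in> {..<n}. restrict g {..<n} p = j} = {p \<in> {..<n}. g p = j}" for j by auto
    then have "assignment_cost (restrict g {..<n}) = assignment_cost g" by (simp add: assignment_cost_def)
    finally show "assignment_cost f \<le> assignment_cost g" .
  qed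
qed

text \<open>Assign each point to a nearest center, then replace each center by the centroid of its
  cluster; by the parallel axis identity this does not raise the cost.\<close>

lemma assignment_cost_le_W:
  assumes "\<And>g. (\<And>p. p < n \<Longrightarrow> g p < k) \<Longrightarrow> c \<le> assignment_cost g"
  shows "c \<le> W C"
proof -
  obtain g where g: "\<And>p. g p < k \<and> w C p = D (X p) (C (g p))" using w_attained[of C] by metis
  have "c \<le> assignment_cost g" by (rule assms) (use g in blast)
  also have "\<dots> \<le> (\<Sum>j<k. \<Sum>p\<in>{p \<in> {..<n}. g p = j}. D (X p) (C j))"
    unfolding assignment_cost_def
  proof (rule sum_mono)
    fix j show "dev {p \<in> {..<n}. g p = j} \<le> (\<Sum>p\<in>{p \<in> {..<n}. g p = j}. D (X p) (C j))"
      by (subst parallel_axis) simp_all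
  qed
  also have "\<dots> = (\<Sum>j<k. \<Sum>p\<in>{p \<in> {..<n}. g p = j}. w C p)"
    by (intro sum.cong refl) (use g in auto)
  also have "\<dots> = W C"
    unfolding W_def by (rule sum.group) (use g in auto)
  finally show ?thesis .
qed

end

section \<open>Well-formedness\<close>

lemma wfc_unr: "(\<And>j. wfc K (f j)) \<Longrightarrow> wfc K (unr f m)"
  by (induction m) auto

lemma wfc_tree: "(\<And>x. wfc K (leaf x)) \<Longrightarrow> wfc K (tree leaf l m)"
  by (induction l arbitrary: m) auto

lemma wfc_blk: "wfc K (blk is)"
  by (induction "is") auto

lemma wfc_rows: "wfc K (zerop d)" "wfc K (addp d)" "wfc K (divp d)" "wfc K (cprow d \<sigma> \<rho>)" "wfc K (distp d)" "wfc K (leafp d G x)"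
  "wfc K (ld d r \<rho> j)" "wfc K (st d \<rho> j)"
  unfolding zerop_def addp_def divp_def cprow_def distp_def leafp_def ld_def st_def
  by (auto intro!: wfc_unr simp: wfc_blk)

text \<open>The registers with the loop bounds n, k, s, T and M, none of which the main program
  writes.\<close>

definition KP :: "nat set" where "KP = {0, 1, 2, 3, 4}"

lemma KP_iff [simp]: "x \<in> KP \<longleftrightarrow> x = 0 \<or> x = 1 \<or> x = 2 \<or> x = 3 \<or> x = 4"
  by (auto simp: KP_def)

lemma wfc_For:
  assumes "wfc KP c" "m \<in> KP" "i \<notin> KP" "i \<noteq> 5" "keep c N R" "\<And>x. x \<in> N \<Longrightarrow> x \<noteq> i \<and> x \<notin> KP"
  shows "wfc KP (For i m c)"
proof -
  have "5 \<notin> KP" by simp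
  moreover have "wn c \<subseteq> N" using assms(5) by (simp only: keep_def)
  ultimately show ?thesis unfolding wfc.simps using assms by blast
qed

lemma wfc_passp: "wfc KP (passp d G)"
proof -
  have k: "keep (tree (leafp d G) d 0) {17, 20, 21} {1, 2, 3}"
    by (rule keep_tree) (auto intro: keep_mono[OF keep_leafp])
  have "wfc KP (For 10 2 (Sq (Ins (NLoad 16 10)) (Sq (tree (leafp d G) d 0) (blk [RArith 1 Times 1 1, RArith 4 Plus 4 1]))))"
    by (rule wfc_For[where N = "{16, 17, 20, 21}" and R = "{1, 2, 3, 4}"])
       (use keep_mono[OF k, of "{16, 17, 20, 21}" "{1, 2, 3, 4}"] in \<open>auto simp: wfc_tree wfc_rows\<close>)
  then have 1: "wfc KP (estp d G)" unfolding estp_def by (simp only: wfc.simps(2,3) simp_thms)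
  have 2: "wfc KP (wtp d G)" unfolding wtp_def
    by (rule wfc_For[where N = "{5, 10, 16, 17, 18, 20, 21}" and R = "{1, 2, 3, 4, 5, 7}"])
       (auto simp: 1 intro: keep_mono[OF keep_estp])
  have "wfc KP (For 12 0 (Sq (wtp d G) (blk [RArith 6 Plus 6 5, NArith 23 Plus 22 12, RStore 23 6])))"
    by (rule wfc_For[where N = "{5, 10, 11, 16, 17, 18, 20, 21, 23}" and R = "{1, 2, 3, 4, 5, 6, 7}"])
       (auto simp: 2 intro: keep_mono[OF keep_wtp])
  then have "wfc KP (sump d G)" unfolding sump_def by (simp only: wfc.simps(2,3) simp_thms)
  moreover have "wfc KP drawp" by (simp add: drawp_def)
  ultimately show ?thesis by (simp add: passp_def)
qed

lemma wfc_searchp: "wfc KP (searchp d G)"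
proof -
  have pick: "wfc KP pickp" by (simp add: pickp_def)
  have 1: "wfc KP (samplep d G)" unfolding samplep_def by (simp add: wfc_passp pick)
  have 2: "wfc KP (For 14 4 (Sq (samplep d G) (addp d)))"
  proof (rule wfc_For)
    show "keep (Sq (samplep d G) (addp d)) NS RS"
      using keep_samplep[of d G] keep_mono[OF keep_rows(2)[of d], of NS RS] by simp
  qed (auto simp: 1 wfc_rows)
  have 3: "wfc KP (For 11 1 (Ifc (NLess 11 13) Skip (Sq (Ins (NArith 18 Plus 0 11)) (cprow d 29 18))))"
    by (rule wfc_For[where N = "{18, 20, 21}" and R = "{7}"])
       (auto simp: wfc_rows intro: keep_mono[OF keep_rows(4)])
  have 4: "wfc KP (stagep d G)" unfolding stagep_def using 2 3 by (simp add: wfc_rows del: wfc.simps(5))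
  have 5: "wfc KP (trialp d G)" unfolding trialp_def
    by (rule wfc_For[OF 4 _ _ _ keep_stagep]) auto
  have 6: "wfc KP (For 11 1 (Sq (blk [NArith 18 Plus 0 11, NArith 23 Plus 30 11]) (cprow d 18 23)))"
    by (rule wfc_For[where N = "{18, 20, 21, 23}" and R = "{7}"])
       (auto simp: wfc_rows intro: keep_mono[OF keep_rows(4)])
  have 7: "wfc KP (roundp d G)" unfolding roundp_def using 5 6 by (simp add: wfc_passp del: wfc.simps(5))
  have "wfc KP (For 15 3 (roundp d G))" by (rule wfc_For[OF 7 _ _ _ keep_roundp]) auto
  then show ?thesis unfolding searchp_def by (simp add: wfc_passp del: wfc.simps(5))
qed

lemma keep_outp: "keep (outp d) {5, 11, 13, 20, 21, 23, 24} {1, 2, 3, 4, 7}"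
  unfolding outp_def
  using keep_mono[OF keep_rows(4)] keep_mono[OF keep_dupp] keep_mono[OF keep_st] by auto

lemma wfc_outp: "wfc KP (outp d)"
proof -
  have 1: "wfc KP (checkp d)" unfolding checkp_def by (simp add: wfc_rows)
  have 2: "wfc KP (For 11 1 (Ifc (NLess 11 13) (checkp d) Skip))"
    by (rule wfc_For[where N = "{20, 21, 24}" and R = "{1, 2, 3, 4}"])
       (use 1 keep_checkp[of d] in auto)
  then have 3: "wfc KP (dupp d)" unfolding dupp_def by (simp del: wfc.simps(5))
  show ?thesis unfolding outp_def
    by (rule wfc_For[where N = "{5, 11, 20, 21, 23, 24}" and R = "{1, 2, 3, 4, 7}"])
       (auto simp: 3 wfc_rows intro: keep_mono[OF keep_rows(4)] keep_mono[OF keep_dupp] keep_mono[OF keep_st])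
qed

section \<open>The complete program\<close>

text \<open>The number of rounds and the sketch size depend on \<open>k\<close>, so they are
  computed from it. Register 3 starts as \<open>L\<close>, register 32 holds \<open>c * k\<close>
  and register 33 the exponent \<open>(M + 1) * k\<close>.\<close>

definition setA :: "nat \<Rightarrow> nat \<Rightarrow> nat \<Rightarrow> nat \<Rightarrow> cmd" where
  "setA d M c L = blk [NConst 31 1, NConst 8 2, NConst 4 M, NConst 19 (2 ^ d - 1), NArith 6 Minus 0 31,
     NArith 7 Minus 1 31, NArith 30 Plus 0 1, NArith 29 Plus 30 1, NArith 22 Plus 29 31, NConst 20 d,
     NArith 22 Times 22 20, NConst 32 c, NArith 32 Times 32 1, NConst 33 (M + 1), NArith 33 Times 33 1, NConst 3 L]"

text \<open>There is no power instruction; the repeated multiplications are cheap compared with the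
  main program.\<close>

definition setB :: cmd where
  "setB = For 34 33 (Ins (NArith 3 Times 3 32))"

text \<open>Register 35 ends as the inverse accuracy \<open>h\<close> of the analysis.\<close>

definition setC :: "nat \<Rightarrow> cmd" where
  "setC h\<^sub>0 = blk [NConst 35 h\<^sub>0, NArith 35 Times 35 1, NArith 35 Times 35 3, NArith 2 Times 35 35, NArith 2 Times 2 8]"

definition mainp :: "nat \<Rightarrow> (nat \<Rightarrow> nat \<Rightarrow> real) \<Rightarrow> cmd" where
  "mainp d G = Sq (searchp d G) (outp d)"

lemma impl_Sq:
  assumes "impl t (compile a) u (sem a u)" "\<And>u'. u' \<in> set_pmf (sem a u) \<Longrightarrow> impl t' (compile b) u' (sem b u')"
  shows "impl (t + 1 + t') (compile (Sq a b)) u (sem (Sq a b) u)"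
  using impl_Seq[OF assms] by simp

definition fullp :: "nat \<Rightarrow> (nat \<Rightarrow> nat \<Rightarrow> real) \<Rightarrow> nat \<Rightarrow> nat \<Rightarrow> nat \<Rightarrow> nat \<Rightarrow> cmd" where
  "fullp d G M c L h\<^sub>0 = Sq (setA d M c L) (Sq setB (Sq (setC h\<^sub>0) (mainp d G)))"

context clustering
begin

text \<open>The first trial starts from zero vectors, since the memory beyond the input is
  zero.\<close>

definition ready :: "nat \<Rightarrow> ram_state \<Rightarrow> bool" where
  "ready T t \<longleftrightarrow> envr t \<and> pts t \<and> slots (\<lambda>_ _. 0) t \<and> best (\<lambda>_ _. 0) t \<and> nreg t 3 = T"

lemma input_ready:
  assumes t: "nreg t 0 = n" "nreg t 1 = k" "nreg t 9 = 0" "\<And>p j. p < n \<Longrightarrow> j < d \<Longrightarrow> cell d t p j = X p j"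
      "\<And>\<rho> j. n \<le> \<rho> \<Longrightarrow> j < d \<Longrightarrow> cell d t \<rho> j = 0"
    and T: "T = L * (c * k) ^ ((M + 1) * k)" and s: "s = 2 * (h\<^sub>0 * k * T)\<^sup>2"
  shows "hoare (setA d M c L) t (\<lambda>t1. nreg t1 33 = (M + 1) * k \<and> hoare setB t1 (\<lambda>t2. hoare (setC h\<^sub>0) t2 (ready T)))"
proof -
  define iv where "iv u \<longleftrightarrow> nreg u 0 = n \<and> nreg u 1 = k \<and> nreg u 4 = M \<and> nreg u 6 = n - 1 \<and> nreg u 7 = k - 1 \<and>
     nreg u 8 = 2 \<and> nreg u 9 = 0 \<and> nreg u 19 = 2 ^ d - 1 \<and> nreg u 22 = F \<and> nreg u 29 = n + 2 * k \<and>
     nreg u 30 = n + k \<and> nreg u 31 = 1 \<and> nreg u 32 = c * k \<and> rmem u = rmem t" for u :: ram_state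
  have B: "hoare setB u (\<lambda>u'. iv u' \<and> nreg u' 3 = T)"
    if u: "iv u" "nreg u 3 = L" "nreg u 33 = (M + 1) * k" for u
  proof -
    define Inv where "Inv j u' \<longleftrightarrow> iv u' \<and> nreg u' 3 = L * (c * k) ^ j" for j and u' :: ram_state
    have "hoare (For 34 33 (Ins (NArith 3 Times 3 32))) u (\<lambda>u'. Inv (nreg u 33) u')"
    proof (rule hoare_For)
      show "Inv 0 (setn 34 0 u)" using u by (simp add: Inv_def iv_def)
      fix j u' assume "Inv j u'"
      then show "hoare (Ins (NArith 3 Times 3 32)) u' (\<lambda>u''. Inv (Suc j) (incr 34 u''))"
        by (simp add: Inv_def iv_def)
    qed simp_all
    then show ?thesis unfolding setB_def
      by (rule hoare_conseq) (simp add: Inv_def u(3) T)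
  qed
  have C: "hoare (setC h\<^sub>0) u (ready T)" if "iv u \<and> nreg u 3 = T" for u
  proof -
    have "h\<^sub>0 * k * T * (h\<^sub>0 * k * T) * 2 = s" using s by (simp add: power2_eq_square)
    then show ?thesis using that t(4,5) unfolding setC_def
      by (simp add: ready_def iv_def envr_def pts_def slots_def best_def cell_def)
  qed
  have BC: "hoare setB u (\<lambda>u'. hoare (setC h\<^sub>0) u' (ready T))"
    if "iv u" "nreg u 3 = L" "nreg u 33 = (M + 1) * k" for u
    by (rule hoare_conseq[OF B[OF that]]) (rule C)
  have "hoare (setA d M c L) t (\<lambda>u. iv u \<and> nreg u 3 = L \<and> nreg u 33 = (M + 1) * k)"
    using t(1-3) unfolding setA_def by (simp add: iv_def algebra_simps)
  then show ?thesis by (rule hoare_conseq) (use BC in blast)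
qed

lemma coup_mainp:
  assumes "ready T t" "d \<ge> 1"
  shows "coup (mainp d G) t (search T (\<lambda>_ _. 0)) (\<lambda>x. output_ok (fst (snd x)))"
proof -
  have "coup (mainp d G) t (map_pmf (\<lambda>x. x) (search T (\<lambda>_ _. 0))) (\<lambda>x. output_ok (fst (snd x)))"
    unfolding mainp_def
  proof (rule coup_Sq_hoare)
    show "coup (searchp d G) t (search T (\<lambda>_ _. 0)) searching"
      by (rule coup_searchp) (use assms in \<open>simp_all add: ready_def\<close>)
    fix x t' assume "searching x t'"
    then show "hoare (outp d) t' (output_ok (fst (snd x)))"
      by (intro hoare_outp assms(2)) (simp_all add: searching_def)
  qed
  then show ?thesis by simp
qed

lemma impl_mainp:
  assumes "ready T t" "d \<ge> 1" "M \<ge> 1" "T \<ge> 1" "s \<ge> 1"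
  shows "impl (2500 * (T * (k * (M * (n * (k * (s * d))))))) (compile (mainp d G)) t (sem (mainp d G) t)"
proof -
  let ?\<nu> = "nreg t"
  have \<nu>: "?\<nu> 0 = n" "?\<nu> 1 = k" "?\<nu> 2 = s" "?\<nu> 3 = T" "?\<nu> 4 = M"
    using assms(1) by (simp_all add: ready_def envr_def)
  have search: "tb ?\<nu> (searchp d G) 2000 (T * (k * (M * (n * (k * (s * d))))))"
    using tb_searchp[of d ?\<nu> G] assms n_pos k_pos unfolding \<nu> by simp
  have out: "tb ?\<nu> (outp d) 400 (k * (k * d))"
    using tb_outp[of d ?\<nu>] assms k_pos unfolding \<nu> by simp
  have "k * d \<le> k * (s * d)" using assms(5) by simp
  also have "\<dots> \<le> n * (k * (s * d))" using n_pos by simp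
  also have "\<dots> \<le> M * (n * (k * (s * d)))" using assms(3) by simp
  finally have "k * (k * d) \<le> k * (M * (n * (k * (s * d))))" by (rule mult_le_mono2)
  also have "\<dots> \<le> T * (k * (M * (n * (k * (s * d)))))" using assms(4) by simp
  finally have "tb ?\<nu> (outp d) 400 (T * (k * (M * (n * (k * (s * d))))))"
    using tb_mono[OF out order_refl] by blast
  from tb_Sq[OF search this] have "tb ?\<nu> (mainp d G) 2401 (T * (k * (M * (n * (k * (s * d))))))"
    unfolding mainp_def by simp
  then have le: "tm ?\<nu> (mainp d G) \<le> 2500 * (T * (k * (M * (n * (k * (s * d))))))"
    unfolding tb_def by linarith
  have "impl (tm ?\<nu> (mainp d G)) (compile (mainp d G)) t (sem (mainp d G) t)"
  proof (rule impl_comp[where K = KP])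
    show "wfc KP (mainp d G)" by (simp add: mainp_def wfc_searchp wfc_outp)
    have "keep (mainp d G) (insert 13 (insert 14 (insert 15 NS))) (insert 10 RS)"
      unfolding mainp_def using keep_searchp keep_mono[OF keep_outp] by simp
    then show "KP \<inter> wn (mainp d G) = {}" by (auto simp: keep_def)
  qed simp
  then show ?thesis using le by (rule impl_mono)
qed

lemma fullp_correct:
  assumes t: "nreg t 0 = n" "nreg t 1 = k" "nreg t 9 = 0" "\<And>p j. p < n \<Longrightarrow> j < d \<Longrightarrow> cell d t p j = X p j"
      "\<And>\<rho> j. n \<le> \<rho> \<Longrightarrow> j < d \<Longrightarrow> cell d t \<rho> j = 0"
    and T: "T = L * (c * k) ^ ((M + 1) * k)" and s: "s = 2 * (h\<^sub>0 * k * T)\<^sup>2"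
    and pos: "d \<ge> 1" "M \<ge> 1" "T \<ge> 1" "s \<ge> 1"
  shows "impl (3000 * (T * (k * (M * (n * (k * (s * d))))))) (compile (fullp d G M c L h\<^sub>0)) t (sem (fullp d G M c L h\<^sub>0) t)"
    and "coup (fullp d G M c L h\<^sub>0) t (search T (\<lambda>_ _. 0)) (\<lambda>x. output_ok (fst (snd x)))"
proof -
  let ?Q = "T * (k * (M * (n * (k * (s * d)))))"
  note h = input_ready[OF t T s]
  show "coup (fullp d G M c L h\<^sub>0) t (search T (\<lambda>_ _. 0)) (\<lambda>x. output_ok (fst (snd x)))"
    unfolding fullp_def
  proof (rule coup_hoare_Sq[OF h])
    fix t1 assume "nreg t1 33 = (M + 1) * k \<and> hoare setB t1 (\<lambda>t2. hoare (setC h\<^sub>0) t2 (ready T))"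
    then have t1: "hoare setB t1 (\<lambda>t2. hoare (setC h\<^sub>0) t2 (ready T))" ..
    show "coup (Sq setB (Sq (setC h\<^sub>0) (mainp d G))) t1 (search T (\<lambda>_ _. 0)) (\<lambda>x. output_ok (fst (snd x)))"
    proof (rule coup_hoare_Sq[OF t1])
      fix t2 assume t2: "hoare (setC h\<^sub>0) t2 (ready T)"
      show "coup (Sq (setC h\<^sub>0) (mainp d G)) t2 (search T (\<lambda>_ _. 0)) (\<lambda>x. output_ok (fst (snd x)))"
        by (rule coup_hoare_Sq[OF t2 coup_mainp[OF _ pos(1)]])
    qed
  qed
  have A: "impl 32 (compile (setA d M c L)) u (sem (setA d M c L) u)" for u
  proof -
    have "impl (tm (\<lambda>_. 0) (setA d M c L)) (compile (setA d M c L)) u (sem (setA d M c L) u)"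
      by (rule impl_comp[where K = "{}"]) (simp_all add: setA_def)
    then show ?thesis by (rule impl_mono) (simp add: setA_def)
  qed
  have C: "impl 10 (compile (setC h\<^sub>0)) u (sem (setC h\<^sub>0) u)" for u
  proof -
    have "impl (tm (\<lambda>_. 0) (setC h\<^sub>0)) (compile (setC h\<^sub>0)) u (sem (setC h\<^sub>0) u)"
      by (rule impl_comp[where K = "{}"]) (simp_all add: setC_def)
    then show ?thesis by (rule impl_mono) (simp add: setC_def)
  qed
  have B: "impl ((M + 1) * k * 7 + 3) (compile setB) u (sem setB u)" if "nreg u 33 = (M + 1) * k" for u
  proof -
    \<comment> \<open>Register 3 is still being computed here, so \<open>KP\<close> cannot be the
      set of bounds; the only bound is register 33.\<close>
    have "impl (tm (nreg u) setB) (compile setB) u (sem setB u)"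
      by (rule impl_comp[where K = "{33}"]) (simp_all add: setB_def)
    then show ?thesis by (rule impl_mono) (simp add: setB_def that)
  qed
  have "impl (32 + 1 + (((M + 1) * k * 7 + 3) + 1 + (10 + 1 + 2500 * ?Q))) (compile (fullp d G M c L h\<^sub>0)) t (sem (fullp d G M c L h\<^sub>0) t)"
    unfolding fullp_def
  proof (rule impl_Sq[OF A])
    fix t1 assume "t1 \<in> set_pmf (sem (setA d M c L) t)"
    then have t1: "nreg t1 33 = (M + 1) * k" "hoare setB t1 (\<lambda>t2. hoare (setC h\<^sub>0) t2 (ready T))"
      using h by (auto simp: hoare_def)
    show "impl (((M + 1) * k * 7 + 3) + 1 + (10 + 1 + 2500 * ?Q)) (compile (Sq setB (Sq (setC h\<^sub>0) (mainp d G)))) t1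
       (sem (Sq setB (Sq (setC h\<^sub>0) (mainp d G))) t1)"
    proof (rule impl_Sq[OF B[OF t1(1)]])
      fix t2 assume "t2 \<in> set_pmf (sem setB t1)"
      then have t2: "hoare (setC h\<^sub>0) t2 (ready T)" using t1(2) by (auto simp: hoare_def)
      show "impl (10 + 1 + 2500 * ?Q) (compile (Sq (setC h\<^sub>0) (mainp d G))) t2
          (sem (Sq (setC h\<^sub>0) (mainp d G)) t2)"
        by (rule impl_Sq[OF C], rule impl_mainp[OF _ pos]) (use t2 in \<open>auto simp: hoare_def\<close>)
    qed
  qed
  then show "impl (3000 * ?Q) (compile (fullp d G M c L h\<^sub>0)) t (sem (fullp d G M c L h\<^sub>0) t)"
  proof (rule impl_mono)
    have "1 \<le> n * (k * (s * d))" using n_pos k_pos pos by simp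
    then have "M * 1 \<le> M * (n * (k * (s * d)))" by (rule mult_le_mono2)
    then have "k * (M * 1) \<le> k * (M * (n * (k * (s * d))))" by (rule mult_le_mono2)
    also have "\<dots> \<le> ?Q" using pos by simp
    finally have kM: "k * M \<le> ?Q" by simp
    have "1 * 1 \<le> k * M" using k_pos pos by (intro mult_le_mono) auto
    then have "1 \<le> k * M" by simp
    moreover have "k \<le> k * M" using pos by simp
    moreover have "(M + 1) * k * 7 = 7 * (k * M) + 7 * k" by (simp add: algebra_simps)
    ultimately show "32 + 1 + (((M + 1) * k * 7 + 3) + 1 + (10 + 1 + 2500 * ?Q)) \<le> 3000 * ?Q" using kM by linarith
  qed
qed

end

section \<open>Approximation guarantee\<close>

context clustering
begin

lemma D_cong: "(\<And>j. j < d \<Longrightarrow> v j = v' j) \<Longrightarrow> D u v = D u v'"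
  by (simp add: D_def lin_def)

lemma kmedian_cost_W:
  assumes A: "\<And>p q. p \<in> carrier_vec d \<Longrightarrow> q \<in> carrier_vec d \<Longrightarrow>
      mahalanobis A p q = (\<Sum>r<d. (\<Sum>j<d. B r j * (p $ j - q $ j))\<^sup>2)"
    and ps: "length ps = n" "distinct ps" "set ps \<subseteq> carrier_vec d" "X = (\<lambda>p j. ps ! p $ j)"
    and c: "\<And>l. l < k \<Longrightarrow> c l \<in> carrier_vec d"
  shows "kmedian_cost A (set ps) (c ` {..<k}) = W (\<lambda>l j. c l $ j)"
proof -
  have "bij_betw (\<lambda>i. ps ! i) {..<n} (set ps)" using bij_betw_nth[OF ps(2) _ refl] ps(1) by simp
  then have "kmedian_cost A (set ps) (c ` {..<k}) = (\<Sum>i<n. Min ((\<lambda>q. mahalanobis A (ps ! i) q) ` c ` {..<k}))"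
    unfolding kmedian_cost_def by (rule sum.reindex_bij_betw[symmetric])
  also have "\<dots> = W (\<lambda>l j. c l $ j)"
    unfolding W_def w_def image_image
  proof (intro sum.cong refl arg_cong[where f = Min] image_cong)
    fix i l assume "i \<in> {..<n}" "l \<in> {..<k}"
    then have "ps ! i \<in> carrier_vec d" "c l \<in> carrier_vec d" using ps c by (auto simp: subset_iff)
    then show "mahalanobis A (ps ! i) (c l) = D (X i) (\<lambda>j. c l $ j)"
      by (simp add: A D_def lin_def ps(4) sum_subtractf[symmetric] algebra_simps)
  qed
  finally show ?thesis .
qed

text \<open>Distinctness of the rows gives exactly \<open>k\<close> centers, and the occurrence of
  all centers of \<open>C\<close> bounds the cost. Conversely, any admissible set is enumerated by
  \<open>k\<close> slots, so \<open>opt\<close> bounds the optimum from below.\<close>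

lemma output_approx:
  assumes A: "\<And>p q. p \<in> carrier_vec d \<Longrightarrow> q \<in> carrier_vec d \<Longrightarrow>
      mahalanobis A p q = (\<Sum>r<d. (\<Sum>j<d. B r j * (p $ j - q $ j))\<^sup>2)"
    and ps: "length ps = n" "distinct ps" "set ps \<subseteq> carrier_vec d" "X = (\<lambda>p j. ps ! p $ j)"
    and out: "output_ok C t"
    and opt: "\<And>C. opt \<le> W C" and C: "W C \<le> (1 + \<epsilon>) * opt" and \<epsilon>: "0 < \<epsilon>"
  shows "kmedian_approx d k A \<epsilon> (set ps) (output_centers d k t)"
proof -
  define c where "c i = vec d (\<lambda>j. rmem t (i * d + j))" for i
  have c_carrier: "c l \<in> carrier_vec d" for l by (simp add: c_def)
  have c_cell: "c l $ j = cell d t l j" if "j < d" for l j using that by (simp add: c_def cell_def)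
  have O: "output_centers d k t = c ` {..<k}" by (simp add: output_centers_def c_def)
  have "inj_on c {..<k}"
  proof (rule linorder_inj_onI')
    fix a b assume ab: "a \<in> {..<k}" "b \<in> {..<k}" "a < b"
    show "c a \<noteq> c b"
    proof
      assume "c a = c b"
      then have "agree d t a b" unfolding agree_def using c_cell by metis
      then show False using out ab by (auto simp: output_ok_def)
    qed
  qed
  then have mem: "output_centers d k t \<in> center_sets d k"
    unfolding O center_sets_def using c_carrier by (auto simp: card_image)
  have "W (\<lambda>l j. c l $ j) \<le> W C"
    unfolding W_def
  proof (rule sum_mono)
    fix p
    obtain l where l: "l < k" "w C p = D (X p) (C l)" using w_attained by blast
    obtain l' where l': "l' < k" "\<forall>j<d. cell d t l' j = C l j" using out l(1) unfolding output_ok_def by blast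
    have "D (X p) (\<lambda>j. c l' $ j) = D (X p) (C l)" by (rule D_cong) (use l' c_cell in auto)
    then show "w (\<lambda>l j. c l $ j) p \<le> w C p" using w_le[OF l'(1), of "\<lambda>l j. c l $ j" p] l(2) by simp
  qed
  then have cost: "kmedian_cost A (set ps) (output_centers d k t) \<le> (1 + \<epsilon>) * opt"
    unfolding O using C kmedian_cost_W[OF A ps, of c] c_carrier by simp
  have "opt \<le> opt_cost d k A (set ps)"
    unfolding opt_cost_def
  proof (rule cINF_greatest)
    show "center_sets d k \<noteq> {}" using mem by blast
    fix Q assume Q: "Q \<in> center_sets d k"
    then have "finite Q" using k_pos by (intro card_ge_0_finite) (simp add: center_sets_def)
    then obtain e where e: "bij_betw e {0..<card Q} Q" using ex_bij_betw_nat_finite by blast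
    then have Qe: "Q = e ` {..<k}" using Q by (simp add: bij_betw_def center_sets_def atLeast0LessThan)
    have "kmedian_cost A (set ps) (e ` {..<k}) = W (\<lambda>l j. e l $ j)"
      by (rule kmedian_cost_W[OF A ps]) (use Q Qe in \<open>auto simp: center_sets_def\<close>)
    then show "opt \<le> kmedian_cost A (set ps) Q" using opt unfolding Qe by simp
  qed
  then have "(1 + \<epsilon>) * opt \<le> (1 + \<epsilon>) * opt_cost d k A (set ps)" using \<epsilon> by (intro mult_left_mono) auto
  then show ?thesis using mem cost by (simp add: kmedian_approx_def)
qed

end

section \<open>Choice of the parameters\<close>

text \<open>To first order, the factor after division by 1 - x is 1 + 4x; the 16 leaves room for the
  quadratic terms.\<close>

lemma approximation_factor:
  fixes x \<epsilon> w opt :: real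
  assumes x: "0 < x" "16 * x \<le> \<epsilon>" and \<epsilon>: "\<epsilon> \<le> 1 / 2" and opt: "0 \<le> opt"
    and w: "(1 - x) * w \<le> (1 + x) * (1 + 2 * x) * opt"
  shows "w \<le> (1 + \<epsilon>) * opt"
proof -
  have "x * x \<le> 1 / 32 * x" using x \<epsilon> by (intro mult_right_mono) auto
  moreover have "x * \<epsilon> \<le> 1 / 32 * \<epsilon>" using x \<epsilon> by (intro mult_right_mono) auto
  moreover have "(1 + x) * (1 + 2 * x) = 1 + 3 * x + 2 * (x * x)" "(1 - x) * (1 + \<epsilon>) = 1 + \<epsilon> - x - x * \<epsilon>"
    by (simp_all add: algebra_simps)
  ultimately have "(1 + x) * (1 + 2 * x) \<le> (1 - x) * (1 + \<epsilon>)" using x by linarith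
  then have "(1 + x) * (1 + 2 * x) * opt \<le> (1 - x) * (1 + \<epsilon>) * opt" using opt by (rule mult_right_mono)
  then have "(1 - x) * w \<le> (1 - x) * ((1 + \<epsilon>) * opt)" using w by (simp add: mult.assoc)
  then show ?thesis using x \<epsilon> by simp
qed

text \<open>Each of the two failures gets half of \<delta>. Missing every success has probability at
  most exp(-L/2) \<le> 2/L, as T = L/q; inaccurate evaluations contribute (T + 1)/(LT) \<le>
  2/L.\<close>

lemma failure_bound:
  fixes L T :: nat and \<delta> q \<alpha> :: real
  assumes L: "4 / \<delta> \<le> L" "L \<ge> 4" and \<delta>: "0 < \<delta>" and T: "T = L * Z" "Z \<ge> 1"
    and q: "q = 1 / Z" and \<alpha>: "\<alpha> = 1 / (real L * real T)"
  shows "\<alpha> \<le> q / 2" "(1 - q / 2) ^ T + (real T + 1) * \<alpha> \<le> \<delta>"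
proof -
  have Lr: "real L \<ge> 4" using L by simp
  have Z: "real Z \<ge> 1" using T by simp
  have T': "real T = L * Z" using T by simp
  have "real L * L * 1 \<ge> 4 * 4 * 1" by (intro mult_mono) (use Lr in auto)
  then show "\<alpha> \<le> q / 2" using Lr Z unfolding \<alpha> q T' by (simp add: field_simps)
  have \<delta>2: "2 / L \<le> \<delta> / 2" using L \<delta> Lr by (simp add: field_simps)
  have "q \<le> 1" using Z unfolding q by simp
  then have q1: "0 \<le> 1 - q / 2" by linarith
  have "(1 - q / 2) ^ T \<le> exp (- (q / 2)) ^ T"
    by (intro power_mono q1) (use exp_ge_add_one_self[of "- (q / 2)"] in simp)
  also have "\<dots> = exp (- (real L / 2))"
    using Z by (simp add: exp_of_nat_mult[symmetric] T' q)
  also have "\<dots> = 1 / exp (real L / 2)" by (simp add: exp_minus inverse_eq_divide)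
  also have "\<dots> \<le> 1 / (real L / 2)"
  proof (rule divide_left_mono)
    show "real L / 2 \<le> exp (real L / 2)" using exp_ge_add_one_self[of "real L / 2"] by linarith
  qed (use Lr in auto)
  finally have 1: "(1 - q / 2) ^ T \<le> \<delta> / 2" using \<delta>2 by simp
  have "real L * Z \<ge> 1 * 1" by (intro mult_mono) (use Lr Z in auto)
  then have Tpos: "real T \<ge> 1" using T' by simp
  have "(real T + 1) * \<alpha> \<le> (2 * real T) * \<alpha>"
    by (rule mult_right_mono) (use Tpos in \<open>auto simp: \<alpha>\<close>)
  also have "\<dots> = 2 / L" using Tpos Lr by (simp add: \<alpha>)
  finally show "(1 - q / 2) ^ T + (real T + 1) * \<alpha> \<le> \<delta>" using 1 \<delta>2 by linarith
qed

text \<open>The rounds contribute one factor \<open>T\<close> and the sketches two, \<open>s\<close>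
  being quadratic in \<open>T\<close>; \<open>L ^ 5\<close> comes from \<open>T ^ 3\<close> and from
  a further \<open>L ^ 2\<close> in \<open>s\<close>. The exponent is only of order (k/\<epsilon>)
  log(k/\<epsilon>), and since the logarithm \<open>l\<close> is at least 1 it absorbs the
  constants.\<close>

lemma time_bound:
  fixes \<epsilon> :: real
  assumes \<epsilon>: "0 < \<epsilon>" "\<epsilon> \<le> 1 / 2" and k: "k \<ge> 1" and N: "N = nat \<lceil>1 / \<epsilon>\<rceil>"
    and M: "M = 128 * N" and T: "T = L * (2 ^ 25 * N ^ 3 * k) ^ ((M + 1) * k)" and s: "s = 2 * (16 * N * L * k * T)\<^sup>2"
  shows "real (3000 * (T * (k * (M * (n * (k * (s * d))))))) \<le>
    (3000 * real L ^ 5) * real n * real d * 2 powr (25000 * ((real k)\<^sup>2 / \<epsilon>) * (log 2 ((real k)\<^sup>2 / \<epsilon>)) ^ 1)"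
proof -
  define u where "u = (real k)\<^sup>2 / \<epsilon>"
  define l where "l = log 2 u"
  define Y where "Y = 2 ^ 25 * real N ^ 3 * k"
  define e where "e = 3 * ((M + 1) * k)"
  have k1: "real k \<ge> 1" using k by simp
  have kk: "real k \<le> (real k)\<^sup>2" using k1 by (simp add: power2_eq_square)
  have e1: "1 / \<epsilon> \<ge> 2" using \<epsilon> by (simp add: field_simps)
  have Er: "real N \<le> 2 * (1 / \<epsilon>)"
  proof -
    have "real N < 1 / \<epsilon> + 1" unfolding N using e1 ceiling_correct[of "1 / \<epsilon>"] by simp
    then show ?thesis using e1 by simp
  qed
  have E1: "real N \<ge> 1"
  proof -
    have "1 / \<epsilon> \<le> real N" unfolding N by (rule of_nat_ceiling)
    then show ?thesis using e1 by linarith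
  qed
  have uk: "u = (real k)\<^sup>2 * (1 / \<epsilon>)" by (simp add: u_def)
  have u2: "u \<ge> 2"
  proof -
    have "1 * 2 \<le> (real k)\<^sup>2 * (1 / \<epsilon>)" by (intro mult_mono) (use k1 e1 in auto)
    then show ?thesis by (simp add: uk)
  qed
  have Eu: "real N \<le> 2 * u"
  proof -
    have "1 * (1 / \<epsilon>) \<le> (real k)\<^sup>2 * (1 / \<epsilon>)" by (intro mult_right_mono) (use k1 \<epsilon> in auto)
    then show ?thesis using Er by (simp add: uk)
  qed
  have ku: "real k \<le> u"
  proof -
    have "(real k)\<^sup>2 * 1 \<le> (real k)\<^sup>2 * (1 / \<epsilon>)" by (intro mult_left_mono) (use e1 in auto)
    then show ?thesis using kk unfolding uk by linarith
  qed
  have kEu: "real k * real N \<le> 2 * u"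
  proof -
    have "real k * real N \<le> (real k)\<^sup>2 * (2 * (1 / \<epsilon>))" by (intro mult_mono) (use kk Er in auto)
    then show ?thesis by (simp add: uk mult.commute)
  qed
  have l1: "l \<ge> 1" unfolding l_def using u2 by (simp add: le_log_iff)
  have ul: "u = 2 powr l" unfolding l_def using u2 by simp
  have ulp: "u ^ i = 2 powr (i * l)" for i using ul by (simp add: powr_realpow powr_power mult.commute)
  have p2: "(2::real) ^ i = 2 powr i" for i by (simp add: powr_realpow)
  have Y: "Y \<le> 2 powr (32 * l)"
  proof -
    have "Y \<le> 2 ^ 25 * (2 * u) ^ 3 * u"
      unfolding Y_def by (intro mult_mono power_mono Eu ku) (use E1 u2 in auto)
    also have "\<dots> = 2 ^ 28 * u ^ 4" by (simp add: power_mult_distrib power_numeral_reduce)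
    also have "\<dots> = 2 powr (28 + 4 * l)" unfolding p2 ulp by (simp add: powr_add)
    also have "\<dots> \<le> 2 powr (32 * l)" using l1 by (intro powr_mono) auto
    finally show ?thesis .
  qed
  have Y0: "Y \<ge> 0" by (simp add: Y_def)
  have "real e = 3 * (128 * (real k * real N) + real k)" by (simp add: e_def M algebra_simps)
  also have "\<dots> \<le> 3 * (128 * (2 * u) + 2 * u)" using kEu ku u2 by simp
  finally have e: "real e \<le> 774 * u" by simp
  have "Y ^ e \<le> (2 powr (32 * l)) ^ e" by (rule power_mono[OF Y Y0])
  also have "\<dots> = 2 powr (32 * l * e)" by (simp add: powr_power mult.commute)
  also have "\<dots> \<le> 2 powr (32 * l * (774 * u))" using e l1 by (intro powr_mono mult_left_mono) auto
  finally have Ye: "Y ^ e \<le> 2 powr (24768 * (u * l))" by (simp add: mult_ac)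
  have "2 ^ 16 * real N ^ 3 * real k ^ 4 \<le> 2 ^ 16 * (2 * u) ^ 3 * u ^ 4"
    by (intro mult_mono power_mono Eu ku) (use E1 u2 in auto)
  also have "\<dots> = 2 ^ 19 * u ^ 7" by (simp add: power_mult_distrib power_numeral_reduce)
  also have "\<dots> = 2 powr (19 + 7 * l)" unfolding p2 ulp by (simp add: powr_add)
  also have "\<dots> \<le> 2 powr (26 * (u * l))"
  proof (rule powr_mono)
    have "1 * l \<le> u * l" using u2 l1 by (intro mult_right_mono) auto
    then show "19 + 7 * l \<le> 26 * (u * l)" using l1 by linarith
  qed simp
  finally have poly: "2 ^ 16 * real N ^ 3 * real k ^ 4 \<le> 2 powr (26 * (u * l))" .
  have Tr: "real T = L * Y ^ ((M + 1) * k)" by (simp add: T Y_def)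
  have T3: "real T ^ 3 = real L ^ 3 * Y ^ e" by (simp add: Tr e_def power_mult_distrib power_mult[symmetric] mult.commute)
  \<comment> \<open>The power 2^16 collects 2^7 from \<open>M\<close> and 2^9 from
    \<open>s\<close>.\<close>
  have "real (T * (k * (M * (n * (k * (s * d)))))) = real n * real d * (2 ^ 16 * real N ^ 3 * real k ^ 4) * real L ^ 2 * real T ^ 3"
    by (simp add: M s power2_eq_square power_numeral_reduce)
  also have "\<dots> = real n * real d * real L ^ 5 * ((2 ^ 16 * real N ^ 3 * real k ^ 4) * Y ^ e)"
    unfolding T3 by (simp add: power_numeral_reduce)
  also have "\<dots> \<le> real n * real d * real L ^ 5 * (2 powr (26 * (u * l)) * 2 powr (24768 * (u * l)))"
    by (intro mult_left_mono mult_mono poly Ye) (auto simp: Y0)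
  also have "\<dots> = real n * real d * real L ^ 5 * 2 powr (24794 * (u * l))"
    by (simp add: powr_add[symmetric] mult.commute)
  also have "\<dots> \<le> real n * real d * real L ^ 5 * 2 powr (25000 * (u * l))"
  proof (intro mult_left_mono powr_mono)
    have "0 \<le> u * l" using u2 l1 by simp
    then show "24794 * (u * l) \<le> 25000 * (u * l)" by linarith
  qed auto
  finally have "real (T * (k * (M * (n * (k * (s * d)))))) \<le> real n * real d * real L ^ 5 * 2 powr (25000 * (u * l))" .
  then show ?thesis by (simp add: u_def l_def mult.assoc mult.left_commute mult.commute)
qed

text \<open>The constant \<open>a\<close> grows like \<delta>^(-5), while \<open>b = 25000\<close>
  and \<open>m = 1\<close> are absolute.\<close>

theorem theorem4:
  fixes \<delta> :: real
  assumes "0 < \<delta>" and "\<delta> < 1"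
  shows "\<exists>(a::real) (b::real) (m::nat). a > 0 \<and> b > 0 \<and>
    (\<forall>(\<epsilon>::real) (d::nat) (A::real mat).
       0 < \<epsilon> \<and> \<epsilon> \<le> 1/2 \<and> d \<ge> 1 \<and> pos_def_mat d A \<longrightarrow>
       (\<exists>\<A>::prog. \<forall>(n::nat) (k::nat) (P::real vec set) (ps::real vec list).
          n \<ge> 1 \<and> k \<ge> 1 \<and> P \<subseteq> carrier_vec d \<and> finite P \<and> card P = n \<and>
          set ps = P \<and> distinct ps \<longrightarrow>
          (\<exists>t::nat.
             real t \<le> a * real n * real d *
                2 powr (b * ((real k)\<^sup>2 / \<epsilon>) * (log 2 ((real k)\<^sup>2 / \<epsilon>)) ^ m) \<and>
             halts_within t \<A> (input_state d k ps) \<and>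
             measure_pmf.prob (run t (\<A>, input_state d k ps))
               {cfg. kmedian_approx d k A \<epsilon> P (output_centers d k (snd cfg))} \<ge> 1 - \<delta>)))"
proof -
  \<comment> \<open>With 4/\<delta> both failure terms stay below \<delta>/2.\<close>
  define L where "L = nat \<lceil>4 / \<delta>\<rceil>"
  have L: "4 / \<delta> \<le> L" unfolding L_def by (rule of_nat_ceiling)
  have "4 < 4 / \<delta>" using assms by (simp add: field_simps)
  then have L4: "L \<ge> 4" using L by linarith
  have main: "\<exists>\<A>::prog. \<forall>(n::nat) (k::nat) (P::real vec set) (ps::real vec list).
          n \<ge> 1 \<and> k \<ge> 1 \<and> P \<subseteq> carrier_vec d \<and> finite P \<and> card P = n \<and>
          set ps = P \<and> distinct ps \<longrightarrow>
          (\<exists>t::nat.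
             real t \<le> (3000 * real L ^ 5) * real n * real d *
                2 powr (25000 * ((real k)\<^sup>2 / \<epsilon>) * (log 2 ((real k)\<^sup>2 / \<epsilon>)) ^ 1) \<and>
             halts_within t \<A> (input_state d k ps) \<and>
             measure_pmf.prob (run t (\<A>, input_state d k ps))
               {cfg. kmedian_approx d k A \<epsilon> P (output_centers d k (snd cfg))} \<ge> 1 - \<delta>)"
    if \<epsilon>: "0 < \<epsilon>" "\<epsilon> \<le> 1/2" and d: "d \<ge> 1" and A: "pos_def_mat d A" for \<epsilon> d and A :: "real mat"
  proof -
    obtain B :: "nat \<Rightarrow> nat \<Rightarrow> real" where B: "\<And>p q. p \<in> carrier_vec d \<Longrightarrow> q \<in> carrier_vec d \<Longrightarrow>
       mahalanobis A p q = (\<Sum>r<d. (\<Sum>j<d. B r j * (p $ j - q $ j))\<^sup>2)"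
      using pos_def_mat_squares[OF A] by blast
    define N where "N = nat \<lceil>1 / \<epsilon>\<rceil>"
    \<comment> \<open>This is 8/x, as \<open>clustered\<close> demands.\<close>
    define M where "M = 128 * N"
    \<comment> \<open>1/(ck) serves as \<kappa>; it has to stay below x^3/(4608k), and 4608 * 16^3 =
      18874368 is below 2^25.\<close>
    define c where "c = 2 ^ 25 * N ^ 3"
    \<comment> \<open>Chosen so that k/(hx) becomes exactly 1/(LT) for
      \<open>h = h\<^sub>0 * k * T\<close>.\<close>
    define h\<^sub>0 where "h\<^sub>0 = 16 * N * L"
    \<comment> \<open>Used both as \<beta> and as the accuracy of the cost estimates.\<close>
    define x where "x = 1 / (16 * real N)"
    have "1 / \<epsilon> \<le> real N" unfolding N_def by (rule of_nat_ceiling)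
    moreover have "2 \<le> 1 / \<epsilon>" using \<epsilon> by (simp add: field_simps)
    ultimately have N: "N \<ge> 2" "1 / \<epsilon> \<le> N" by linarith+
    have x: "0 < x" "x \<le> 1" "x < 1" "16 * x \<le> \<epsilon>"
      using N \<epsilon> by (simp_all add: x_def field_simps)
    \<comment> \<open>Fixed before \<open>n\<close>, \<open>k\<close> and the points are
      chosen.\<close>
    let ?prog = "compile (fullp d (sketch_row d B) M c L h\<^sub>0)"
    show ?thesis
    proof (intro exI[of _ ?prog] allI impI)
      fix n k :: nat and P :: "real vec set" and ps :: "real vec list"
      assume *: "n \<ge> 1 \<and> k \<ge> 1 \<and> P \<subseteq> carrier_vec d \<and> finite P \<and> card P = n \<and> set ps = P \<and> distinct ps"
      then have n: "n \<ge> 1" and k: "k \<ge> 1" and ps: "length ps = n" "distinct ps" "set ps \<subseteq> carrier_vec d" "P = set ps"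
        by (auto simp: distinct_card)
      define X where "X p j = ps ! p $ j" for p j
      define Z where "Z = (c * k) ^ ((M + 1) * k)"
      define T where "T = L * (c * k) ^ ((M + 1) * k)"
      define h where "h = h\<^sub>0 * k * T"
      define s where "s = 2 * h\<^sup>2"
      define t where "t = 3000 * (T * (k * (M * (n * (k * (s * d))))))"
      have c1: "c \<ge> 2" using N by (simp add: c_def)
      have ck: "c * k \<ge> 2" using mult_le_mono[OF c1 k] by simp
      have Z1: "Z \<ge> 1" unfolding Z_def by (rule one_le_power) (use ck in linarith)
      have TZ: "T = L * Z" by (simp add: T_def Z_def)
      have T1: "T \<ge> 1" using L4 Z1 mult_le_mono[of 1 L 1 Z] by (simp add: TZ)
      have kT: "k * T \<ge> k" using T1 by simp
      have "16 * N * L \<ge> 16 * 2 * 4" by (intro mult_le_mono N L4) simp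
      then have "h\<^sub>0 \<ge> 6" by (simp add: h\<^sub>0_def)
      then have "6 * k \<le> h\<^sub>0 * (k * T)" using kT by (rule mult_le_mono)
      then have h6: "h \<ge> 6 * k" by (simp add: h_def mult.assoc)
      then have h1: "h \<ge> 1" using k by linarith
      have s1: "s \<ge> 1" using h1 by (simp add: s_def)
      have M1: "M \<ge> 1" using N by (simp add: M_def)
      interpret clustering d n k s M B X by unfold_locales (use n k in auto)
      obtain f where opt_f: "\<And>p. p < n \<Longrightarrow> f p < k"
        "\<And>g. (\<And>p. p < n \<Longrightarrow> g p < k) \<Longrightarrow> assignment_cost f \<le> assignment_cost g"
        using optimal_assignment by blast
      define \<kappa> where "\<kappa> = 1 / real (c * k)"
      interpret clustered d n k s M B X f x \<kappa> h
      proof unfold_locales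
        show "f p < k" if "p < n" for p by (rule opt_f(1)[OF that])
        show "8 / x \<le> M" using N by (simp add: x_def M_def)
        show "0 \<le> \<kappa>" by (simp add: \<kappa>_def)
        have "x ^ 3 / (4608 * k) = 1 / (18874368 * (real N ^ 3 * k))"
          by (simp add: x_def power_divide power_mult_distrib)
        also have "\<dots> \<ge> 1 / (2 ^ 25 * (real N ^ 3 * k))"
          using N k by (intro divide_left_mono mult_right_mono mult_pos_pos) auto
        finally show "\<kappa> \<le> x ^ 3 / (4608 * k)" by (simp add: \<kappa>_def c_def mult.assoc)
      qed (use x h1 h6 s_def in simp_all)
      have opt: "OPT \<le> W C" for C
      proof (rule assignment_cost_le_W)
        fix g :: "nat \<Rightarrow> nat" assume "\<And>p. p < n \<Longrightarrow> g p < k"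
        then have "assignment_cost f \<le> assignment_cost g" by (rule opt_f(2))
        then show "OPT \<le> assignment_cost g" by (simp add: OPT_def assignment_cost_def S_def)
      qed
      define q where "q = 1 / real Z"
      define \<alpha> where "\<alpha> = 1 / (real L * T)"
      have q: "q \<le> (\<kappa> ^ M / 2) ^ k"
      proof -
        \<comment> \<open>The exponent M + 1 instead of M pays for the factor 1/2, since \<kappa>
          \<le> 1/2.\<close>
        have "q = (\<kappa> ^ M * \<kappa>) ^ k"
          by (simp add: q_def Z_def \<kappa>_def power_divide power_mult power_add power_mult_distrib mult.commute)
        also have "\<dots> \<le> (\<kappa> ^ M * (1 / 2)) ^ k"
        proof (intro power_mono mult_left_mono)
          have "real (c * k) \<ge> 2" using ck by linarith
          then show "\<kappa> \<le> 1 / 2" unfolding \<kappa>_def by (intro divide_left_mono) auto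
        qed (simp_all add: \<kappa>_def)
        finally show ?thesis by simp
      qed
      have q01: "0 \<le> q" "q \<le> 1" using Z1 by (simp_all add: q_def)
      have \<alpha>: "k / (h * x) = \<alpha>"
        using N k T1 L4 by (simp add: h_def h\<^sub>0_def x_def \<alpha>_def field_simps)
      note fail = failure_bound[OF L L4 assms(1) TZ Z1 q_def \<alpha>_def]
      let ?ok = "\<lambda>st :: centers \<times> centers \<times> real. (1 - x) * W (fst (snd st)) \<le> (1 + x) * (1 + 2 * x) * OPT"
      have "1 - \<delta> \<le> 1 - (1 - q / 2) ^ T - (real T + 1) * (k / (h * x))"
        using fail(2) unfolding \<alpha> by linarith
      also have "\<dots> \<le> pr (search T (\<lambda>_ _. 0)) ?ok"
        by (rule pr_search) (use x q q01 fail(1) \<alpha> in auto)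
      finally have prob: "1 - \<delta> \<le> pr (search T (\<lambda>_ _. 0)) ?ok" .
      let ?i = "input_state d k ps"
      let ?S = "sem (fullp d G M c L h\<^sub>0) ?i"
      have cell: "cell d ?i \<rho> j = (if \<rho> < n then X \<rho> j else 0)" if "j < d" for \<rho> j
      proof (cases "\<rho> < n")
        case True
        then have "\<rho> * d + j < n * d" using that by (rule addr_less)
        then show ?thesis using True that by (simp add: cell_def input_state_def X_def ps)
      next
        case False
        then have "n * d \<le> \<rho> * d + j" by (simp add: trans_le_add1)
        then show ?thesis using False by (simp add: cell_def input_state_def ps)
      qed
      have i: "nreg ?i 0 = n" "nreg ?i 1 = k" "nreg ?i 9 = 0"
        "\<And>p j. p < n \<Longrightarrow> j < d \<Longrightarrow> cell d ?i p j = X p j" "\<And>\<rho> j. n \<le> \<rho> \<Longrightarrow> j < d \<Longrightarrow> cell d ?i \<rho> j = 0"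
        using cell by (simp_all add: input_state_def ps(1))
      have s': "s = 2 * (h\<^sub>0 * k * T)\<^sup>2" by (simp add: s_def h_def)
      note correct = fullp_correct[OF i T_def s' d M1 T1 s1]
      have impl: "impl t ?prog ?i ?S" unfolding t_def by (rule correct(1))
      have rel: "rel_pmf (\<lambda>st. output_ok (fst (snd st))) (search T (\<lambda>_ _. 0)) ?S"
        using correct(2) by (simp add: coup_def)
      let ?approx = "\<lambda>u. kmedian_approx d k A \<epsilon> P (output_centers d k u)"
      have "1 - \<delta> \<le> measure_pmf.prob (search T (\<lambda>_ _. 0)) {st. ?ok st}" using prob by (simp add: pr_def)
      \<comment> \<open>The coupling carries the probability over to the final machine
        states.\<close>
      also have "\<dots> \<le> measure_pmf.prob ?S {u. \<exists>st\<in>{st. ?ok st}. output_ok (fst (snd st)) u}"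
        by (rule rel_pmf_measureD[OF rel])
      also have "\<dots> \<le> measure_pmf.prob ?S {u. ?approx u}"
      proof (rule measure_pmf.finite_measure_mono)
        show "{u. \<exists>st\<in>{st. ?ok st}. output_ok (fst (snd st)) u} \<subseteq> {u. ?approx u}"
        proof clarify
          fix u :: ram_state and C\<^sub>1 C :: centers and v :: real
          assume ok: "(1 - x) * W (fst (snd (C\<^sub>1, C, v))) \<le> (1 + x) * (1 + 2 * x) * OPT"
            and out: "output_ok (fst (snd (C\<^sub>1, C, v))) u"
          have "W C \<le> (1 + \<epsilon>) * OPT"
            by (rule approximation_factor[OF x(1,4) \<epsilon>(2) OPT_nonneg]) (use ok in simp)
          then show "?approx u"
            unfolding ps(4) using out
            by (intro output_approx[OF B ps(1-3) _ _ opt _ \<epsilon>(1)]) (auto simp: X_def fun_eq_iff)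
        qed
      qed simp
      also have "\<dots> = measure_pmf.prob (run t (?prog, ?i)) {cfg. ?approx (snd cfg)}"
        using impl by (simp add: impl_def vimage_def)
      finally have "measure_pmf.prob (run t (?prog, ?i)) {cfg. ?approx (snd cfg)} \<ge> 1 - \<delta>" .
      moreover have "halts_within t ?prog ?i" by (rule impl_halts[OF impl])
      moreover have "real t \<le> (3000 * real L ^ 5) * real n * real d *
          2 powr (25000 * ((real k)\<^sup>2 / \<epsilon>) * (log 2 ((real k)\<^sup>2 / \<epsilon>)) ^ 1)"
        unfolding t_def
        by (rule time_bound[OF \<epsilon> k N_def M_def]) (simp_all add: T_def c_def s' h\<^sub>0_def)
      ultimately show "\<exists>t::nat.
             real t \<le> (3000 * real L ^ 5) * real n * real d *
                2 powr (25000 * ((real k)\<^sup>2 / \<epsilon>) * (log 2 ((real k)\<^sup>2 / \<epsilon>)) ^ 1) \<and>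
             halts_within t ?prog (input_state d k ps) \<and>
             measure_pmf.prob (run t (?prog, input_state d k ps))
               {cfg. kmedian_approx d k A \<epsilon> P (output_centers d k (snd cfg))} \<ge> 1 - \<delta>"
        by blast
    qed
  qed
  have "3000 * real L ^ 5 > 0" using L4 by simp
  then show ?thesis
    using main by (intro exI[of _ "3000 * real L ^ 5"] exI[of _ "25000::real"] exI[of _ "1::nat"]) auto
qed

end
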